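(* Let $\Omega\subset\mathbb{C}$ be a bounded domain such that there is a rational function $f$ with $f(\infty)=\infty$ whose restriction to $\Omega$ is a $p$-valent proper map $f:\Omega\to\mathbb{D}$ onto the unit disk $\mathbb{D}=\{z\in\mathbb{C}:|z|<1\}$. Let $n=\deg f$ be the degree of $f$ as a rational function. If $n>p$, then the exponential transform $E_\Omega(z,w)$ is not a rational function for $z$ and $w$ in the unbounded component of $\mathbb{C}\setminus\overline{\Omega}$; that is, there is no rational function of the two variables $z$ and $\bar w$ which coincides with $E_\Omega(z,w)$ for all $z,w$ in the unbounded component of $\mathbb{C}\setminus\overline{\Omega}$.
   Context: For a bounded domain $\Omega\subset\mathbb{C}$, the exponential transform of $\Omega$ is the function of $z,w\in\mathbb{C}\setminus\overline{\Omega}$ defined by $$E_\Omega(z,w)=\exp\left[\frac{1}{2\pi i}\int_\Omega \frac{d\zeta}{\zeta-z}\wedge\frac{d\bar\zeta}{\bar\zeta-\bar w}\right].$$ A rational function $f$ with $f(\infty)=\infty$ is written $f=A/B$ with $A,B$ relatively prime polynomials and $\deg A>\deg B$; its degree is $\deg f=\max\{\deg A,\deg B\}=\deg A$. A proper holomorphic map $f:\Omega\to\mathbb{D}$ is $p$-valent if every point of $\mathbb{D}$ has exactly $p$ preimages in $\Omega$, counted with multiplicity. *)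

theory Defs
  imports "HOL-Complex_Analysis.Complex_Analysis" "HOL-Computational_Algebra.Polynomial"
begin

(* The 2-form d\<zeta> \<and> d(cnj \<zeta>) equals -2 * \<i> times Lebesgue area measure. *)
definition exp_transform :: "complex set \<Rightarrow> complex \<Rightarrow> complex \<Rightarrow> complex" where
  "exp_transform \<Omega> z w =
     exp (1 / (2 * of_real pi * \<i>) *
          (LINT \<zeta>:\<Omega>|lborel. (- 2 * \<i>) / ((\<zeta> - z) * (cnj \<zeta> - cnj w))))"

(* For a zero z of f - w, zorder (f - w) z is the multiplicity of z as a preimage of w. 
   Finiteness of the fibre is explicit because sums over infinite sets are 0. *)
definition valent_proper_map :: "nat \<Rightarrow> complex set \<Rightarrow> (complex \<Rightarrow> complex) \<Rightarrow> bool" where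
  "valent_proper_map p \<Omega> f \<longleftrightarrow>
     f holomorphic_on \<Omega> \<and>
     f ` \<Omega> = ball 0 1 \<and>
     proper_map (top_of_set \<Omega>) (top_of_set (ball 0 1)) f \<and>
     (\<forall>w\<in>ball 0 1. finite {z \<in> \<Omega>. f z = w} \<and>
        (\<Sum>z\<in>{z \<in> \<Omega>. f z = w}. zorder (\<lambda>\<zeta>. f \<zeta> - w) z) = int p)"

(* A bivariate polynomial is a polynomial in the first variable x whose coefficients are
   polynomials in the second variable y. *)
definition poly2 :: "complex poly poly \<Rightarrow> complex \<Rightarrow> complex \<Rightarrow> complex" where
  "poly2 P x y = poly (poly P [:x:]) y"

(* A rational function P / Q in z and cnj w; to coincide with F on all of U \<times> U it has to be
   defined there, hence the nonvanishing of the denominator. *)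
definition rational_in_z_cnj_w_on ::
    "complex set \<Rightarrow> (complex \<Rightarrow> complex \<Rightarrow> complex) \<Rightarrow> bool" where
  "rational_in_z_cnj_w_on U F \<longleftrightarrow>
     (\<exists>P Q. Q \<noteq> 0 \<and>
        (\<forall>z\<in>U. \<forall>w\<in>U. poly2 Q z (cnj w) \<noteq> 0 \<and>
                       F z w = poly2 P z (cnj w) / poly2 Q z (cnj w)))"

end

theory Submission
  imports Defs "HOL-Computational_Algebra.Fundamental_Theorem_Algebra"
    "HOL-Computational_Algebra.Polynomial_Factorial" "HOL-Computational_Algebra.Field_as_Ring"
begin

text \<open>
Let f = A / B and n = deg A, write E(z, w) for the exponential transform, U for the unbounded complementary
component, and f* y = cnj (f (cnj y)). Suppose that E(z, w) = P(z, cnj w) / Q(z, cnj w) on U \<times> U. The proof shows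
that n divides p; since p > 0, this is impossible for p < n.

The logarithm of E(z, w) is a Cauchy transform over \<Omega>, whose d-bar derivative in \<Omega> is that of
log (cnj z - cnj w). So E(z, w) is continuous and free of zeros in the plane, holomorphic in z off the closure of \<Omega>, and
E(z, w) / (cnj z - cnj w) is holomorphic in \<Omega>. As |f| = 1 on the boundary, Liouville's theorem turns these facts into a
formula for |u| > 1 (\<open>product_formula\<close>): the product of E(z, w) over the n solutions z of f z = u is a
factor c(w), which does not depend on u, times the product of cnj \<zeta> - cnj w over the p points \<zeta> \<in> \<Omega> with
f \<zeta> = 1 / cnj u.

Suppose first that the complement of the closure of \<Omega> is connected. Then all z lie in U, and the left-hand side is a
rational function of u and y = cnj w. Apart from the factor c(w), it vanishes to first order at the p points y = cnj \<zeta>,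
which are among the n solutions y of u f* y = 1, and it does not vanish at the others. But this equation is linear in u, so that it defines an
irreducible curve, along which a rational function has the same order at all but finitely many points
(\<open>order_along_linear_curve\<close>). So the total order over the n solutions is a multiple of n, and it equals p.

If \<Omega> has holes, then E(z, w) need not equal P / Q for z in a hole. Across an arc of the boundary of U one
continues the identity E Q = P into \<Omega>: there E(z, w) Q = P (cnj z - cnj w) / (S(z) - cnj w), where the Schwarz function
S of the arc extends meromorphically to \<Omega> and satisfies f z f* (S z) = 1. Across the boundary of a hole cnj z is
replaced by the Schwarz function T of that boundary, and this gives E Q (S - cnj w) = P (T - cnj w) in the
hole (\<open>component_matched\<close>). Each factor (T - y) / (S - y) has one zero and one pole among the n solutions of
u f* y = 1, or is 1, and so leaves the total order unchanged: it is still p, and n divides it.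
\<close>

section \<open>Cauchy transforms of bounded densities\<close>

lemma lborel_Complex: "distr (lborel \<Otimes>\<^sub>M lborel) borel (\<lambda>(x, y). Complex x y) = lborel"
proof (rule lborel_eqI[symmetric])
  have meas[measurable]: "(\<lambda>(x, y). Complex x y) \<in> lborel \<Otimes>\<^sub>M lborel \<rightarrow>\<^sub>M borel"
    by (simp add: Complex_eq case_prod_unfold)
  fix l u :: complex
  assume le: "\<And>b. b \<in> Basis \<Longrightarrow> l \<bullet> b \<le> u \<bullet> b"
  have le': "Re l \<le> Re u" "Im l \<le> Im u" using le[of 1] le[of \<i>] by (auto simp: Basis_complex_def)
  have "(\<lambda>(x, y). Complex x y) -` box l u = box (Re l) (Re u) \<times> box (Im l) (Im u)"
    by (auto simp: box_def Basis_complex_def)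
  then show "emeasure (distr (lborel \<Otimes>\<^sub>M lborel) borel (\<lambda>(x, y). Complex x y)) (box l u) = (\<Prod>b\<in>Basis. (u - l) \<bullet> b)"
    using le'
    by (simp add: emeasure_distr space_pair_measure lborel.emeasure_pair_measure_Times Basis_complex_def ennreal_mult)
qed simp

text \<open>The kernel 1 / |\<zeta> - z| is locally integrable in the plane: on the dyadic annulus of radii
\<open>r / 2^(k+1)\<close> and \<open>r / 2^k\<close> it is at most \<open>2^(k+1) / r\<close>, whereas the area of the disc around it is only
\<open>\<pi> r\<^sup>2 / 4^k\<close>, so that the annuli contribute a geometric series.\<close>

lemma nn_integral_inverse_dist_le:
  fixes z :: complex
  assumes r: "0 < r"
  shows "(\<integral>\<^sup>+\<zeta>. ennreal (1 / norm (\<zeta> - z)) * indicator (ball z r) \<zeta> \<partial>lborel) \<le> ennreal (4 * pi * r)"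
proof -
  let ?B = "\<lambda>k::nat. ball z (r / 2 ^ k)"
  have "(\<integral>\<^sup>+\<zeta>. ennreal (1 / norm (\<zeta> - z)) * indicator (ball z r) \<zeta> \<partial>lborel)
      \<le> (\<integral>\<^sup>+\<zeta>. (\<Sum>k. ennreal (2 ^ (k + 1) / r) * indicator (?B k) \<zeta>) \<partial>lborel)"
  proof (rule nn_integral_mono)
    fix \<zeta> :: complex
    let ?s = "\<lambda>k. ennreal (2 ^ (k + 1) / r) * indicator (?B k) \<zeta>"
    show "ennreal (1 / norm (\<zeta> - z)) * indicator (ball z r) \<zeta> \<le> (\<Sum>k. ?s k)"
    proof (cases "\<zeta> \<in> ball z r \<and> \<zeta> \<noteq> z")
      case False
      then show ?thesis by auto
    next
      case True
      then have n: "0 < norm (\<zeta> - z)" "norm (\<zeta> - z) < r" by (auto simp: dist_norm norm_minus_commute)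
      have ex: "\<exists>k. r / 2 ^ k \<le> norm (\<zeta> - z)"
      proof -
        obtain k where "(1/2) ^ k < norm (\<zeta> - z) / r"
          using real_arch_pow_inv[of "norm (\<zeta> - z) / r" "1/2"] n r by auto
        then show ?thesis using r by (intro exI[of _ k]) (auto simp: field_simps power_divide)
      qed
      define m where "m = (LEAST k. r / 2 ^ k \<le> norm (\<zeta> - z))"
      have m: "r / 2 ^ m \<le> norm (\<zeta> - z)" unfolding m_def using ex by (rule LeastI_ex)
      have "m \<noteq> 0" using m n by (intro notI) auto
      then obtain k where k: "m = Suc k" by (cases m) auto
      have "\<not> r / 2 ^ k \<le> norm (\<zeta> - z)" using not_less_Least[of k "\<lambda>k. r / 2 ^ k \<le> norm (\<zeta> - z)"] k m_def by auto
      then have "\<zeta> \<in> ?B k" by (auto simp: dist_norm norm_minus_commute)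
      moreover have "1 / norm (\<zeta> - z) \<le> 2 ^ (k + 1) / r" using m k n r by (auto simp: field_simps)
      ultimately have "ennreal (1 / norm (\<zeta> - z)) * indicator (ball z r) \<zeta> \<le> ?s k"
        using True r by (auto simp: ennreal_leI)
      also have "?s k = sum ?s {k}" by (simp only: sum.insert finite.emptyI empty_iff not_False_eq_True sum.empty add_0_right)
      also have "\<dots> \<le> (\<Sum>k. ?s k)" by (rule sum_le_suminf) auto
      finally show ?thesis .
    qed
  qed
  also have "\<dots> = (\<Sum>k. (\<integral>\<^sup>+\<zeta>. ennreal (2 ^ (k + 1) / r) * indicator (?B k) \<zeta> \<partial>lborel))"
    by (intro nn_integral_suminf borel_measurable_times_ennreal borel_measurable_indicator) auto
  also have "\<dots> = (\<Sum>k. ennreal (2 * pi * r * (1/2) ^ k))"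
  proof (rule suminf_cong)
    fix k :: nat
    have "(\<integral>\<^sup>+\<zeta>. ennreal (2 ^ (k + 1) / r) * indicator (?B k) \<zeta> \<partial>lborel) = ennreal (2 ^ (k + 1) / r) * emeasure lborel (?B k)"
      by (subst nn_integral_cmult_indicator) auto
    also have "emeasure lborel (?B k) = ennreal (pi * (r / 2 ^ k)\<^sup>2)"
      using r by (subst emeasure_ball) (auto simp: unit_ball_vol_2)
    also have "ennreal (2 ^ (k + 1) / r) * \<dots> = ennreal (2 ^ (k + 1) / r * (pi * (r / 2 ^ k)\<^sup>2))"
      using r by (subst ennreal_mult) auto
    also have "2 ^ (k + 1) / r * (pi * (r / 2 ^ k)\<^sup>2) = 2 * pi * r * (1/2) ^ k"
      using r by (auto simp: field_simps power2_eq_square power_divide)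
    finally show "(\<integral>\<^sup>+\<zeta>. ennreal (2 ^ (k + 1) / r) * indicator (?B k) \<zeta> \<partial>lborel) = ennreal (2 * pi * r * (1/2) ^ k)" .
  qed
  also have "\<dots> = ennreal (4 * pi * r)"
  proof (rule suminf_ennreal_eq)
    have "(\<lambda>k. (2 * pi * r) * (1/2) ^ k) sums ((2 * pi * r) * (1 / (1 - 1/2)))"
      by (intro sums_mult geometric_sums) auto
    then show "(\<lambda>k. 2 * pi * r * (1/2) ^ k) sums (4 * pi * r)" by (simp add: mult_ac)
  qed (use r in auto)
  finally show ?thesis .
qed

lemma inverse_dist_near:
  fixes z :: complex
  assumes r: "0 < r"
  shows "integrable lborel (\<lambda>\<zeta>. indicator (ball z r) \<zeta> / norm (\<zeta> - z))" (is ?I)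
    and "(\<integral>\<zeta>. indicator (ball z r) \<zeta> / norm (\<zeta> - z) \<partial>lborel) \<le> 4 * pi * r" (is ?J)
proof -
  have eq: "ennreal (indicator (ball z r) \<zeta> / norm (\<zeta> - z)) = ennreal (1 / norm (\<zeta> - z)) * indicator (ball z r) \<zeta>" for \<zeta>
    by (auto simp: indicator_def)
  have nn: "(\<integral>\<^sup>+\<zeta>. ennreal (indicator (ball z r) \<zeta> / norm (\<zeta> - z)) \<partial>lborel) \<le> ennreal (4 * pi * r)"
    unfolding eq by (rule nn_integral_inverse_dist_le[OF r])
  show I: ?I
    by (rule integrableI_nonneg) (use nn in \<open>auto intro: le_less_trans intro!: borel_measurable_divide borel_measurable_indicator\<close>)
  have "ennreal (\<integral>\<zeta>. indicator (ball z r) \<zeta> / norm (\<zeta> - z) \<partial>lborel) \<le> ennreal (4 * pi * r)"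
    using nn by (subst nn_integral_eq_integral[OF I, symmetric]) auto
  then show ?J using r by (simp add: ennreal_le_iff)
qed

definition cauchy_transform :: "(complex \<Rightarrow> complex) \<Rightarrow> complex \<Rightarrow> complex" where
  "cauchy_transform b z = (\<integral>\<zeta>. b \<zeta> / (\<zeta> - z) \<partial>lborel)"

text \<open>The two data that all estimates depend on: a bound for the density, and a disc outside which it vanishes.\<close>
definition bounded_density :: "real \<Rightarrow> real \<Rightarrow> (complex \<Rightarrow> complex) \<Rightarrow> bool" where
  "bounded_density M \<rho> b \<longleftrightarrow> 0 \<le> M \<and> b \<in> borel_measurable borel \<and> (\<forall>\<zeta>. norm (b \<zeta>) \<le> M * indicator (ball 0 \<rho>) \<zeta>)"

lemma integrable_indicator_ball: "integrable lborel (indicator (ball (a::complex) r) :: complex \<Rightarrow> real)"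
  using emeasure_lborel_ball_finite[of a r] by (intro integrable_real_indicator) auto

lemma cauchy_kernel_le: "1 / norm (\<zeta> - z) \<le> indicator (ball z 1) \<zeta> / norm (\<zeta> - z) + 1" for z :: complex
proof (cases "\<zeta> \<in> ball z 1")
  case False
  then have "1 \<le> norm (\<zeta> - z)" by (auto simp: dist_norm norm_minus_commute)
  then have "1 / norm (\<zeta> - z) \<le> 1" by (auto simp: divide_le_eq_1)
  then show ?thesis using False by simp
qed simp

lemma
  assumes b: "bounded_density M \<rho> b"
  shows integrable_cauchy_kernel: "integrable lborel (\<lambda>\<zeta>. b \<zeta> / (\<zeta> - z))"
    and norm_cauchy_transform_le: "norm (cauchy_transform b z) \<le> M * (4 * pi + measure lborel (ball (0::complex) \<rho>))"
proof -
  have [measurable]: "b \<in> borel_measurable borel" and M: "0 \<le> M" and bd: "\<And>\<zeta>. norm (b \<zeta>) \<le> M * indicator (ball 0 \<rho>) \<zeta>"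
    using b by (auto simp: bounded_density_def)
  let ?g = "\<lambda>\<zeta>. M * (indicator (ball z 1) \<zeta> / norm (\<zeta> - z) + indicator (ball 0 \<rho>) \<zeta>) :: real"
  have gi: "integrable lborel ?g"
    by (intro integrable_mult_right Bochner_Integration.integrable_add inverse_dist_near integrable_indicator_ball) auto
  have le: "norm (b \<zeta> / (\<zeta> - z)) \<le> ?g \<zeta>" for \<zeta>
  proof (cases "\<zeta> \<in> ball 0 \<rho>")
    case True
    have "norm (b \<zeta> / (\<zeta> - z)) = norm (b \<zeta>) * (1 / norm (\<zeta> - z))" by (simp add: norm_divide)
    also have "\<dots> \<le> M * (indicator (ball z 1) \<zeta> / norm (\<zeta> - z) + 1)"
      using bd[of \<zeta>] True M by (intro mult_mono cauchy_kernel_le) auto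
    finally show ?thesis using True by simp
  next
    case False
    then show ?thesis using bd[of \<zeta>] M by simp
  qed
  show i: "integrable lborel (\<lambda>\<zeta>. b \<zeta> / (\<zeta> - z))"
    by (rule Bochner_Integration.integrable_bound[OF gi]) (use le in \<open>auto intro!: AE_I2 intro: order_trans[OF le]\<close>)
  have "norm (cauchy_transform b z) \<le> (\<integral>\<zeta>. ?g \<zeta> \<partial>lborel)"
    unfolding cauchy_transform_def using i gi le by (intro Bochner_Integration.integral_norm_bound_integral) auto
  also have "\<dots> = M * ((\<integral>\<zeta>. indicator (ball z 1) \<zeta> / norm (\<zeta> - z) \<partial>lborel) + measure lborel (ball (0::complex) \<rho>))"
    using integrable_indicator_ball[of 0 \<rho>] inverse_dist_near(1)[of 1 z] by simp
  also have "\<dots> \<le> M * (4 * pi + measure lborel (ball (0::complex) \<rho>))"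
    using inverse_dist_near(2)[of 1 z] M by (intro mult_left_mono) auto
  finally show "norm (cauchy_transform b z) \<le> M * (4 * pi + measure lborel (ball (0::complex) \<rho>))" .
qed

text \<open>Cutting the kernel off at distance e makes it continuous and bounded, so that the truncated transform is
continuous by dominated convergence. The truncation changes the transform by at most 4 \<pi> M e at every
point, because the integral of 1 / |\<zeta> - z| over a disc of radius e is at most 4 \<pi> e. Hence the transform is a
uniform limit of continuous functions.\<close>

lemma continuous_cauchy_transform:
  assumes b: "bounded_density M \<rho> b"
  shows "continuous_on UNIV (cauchy_transform b)"
proof -
  have [measurable]: "b \<in> borel_measurable borel" and M: "0 \<le> M" and bd: "\<And>\<zeta>. norm (b \<zeta>) \<le> M * indicator (ball 0 \<rho>) \<zeta>"
    using b by (auto simp: bounded_density_def)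
  \<comment> \<open>The kernel \<open>1 / x = cnj x / |x|\<^sup>2\<close> with \<open>|x|\<close> replaced by \<open>max |x| e\<close> in the denominator.\<close>
  define k :: "real \<Rightarrow> complex \<Rightarrow> complex" where "k e x = cnj x / of_real ((max (norm x) e)\<^sup>2)" for e x
  have k_cont: "continuous_on UNIV (k e)" if "0 < e" for e
    unfolding k_def using that by (intro continuous_intros) (auto simp: max_def)
  have k_meas[measurable]: "(\<lambda>\<zeta>. k e (\<zeta> - z)) \<in> borel_measurable borel" if "0 < e" for e z
    using k_cont[OF that] by (intro borel_measurable_continuous_onI continuous_on_compose2[OF k_cont[OF that]] continuous_intros) auto
  have k_norm: "norm (k e x) \<le> 1 / e" if "0 < e" for e x
  proof -
    have "norm (k e x) = norm x / (max (norm x) e)\<^sup>2" by (simp add: k_def norm_divide norm_power)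
    also have "\<dots> \<le> max (norm x) e / (max (norm x) e)\<^sup>2" by (intro divide_right_mono) auto
    also have "\<dots> = 1 / max (norm x) e" using that by (simp add: power2_eq_square)
    also have "\<dots> \<le> 1 / e" using that by (intro divide_left_mono) auto
    finally show ?thesis .
  qed
  have k_far: "k e x = 1 / x" if "0 < e" "e \<le> norm x" for e x
  proof -
    have "x \<noteq> 0" using that by auto
    moreover have "x * cnj x = of_real ((norm x)\<^sup>2)" by (rule complex_norm_square[symmetric])
    ultimately show ?thesis using that by (simp add: k_def max_def field_simps)
  qed
  have k_near: "norm (1 / x - k e x) \<le> 1 / norm x" if e: "0 < e" "norm x < e" for e x
  proof (cases "x = 0")
    case False
    have "x * cnj x = of_real ((norm x)\<^sup>2)" by (rule complex_norm_square[symmetric])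
    then have "1 / x - k e x = (1 / x) * of_real (1 - (norm x)\<^sup>2 / e\<^sup>2)"
      using e False by (simp add: k_def max_def field_simps)
    then have "norm (1 / x - k e x) = (1 / norm x) * \<bar>1 - (norm x)\<^sup>2 / e\<^sup>2\<bar>"
      by (simp add: norm_mult norm_divide del: of_real_diff)
    also have "\<bar>1 - (norm x)\<^sup>2 / e\<^sup>2\<bar> \<le> 1"
      using e power_mono[of "norm x" e 2] by (auto simp: abs_le_iff divide_le_eq_1)
    finally show ?thesis by (simp add: divide_right_mono)
  qed (auto simp: k_def)
  define T where "T e z = (\<integral>\<zeta>. b \<zeta> * k e (\<zeta> - z) \<partial>lborel)" for e z
  have dom: "norm (b \<zeta> * k e (\<zeta> - z)) \<le> M / e * indicator (ball 0 \<rho>) \<zeta>" if "0 < e" for e \<zeta> z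
    using mult_mono[OF bd k_norm[OF that, of "\<zeta> - z"]] M that by (auto simp: norm_mult)
  have domi: "integrable lborel (\<lambda>\<zeta>. M / e * indicator (ball (0::complex) \<rho>) \<zeta> :: real)" for e
    by (intro integrable_mult_right integrable_indicator_ball)
  have Ti: "integrable lborel (\<lambda>\<zeta>. b \<zeta> * k e (\<zeta> - z))" if e: "0 < e" for e z
  proof (rule Bochner_Integration.integrable_bound[OF domi[of e]])
    show "AE \<zeta> in lborel. norm (b \<zeta> * k e (\<zeta> - z)) \<le> norm (M / e * indicator (ball (0::complex) \<rho>) \<zeta>)"
      using order_trans[OF dom[OF e] abs_ge_self] by (intro AE_I2) (simp only: real_norm_def)
  qed (use e in auto)
  have T_cont: "continuous_on UNIV (T e)" if e: "0 < e" for e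
    unfolding continuous_on_sequentially
  proof (intro ballI allI impI, elim conjE)
    fix a :: complex and X :: "nat \<Rightarrow> complex"
    assume X: "X \<longlonglongrightarrow> a"
    show "(T e \<circ> X) \<longlonglongrightarrow> T e a"
      unfolding T_def comp_def
    proof (rule integral_dominated_convergence[OF _ _ domi[of e]])
      show "AE \<zeta> in lborel. (\<lambda>i. b \<zeta> * k e (\<zeta> - X i)) \<longlonglongrightarrow> b \<zeta> * k e (\<zeta> - a)"
      proof (intro AE_I2 tendsto_mult tendsto_const)
        fix \<zeta>
        show "(\<lambda>i. k e (\<zeta> - X i)) \<longlonglongrightarrow> k e (\<zeta> - a)"
          by (rule continuous_on_tendsto_compose[OF k_cont[OF e]]) (auto intro!: tendsto_intros X)
      qed
    qed (use e dom in auto)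
  qed
  have close: "dist (T e z) (cauchy_transform b z) \<le> M * (4 * pi * e)" if e: "0 < e" for e z
  proof -
    have ig: "integrable lborel (\<lambda>\<zeta>. M * (indicator (ball z e) \<zeta> / norm (\<zeta> - z)))"
      by (intro integrable_mult_right inverse_dist_near e)
    have "dist (T e z) (cauchy_transform b z) = norm (\<integral>\<zeta>. b \<zeta> / (\<zeta> - z) - b \<zeta> * k e (\<zeta> - z) \<partial>lborel)"
      unfolding T_def cauchy_transform_def using integrable_cauchy_kernel[OF b] Ti[OF e]
      by (subst Bochner_Integration.integral_diff) (auto simp: dist_norm norm_minus_commute)
    also have "\<dots> \<le> (\<integral>\<zeta>. M * (indicator (ball z e) \<zeta> / norm (\<zeta> - z)) \<partial>lborel)"
    proof (rule Bochner_Integration.integral_norm_bound_integral)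
      show "norm (b \<zeta> / (\<zeta> - z) - b \<zeta> * k e (\<zeta> - z)) \<le> M * (indicator (ball z e) \<zeta> / norm (\<zeta> - z))" for \<zeta>
      proof (cases "\<zeta> \<in> ball z e")
        case True
        then have "norm (\<zeta> - z) < e" by (auto simp: dist_norm norm_minus_commute)
        then have "norm (1 / (\<zeta> - z) - k e (\<zeta> - z)) \<le> 1 / norm (\<zeta> - z)" by (rule k_near[OF e])
        moreover have "norm (b \<zeta>) \<le> M" using bd[of \<zeta>] M by (auto simp: indicator_def split: if_splits intro: order_trans)
        moreover have "b \<zeta> / (\<zeta> - z) - b \<zeta> * k e (\<zeta> - z) = b \<zeta> * (1 / (\<zeta> - z) - k e (\<zeta> - z))" by (simp add: algebra_simps)
        ultimately show ?thesis using True M by (auto simp: norm_mult simp del: times_divide_eq_right intro!: mult_mono)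
      next
        case False
        then have "e \<le> norm (\<zeta> - z)" by (auto simp: dist_norm norm_minus_commute)
        then show ?thesis using False k_far[OF e] by simp
      qed
    qed (use integrable_cauchy_kernel[OF b] Ti[OF e] ig in auto)
    also have "\<dots> = M * (\<integral>\<zeta>. indicator (ball z e) \<zeta> / norm (\<zeta> - z) \<partial>lborel)"
      by (rule integral_mult_right_zero)
    also have "\<dots> \<le> M * (4 * pi * e)"
      using inverse_dist_near[OF e, of z] M by (intro mult_left_mono)
    finally show ?thesis .
  qed
  have "uniform_limit UNIV (\<lambda>n. T (1 / real (Suc n))) (cauchy_transform b) sequentially"
    unfolding uniform_limit_iff
  proof (intro allI impI)
    fix d :: real assume d: "0 < d"
    have "(\<lambda>n. M * (4 * pi * (1 / real (Suc n)))) \<longlonglongrightarrow> M * (4 * pi * 0)"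
      by (intro tendsto_intros LIMSEQ_Suc[OF lim_1_over_n])
    then have "\<forall>\<^sub>F n in sequentially. M * (4 * pi * (1 / real (Suc n))) < d"
      using d by (intro order_tendstoD(2)) auto
    then show "\<forall>\<^sub>F n in sequentially. \<forall>x\<in>UNIV. dist (T (1 / real (Suc n)) x) (cauchy_transform b x) < d"
    proof eventually_elim
      case (elim n)
      then show ?case using le_less_trans[OF close[of "1 / real (Suc n)"]] by auto
    qed
  qed
  then show ?thesis
    by (rule uniform_limit_theorem[rotated]) (auto intro!: always_eventually T_cont)
qed

section \<open>The Cauchy transform of a rectangle\<close>

lemma Ln_vertical_deriv:
  assumes "Re c > 0"
  shows "((\<lambda>y. - \<i> * ((c + \<i> * of_real y) * Ln (c + \<i> * of_real y) - (c + \<i> * of_real y)))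
           has_vector_derivative Ln (c + \<i> * of_real y)) (at y within S)"
proof -
  have "c + \<i> * of_real y \<notin> \<real>\<^sub>\<le>\<^sub>0" using assms by (auto simp: complex_nonpos_Reals_iff)
  moreover from this have "c + \<i> * of_real y \<noteq> 0" by (metis nonpos_Reals_zero_I)
  ultimately have "((\<lambda>w. w * Ln w - w) has_field_derivative Ln (c + \<i> * of_real y)) (at (c + \<i> * of_real y))"
    by (auto intro!: derivative_eq_intros)
  then have "((\<lambda>w. (c + \<i> * w) * Ln (c + \<i> * w) - (c + \<i> * w)) has_field_derivative Ln (c + \<i> * of_real y) * \<i>) (at (of_real y))"
    by (rule DERIV_chain2[where g="\<lambda>w. c + \<i> * w"]) (auto intro!: derivative_eq_intros)
  then have "((\<lambda>w. - \<i> * ((c + \<i> * w) * Ln (c + \<i> * w) - (c + \<i> * w)))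
           has_field_derivative - \<i> * (Ln (c + \<i> * of_real y) * \<i>)) (at (of_real y))"
    by (rule DERIV_cmult)
  then have "((\<lambda>w. - \<i> * ((c + \<i> * w) * Ln (c + \<i> * w) - (c + \<i> * w)))
           has_field_derivative Ln (c + \<i> * of_real y)) (at (of_real y))"
    by (simp add: algebra_simps)
  from has_vector_derivative_real_field[OF this] show ?thesis .
qed

text \<open>Along a horizontal line the kernel has the primitive Ln. The term at the left end is rewritten with Ln (- x), which
is holomorphic there; the price is the jump \<plusminus> \<i> \<pi> of the logarithm across the height of z.\<close>

lemma inverse_horizontal_integral:
  assumes ab: "a < Re z" "Re z < b" and y: "y \<noteq> Im z"
  shows "(\<integral>x. indicator {a..b} x *\<^sub>R (1 / (Complex x y - z)) \<partial>lborel)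
           = Ln (of_real b - z + \<i> * of_real y) - Ln (z - of_real a - \<i> * of_real y) - \<i> * of_real (pi * sgn (y - Im z))"
proof -
  have Cx: "Complex x y - z = of_real x - z + \<i> * of_real y" for x by (simp add: complex_eq_iff)
  have nr: "of_real x - z + \<i> * of_real y \<notin> \<real>\<^sub>\<le>\<^sub>0" for x
    using y by (auto simp: complex_nonpos_Reals_iff)
  then have nz: "of_real x - z + \<i> * of_real y \<noteq> 0" for x by (metis nonpos_Reals_zero_I)
  have "(\<integral>x. indicator {a..b} x *\<^sub>R (1 / (of_real x - z + \<i> * of_real y)) \<partial>lborel)
      = Ln (of_real b - z + \<i> * of_real y) - Ln (of_real a - z + \<i> * of_real y)"
  proof (rule integral_FTC_Icc)
    show "a \<le> b" using ab by simp
    show "continuous_on {a..b} (\<lambda>x. 1 / (complex_of_real x - z + \<i> * of_real y))"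
      using nz by (intro continuous_intros) auto
    fix x assume "a \<le> x" "x \<le> b"
    have "((\<lambda>w. Ln (w - z + \<i> * of_real y)) has_field_derivative 1 / (of_real x - z + \<i> * of_real y)) (at (of_real x))"
      using nr[of x] nz[of x] by (auto intro!: derivative_eq_intros simp: field_simps)
    from has_vector_derivative_real_field[OF this]
    show "((\<lambda>x. Ln (of_real x - z + \<i> * of_real y)) has_vector_derivative 1 / (of_real x - z + \<i> * of_real y)) (at x within {a..b})" .
  qed
  moreover have "Ln (of_real a - z + \<i> * of_real y) = Ln (z - of_real a - \<i> * of_real y) + \<i> * of_real (pi * sgn (y - Im z))"
    using Ln_minus[of "z - of_real a - \<i> * of_real y"] nz[of a] ab y
    by (auto simp: sgn_if algebra_simps complex_eq_iff)
  ultimately show ?thesis by (simp add: Cx)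
qed

lemma integral_sgn_Icc:
  assumes "c < t" "t < d"
  shows "has_bochner_integral lborel (\<lambda>y. indicator {c..d} y * sgn (y - t)) (c + d - 2 * t :: real)"
proof -
  have "has_bochner_integral lborel (\<lambda>y. indicator {t..d} y *\<^sub>R (1::real)) (d - t)"
    using assms by (intro has_bochner_integral_FTC_Icc[where F="\<lambda>x. x"]) (auto intro!: derivative_eq_intros)
  moreover have "has_bochner_integral lborel (\<lambda>y. indicator {c..t} y *\<^sub>R (1::real)) (t - c)"
    using assms by (intro has_bochner_integral_FTC_Icc[where F="\<lambda>x. x"]) (auto intro!: derivative_eq_intros)
  ultimately have "has_bochner_integral lborel (\<lambda>y. indicator {t..d} y *\<^sub>R (1::real) - indicator {c..t} y *\<^sub>R 1) ((d - t) - (t - c))"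
    by (rule has_bochner_integral_diff)
  moreover have "AE y in lborel. indicator {t..d} y *\<^sub>R (1::real) - indicator {c..t} y *\<^sub>R 1 = indicator {c..d} y * sgn (y - t)"
    using AE_lborel_singleton[of t] by eventually_elim (use assms in \<open>auto simp: indicator_def sgn_if\<close>)
  ultimately show ?thesis
    by (subst has_bochner_integral_cong_AE[symmetric]) (auto simp: algebra_simps)
qed

definition rect_density :: "real \<Rightarrow> real \<Rightarrow> real \<Rightarrow> real \<Rightarrow> complex \<Rightarrow> complex" where
  "rect_density a b c d \<zeta> = indicator {a..b} (Re \<zeta>) * indicator {c..d} (Im \<zeta>)"

lemma rect_density_measurable[measurable]: "rect_density a b c d \<in> borel_measurable borel"
  unfolding rect_density_def[abs_def] by measurable

lemma rect_density_bounded: "\<exists>\<rho>. bounded_density 1 \<rho> (rect_density a b c d)"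
proof -
  define \<rho> where "\<rho> = \<bar>a\<bar> + \<bar>b\<bar> + \<bar>c\<bar> + \<bar>d\<bar> + 1"
  have "norm (rect_density a b c d \<zeta>) \<le> indicator (ball 0 \<rho>) \<zeta>" for \<zeta>
  proof (cases "Re \<zeta> \<in> {a..b} \<and> Im \<zeta> \<in> {c..d}")
    case True
    then have "norm \<zeta> < \<rho>" using cmod_le[of \<zeta>] unfolding \<rho>_def by auto
    then show ?thesis using True by (auto simp: rect_density_def)
  qed (auto simp: rect_density_def)
  then show ?thesis by (intro exI[of _ \<rho>]) (auto simp: bounded_density_def)
qed

text \<open>The d-bar derivative of the transform can be read off for a rectangle. Integrating the horizontal
integrals over the height, every logarithm contributes a holomorphic function of z, and the sign
contributes - \<i> \<pi> (c + d - 2 Im z), which is - \<pi> cnj z up to a holomorphic term.\<close>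

lemma cauchy_transform_rect:
  assumes z: "a < Re z" "Re z < b" "c < Im z" "Im z < d"
  defines "G \<equiv> \<lambda>w. w * Ln w - w"
  shows "cauchy_transform (rect_density a b c d) z + of_real pi * cnj z
    = - \<i> * (G (of_real b - z + \<i> * of_real d) - G (of_real b - z + \<i> * of_real c))
      - \<i> * (G (z - of_real a - \<i> * of_real d) - G (z - of_real a - \<i> * of_real c))
      - \<i> * of_real (pi * (c + d)) + of_real pi * z"
proof -
  let ?f = "\<lambda>\<zeta>. rect_density a b c d \<zeta> / (\<zeta> - z)"
  have [measurable]: "(\<lambda>(x, y). Complex x y) \<in> lborel \<Otimes>\<^sub>M lborel \<rightarrow>\<^sub>M borel"
    by (simp add: Complex_eq case_prod_unfold)
  obtain \<rho> where \<rho>: "bounded_density 1 \<rho> (rect_density a b c d)" using rect_density_bounded by blast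
  have fi: "integrable lborel ?f" by (rule integrable_cauchy_kernel[OF \<rho>])
  then have pi: "integrable (lborel \<Otimes>\<^sub>M lborel) (\<lambda>p. ?f (case p of (x, y) \<Rightarrow> Complex x y))"
    by (subst (asm) lborel_Complex[symmetric], subst (asm) integrable_distr_eq) auto
  have ae: "AE y in lborel. (\<integral>x. ?f (Complex x y) \<partial>lborel) =
     indicator {c..d} y *\<^sub>R Ln (of_real b - z + \<i> * of_real y) - indicator {c..d} y *\<^sub>R Ln (z - of_real a - \<i> * of_real y)
      - \<i> * of_real pi * of_real (indicator {c..d} y * sgn (y - Im z))"
    using AE_lborel_singleton[of "Im z"]
  proof eventually_elim
    case (elim y)
    have "(\<integral>x. ?f (Complex x y) \<partial>lborel) = (\<integral>x. indicator {c..d} y *\<^sub>R (indicator {a..b} x *\<^sub>R (1 / (Complex x y - z))) \<partial>lborel)"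
      by (intro Bochner_Integration.integral_cong) (auto simp: rect_density_def indicator_def)
    also have "\<dots> = indicator {c..d} y *\<^sub>R (\<integral>x. indicator {a..b} x *\<^sub>R (1 / (Complex x y - z)) \<partial>lborel)"
      by (rule integral_scaleR_right)
    finally show ?case
      unfolding inverse_horizontal_integral[OF z(1,2) elim] by (auto simp: indicator_def)
  qed
  have "cauchy_transform (rect_density a b c d) z = (\<integral>p. ?f (case p of (x, y) \<Rightarrow> Complex x y) \<partial>(lborel \<Otimes>\<^sub>M lborel))"
    unfolding cauchy_transform_def by (subst lborel_Complex[symmetric], subst integral_distr) auto
  also have "\<dots> = (\<integral>y. (\<integral>x. ?f (Complex x y) \<partial>lborel) \<partial>lborel)"
    using lborel_pair.integral_snd[of "\<lambda>x y. ?f (Complex x y)"] pi by (simp add: case_prod_unfold)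
  also have "\<dots> = (\<integral>y. indicator {c..d} y *\<^sub>R Ln (of_real b - z + \<i> * of_real y) - indicator {c..d} y *\<^sub>R Ln (z - of_real a - \<i> * of_real y)
      - \<i> * of_real pi * of_real (indicator {c..d} y * sgn (y - Im z)) \<partial>lborel)"
    using pi ae
    by (intro integral_cong_AE) (auto intro!: lborel.borel_measurable_lebesgue_integral simp: case_prod_unfold)
  also have "\<dots> = - \<i> * (G (of_real b - z + \<i> * of_real d) - G (of_real b - z + \<i> * of_real c))
      - \<i> * (G (z - of_real a - \<i> * of_real d) - G (z - of_real a - \<i> * of_real c))
      - \<i> * of_real pi * of_real (c + d - 2 * Im z)"
  proof (rule has_bochner_integral_integral_eq, intro has_bochner_integral_diff has_bochner_integral_mult_right has_bochner_integral_of_real)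
    show "has_bochner_integral lborel (\<lambda>y. indicator {c..d} y * sgn (y - Im z)) (c + d - 2 * Im z)"
      using z by (intro integral_sgn_Icc) auto
  next
    have "has_bochner_integral lborel (\<lambda>y. indicator {c..d} y *\<^sub>R Ln (of_real b - z + \<i> * of_real y))
       (- \<i> * G (of_real b - z + \<i> * of_real d) - - \<i> * G (of_real b - z + \<i> * of_real c))"
      unfolding G_def
    proof (intro has_bochner_integral_FTC_Icc Ln_vertical_deriv)
      show "continuous_on {c..d} (\<lambda>y. Ln (of_real b - z + \<i> * of_real y))"
        using z by (intro continuous_intros) (auto simp: complex_nonpos_Reals_iff)
    qed (use z in auto)
    then show "has_bochner_integral lborel (\<lambda>y. indicator {c..d} y *\<^sub>R Ln (of_real b - z + \<i> * of_real y))
       (- \<i> * (G (of_real b - z + \<i> * of_real d) - G (of_real b - z + \<i> * of_real c)))"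
      by (simp add: algebra_simps)
  next
    have eq: "cnj (z - of_real a) + \<i> * of_real y = cnj (z - of_real a - \<i> * of_real y)" for y
      by (simp add: complex_eq_iff)
    have ln: "Ln (cnj (z - of_real a - \<i> * of_real y)) = cnj (Ln (z - of_real a - \<i> * of_real y))" for y
      using z by (intro cnj_Ln[symmetric]) (auto simp: complex_nonpos_Reals_iff)
    have "has_bochner_integral lborel (\<lambda>y. indicator {c..d} y *\<^sub>R Ln (cnj (z - of_real a) + \<i> * of_real y))
       (- \<i> * G (cnj (z - of_real a) + \<i> * of_real d) - - \<i> * G (cnj (z - of_real a) + \<i> * of_real c))"
      unfolding G_def
    proof (intro has_bochner_integral_FTC_Icc Ln_vertical_deriv)
      show "continuous_on {c..d} (\<lambda>y. Ln (cnj (z - of_real a) + \<i> * of_real y))"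
        using z by (intro continuous_intros) (auto simp: complex_nonpos_Reals_iff)
    qed (use z in auto)
    then have "has_bochner_integral lborel (\<lambda>y. cnj (indicator {c..d} y *\<^sub>R Ln (cnj (z - of_real a) + \<i> * of_real y)))
       (cnj (- \<i> * G (cnj (z - of_real a) + \<i> * of_real d) - - \<i> * G (cnj (z - of_real a) + \<i> * of_real c)))"
      by (intro has_bochner_integral_cnj)
    then show "has_bochner_integral lborel (\<lambda>y. indicator {c..d} y *\<^sub>R Ln (z - of_real a - \<i> * of_real y))
       (\<i> * (G (z - of_real a - \<i> * of_real d) - G (z - of_real a - \<i> * of_real c)))"
      unfolding eq G_def ln by (simp add: algebra_simps)
  qed
  finally show ?thesis by (simp add: complex_eq_iff algebra_simps)
qed

section \<open>The exponential transform inside and outside the domain\<close>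

text \<open>The difference quotient at a of the transform of b is itself a Cauchy transform, that of
b \<zeta> / (\<zeta> - a); if this density is bounded, then continuity gives the derivative.\<close>

lemma cauchy_transform_has_field_derivative:
  assumes b: "bounded_density M \<rho> b" and b': "bounded_density M' \<rho> (\<lambda>\<zeta>. b \<zeta> / (\<zeta> - a))"
  shows "(cauchy_transform b has_field_derivative cauchy_transform (\<lambda>\<zeta>. b \<zeta> / (\<zeta> - a)) a) (at a)"
  unfolding has_field_derivative_iff
proof (rule Lim_transform_eventually)
  show "(cauchy_transform (\<lambda>\<zeta>. b \<zeta> / (\<zeta> - a)) \<longlongrightarrow> cauchy_transform (\<lambda>\<zeta>. b \<zeta> / (\<zeta> - a)) a) (at a)"
    using continuous_cauchy_transform[OF b'] by (auto simp: continuous_on_eq_continuous_at isCont_def)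
  have [measurable]: "b \<in> borel_measurable borel" using b by (auto simp: bounded_density_def)
  have "cauchy_transform (\<lambda>\<zeta>. b \<zeta> / (\<zeta> - a)) z = (cauchy_transform b z - cauchy_transform b a) / (z - a)" if "z \<noteq> a" for z
  proof -
    have "cauchy_transform b z - cauchy_transform b a = (\<integral>\<zeta>. b \<zeta> / (\<zeta> - z) - b \<zeta> / (\<zeta> - a) \<partial>lborel)"
      unfolding cauchy_transform_def
      by (rule Bochner_Integration.integral_diff[symmetric]) (rule integrable_cauchy_kernel[OF b])+
    also have "\<dots> = (\<integral>\<zeta>. (z - a) * (b \<zeta> / (\<zeta> - a) / (\<zeta> - z)) \<partial>lborel)"
    proof (rule integral_cong_AE)
      show "AE \<zeta> in lborel. b \<zeta> / (\<zeta> - z) - b \<zeta> / (\<zeta> - a) = (z - a) * (b \<zeta> / (\<zeta> - a) / (\<zeta> - z))"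
        using AE_lborel_singleton[of z] AE_lborel_singleton[of a]
        by eventually_elim (simp add: field_simps)
    qed auto
    also have "\<dots> = (z - a) * cauchy_transform (\<lambda>\<zeta>. b \<zeta> / (\<zeta> - a)) z"
      unfolding cauchy_transform_def by (rule integral_mult_right_zero)
    finally show ?thesis using that by simp
  qed
  then show "\<forall>\<^sub>F z in at a. cauchy_transform (\<lambda>\<zeta>. b \<zeta> / (\<zeta> - a)) z = (cauchy_transform b z - cauchy_transform b a) / (z - a)"
    by (auto simp: eventually_at intro: exI[of _ 1])
qed

lemma cauchy_transform_rect_derivative:
  assumes z: "a < Re z0" "Re z0 < b" "c < Im z0" "Im z0 < d"
  shows "\<exists>D. ((\<lambda>z. cauchy_transform (rect_density a b c d) z + of_real pi * cnj z) has_field_derivative D) (at z0)"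
proof -
  define G where "G = (\<lambda>w. w * Ln w - w)"
  have G: "\<exists>D. ((\<lambda>z. G (\<alpha> z)) has_field_derivative D) (at z0)" if "Re (\<alpha> z0) > 0" "(\<alpha> has_field_derivative D0) (at z0)" for \<alpha> D0
  proof -
    have "\<alpha> z0 \<notin> \<real>\<^sub>\<le>\<^sub>0" using that by (auto simp: complex_nonpos_Reals_iff)
    then have "(G has_field_derivative (Ln (\<alpha> z0) + \<alpha> z0 * inverse (\<alpha> z0) - 1)) (at (\<alpha> z0))"
      unfolding G_def by (auto intro!: derivative_eq_intros)
    from DERIV_chain2[OF this that(2)] show ?thesis by blast
  qed
  have "\<exists>D. ((\<lambda>z. G (of_real b - z + \<i> * of_real d)) has_field_derivative D) (at z0)"
       "\<exists>D. ((\<lambda>z. G (of_real b - z + \<i> * of_real c)) has_field_derivative D) (at z0)"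
       "\<exists>D. ((\<lambda>z. G (z - of_real a - \<i> * of_real d)) has_field_derivative D) (at z0)"
       "\<exists>D. ((\<lambda>z. G (z - of_real a - \<i> * of_real c)) has_field_derivative D) (at z0)"
    using z by (rule_tac G; auto intro!: derivative_eq_intros)+
  then obtain D1 D2 D3 D4 where D:
       "((\<lambda>z. G (of_real b - z + \<i> * of_real d)) has_field_derivative D1) (at z0)"
       "((\<lambda>z. G (of_real b - z + \<i> * of_real c)) has_field_derivative D2) (at z0)"
       "((\<lambda>z. G (z - of_real a - \<i> * of_real d)) has_field_derivative D3) (at z0)"
       "((\<lambda>z. G (z - of_real a - \<i> * of_real c)) has_field_derivative D4) (at z0)" by blast
  have d: "((\<lambda>z. - \<i> * (G (of_real b - z + \<i> * of_real d) - G (of_real b - z + \<i> * of_real c))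
      - \<i> * (G (z - of_real a - \<i> * of_real d) - G (z - of_real a - \<i> * of_real c))
      - \<i> * of_real (pi * (c + d)) + of_real pi * z) has_field_derivative (- \<i> * (D1 - D2) - \<i> * (D3 - D4) + of_real pi)) (at z0)"
    by (rule derivative_eq_intros D refl)+ simp
  have "((\<lambda>z. cauchy_transform (rect_density a b c d) z + of_real pi * cnj z) has_field_derivative (- \<i> * (D1 - D2) - \<i> * (D3 - D4) + of_real pi)) (at z0)"
  proof (rule has_field_derivative_transform_within_open[OF d])
    show "open {z. a < Re z \<and> Re z < b \<and> c < Im z \<and> Im z < d}"
      by (intro open_Collect_conj open_Collect_less continuous_intros)
  qed (use z cauchy_transform_rect in \<open>auto simp: G_def\<close>)
  then show ?thesis by blast
qed

definition exp_density :: "complex set \<Rightarrow> complex \<Rightarrow> complex \<Rightarrow> complex" where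
  "exp_density \<Omega> w \<zeta> = indicator \<Omega> \<zeta> / (cnj \<zeta> - cnj w)"

lemma exp_transform_eq_cauchy: "exp_transform \<Omega> z w = exp (- cauchy_transform (exp_density \<Omega> w) z / of_real pi)"
proof -
  have "(LINT \<zeta>:\<Omega>|lborel. (- 2 * \<i>) / ((\<zeta> - z) * (cnj \<zeta> - cnj w))) = (\<integral>\<zeta>. (- 2 * \<i>) * (exp_density \<Omega> w \<zeta> / (\<zeta> - z)) \<partial>lborel)"
    unfolding set_lebesgue_integral_def
    by (intro Bochner_Integration.integral_cong) (auto simp: exp_density_def indicator_def mult.commute)
  also have "\<dots> = (- 2 * \<i>) * cauchy_transform (exp_density \<Omega> w) z"
    unfolding cauchy_transform_def by (rule integral_mult_right_zero)
  finally show ?thesis unfolding exp_transform_def by simp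
qed

lemma exp_density_measurable:
  assumes "open \<Omega>"
  shows "exp_density \<Omega> w \<in> borel_measurable borel"
proof -
  have [measurable]: "\<Omega> \<in> sets borel" using assms by auto
  have [measurable]: "cnj \<in> borel_measurable borel" by (intro borel_measurable_continuous_onI continuous_intros)
  show ?thesis unfolding exp_density_def[abs_def] by measurable
qed

lemma exp_density_bounded:
  assumes \<Omega>: "open \<Omega>" "bounded \<Omega>" and w: "w \<notin> closure \<Omega>"
  obtains \<delta> \<rho> where "0 < \<delta>" "\<And>\<zeta>. \<zeta> \<in> \<Omega> \<Longrightarrow> \<delta> \<le> norm (cnj \<zeta> - cnj w)" "\<Omega> \<subseteq> ball 0 \<rho>" "bounded_density (1 / \<delta>) \<rho> (exp_density \<Omega> w)"
proof -
  obtain \<delta> where \<delta>: "0 < \<delta>" "ball w \<delta> \<subseteq> - closure \<Omega>"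
    using w open_contains_ball[of "- closure \<Omega>"] by auto
  obtain \<rho> where \<rho>: "\<Omega> \<subseteq> ball 0 \<rho>"
    using \<Omega>(2) bounded_subset_ballD by blast
  have dist: "\<delta> \<le> norm (cnj \<zeta> - cnj w)" if "\<zeta> \<in> \<Omega>" for \<zeta>
  proof -
    have "\<zeta> \<notin> ball w \<delta>" using \<delta> that closure_subset by blast
    then show ?thesis by (simp add: dist_norm norm_minus_commute flip: complex_cnj_diff)
  qed
  have "norm (exp_density \<Omega> w \<zeta>) \<le> 1 / \<delta> * indicator (ball 0 \<rho>) \<zeta>" for \<zeta>
  proof (cases "\<zeta> \<in> \<Omega>")
    case True
    then have "1 / norm (cnj \<zeta> - cnj w) \<le> 1 / \<delta>" using \<delta> dist by (intro divide_left_mono) (auto intro: mult_pos_pos less_le_trans)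
    then show ?thesis using True \<rho> by (auto simp: exp_density_def norm_divide)
  qed (use \<delta> in \<open>auto simp: exp_density_def\<close>)
  then have "bounded_density (1 / \<delta>) \<rho> (exp_density \<Omega> w)"
    using \<delta> exp_density_measurable[OF \<Omega>(1)] by (auto simp: bounded_density_def)
  with that \<delta> dist \<rho> show ?thesis by blast
qed

lemma exp_transform_nonzero [simp]: "exp_transform \<Omega> z w \<noteq> 0"
  by (simp add: exp_transform_eq_cauchy)

lemma continuous_exp_transform:
  assumes "open \<Omega>" "bounded \<Omega>" "w \<notin> closure \<Omega>"
  shows "continuous_on UNIV (\<lambda>z. exp_transform \<Omega> z w)"
proof -
  obtain \<delta> \<rho> where "bounded_density (1 / \<delta>) \<rho> (exp_density \<Omega> w)" using exp_density_bounded[OF assms] by metis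
  from continuous_cauchy_transform[OF this] show ?thesis
    unfolding exp_transform_eq_cauchy by (intro continuous_intros) auto
qed

lemma bounded_exp_transform:
  assumes "open \<Omega>" "bounded \<Omega>" "w \<notin> closure \<Omega>"
  shows "\<exists>M. \<forall>z. norm (exp_transform \<Omega> z w) \<le> M"
proof -
  obtain \<delta> \<rho> where b: "bounded_density (1 / \<delta>) \<rho> (exp_density \<Omega> w)" using exp_density_bounded[OF assms] by metis
  define C where "C = 1 / \<delta> * (4 * pi + measure lborel (ball (0::complex) \<rho>))"
  have "norm (exp_transform \<Omega> z w) \<le> exp (C / pi)" for z
  proof -
    have "norm (exp_transform \<Omega> z w) \<le> exp (norm (- cauchy_transform (exp_density \<Omega> w) z / of_real pi))"
      unfolding exp_transform_eq_cauchy by (rule norm_exp)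
    also have "\<dots> \<le> exp (C / pi)"
      using divide_right_mono[OF norm_cauchy_transform_le[OF b, of z], of pi] by (simp add: C_def norm_divide)
    finally show ?thesis .
  qed
  then show ?thesis by blast
qed

lemma exp_transform_holomorphic_outside:
  assumes \<Omega>: "open \<Omega>" "bounded \<Omega>" "w \<notin> closure \<Omega>"
  shows "(\<lambda>z. exp_transform \<Omega> z w) holomorphic_on - closure \<Omega>"
proof -
  obtain \<delta> \<rho> where \<delta>: "0 < \<delta>" and b: "bounded_density (1 / \<delta>) \<rho> (exp_density \<Omega> w)" using exp_density_bounded[OF assms] by metis
  have [measurable]: "exp_density \<Omega> w \<in> borel_measurable borel" by (rule exp_density_measurable[OF \<Omega>(1)])
  have "\<exists>D. (cauchy_transform (exp_density \<Omega> w) has_field_derivative D) (at a)" if a: "a \<in> - closure \<Omega>" for a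
  proof -
    obtain e where e: "0 < e" "ball a e \<subseteq> - closure \<Omega>"
      using a open_contains_ball[of "- closure \<Omega>"] by auto
    have "norm (exp_density \<Omega> w \<zeta> / (\<zeta> - a)) \<le> 1 / \<delta> / e * indicator (ball 0 \<rho>) \<zeta>" for \<zeta>
    proof (cases "\<zeta> \<in> \<Omega>")
      case True
      then have "e \<le> norm (\<zeta> - a)" using e closure_subset[of \<Omega>] by (force simp: dist_norm norm_minus_commute subset_eq)
      moreover have "norm (exp_density \<Omega> w \<zeta>) \<le> 1 / \<delta> * indicator (ball 0 \<rho>) \<zeta>" using b by (auto simp: bounded_density_def)
      ultimately have "norm (exp_density \<Omega> w \<zeta>) / norm (\<zeta> - a) \<le> (1 / \<delta> * indicator (ball 0 \<rho>) \<zeta>) / e"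
        using e \<delta> by (intro frac_le) auto
      then show ?thesis by (simp add: norm_divide)
    qed (use \<delta> e in \<open>auto simp: exp_density_def\<close>)
    then have "bounded_density (1 / \<delta> / e) \<rho> (\<lambda>\<zeta>. exp_density \<Omega> w \<zeta> / (\<zeta> - a))"
      using \<delta> e by (auto simp: bounded_density_def)
    from cauchy_transform_has_field_derivative[OF b this] show ?thesis by blast
  qed
  then have "cauchy_transform (exp_density \<Omega> w) holomorphic_on - closure \<Omega>"
    by (subst holomorphic_on_open) auto
  then show ?thesis unfolding exp_transform_eq_cauchy by (intro holomorphic_intros) auto
qed

lemma cauchy_transform_add:
  assumes "bounded_density M \<rho> b" "bounded_density M' \<rho>' b'"
  shows "cauchy_transform (\<lambda>\<zeta>. b \<zeta> + b' \<zeta>) z = cauchy_transform b z + cauchy_transform b' z"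
  unfolding cauchy_transform_def
  using Bochner_Integration.integral_add[OF integrable_cauchy_kernel[OF assms(1)] integrable_cauchy_kernel[OF assms(2)]]
  by (simp add: add_divide_distrib)

lemma cauchy_transform_cmult: "cauchy_transform (\<lambda>\<zeta>. c * b \<zeta>) z = c * cauchy_transform b z"
  unfolding cauchy_transform_def by (simp flip: integral_mult_right_zero)

text \<open>Near a \<in> \<Omega> the density is split into its value at a, spread over a small square, and a remainder that
vanishes to first order at a. The remainder has a transform with a complex derivative at a, and the square
contributes the term - \<pi> cnj z.\<close>

lemma cauchy_transform_exp_density_inside:
  assumes \<Omega>: "open \<Omega>" "bounded \<Omega>" "w \<notin> closure \<Omega>" and a: "a \<in> \<Omega>"
  shows "\<exists>D. ((\<lambda>z. cauchy_transform (exp_density \<Omega> w) z + of_real pi / (cnj a - cnj w) * cnj z) has_field_derivative D) (at a)"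
proof -
  obtain \<delta> \<rho> where \<delta>: "0 < \<delta>" "\<And>\<zeta>. \<zeta> \<in> \<Omega> \<Longrightarrow> \<delta> \<le> norm (cnj \<zeta> - cnj w)" and sub: "\<Omega> \<subseteq> ball 0 \<rho>"
    and b: "bounded_density (1 / \<delta>) \<rho> (exp_density \<Omega> w)" using exp_density_bounded[OF \<Omega>] by metis
  have [measurable]: "exp_density \<Omega> w \<in> borel_measurable borel" by (rule exp_density_measurable[OF \<Omega>(1)])
  obtain e0 where e0: "0 < e0" "ball a e0 \<subseteq> \<Omega>" using \<Omega>(1) a open_contains_ball by blast
  define e where "e = e0 / 3"
  have e: "0 < e" using e0 by (simp add: e_def)
  define R where "R = rect_density (Re a - e) (Re a + e) (Im a - e) (Im a + e)"
  define h where "h = 1 / (cnj a - cnj w)"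
  have na: "\<delta> \<le> norm (cnj a - cnj w)" using \<delta> a by auto
  have hle: "norm h \<le> 1 / \<delta>" unfolding h_def norm_divide using \<delta> na by (auto intro!: divide_left_mono mult_pos_pos intro: less_le_trans)
  have R_cases: "R \<zeta> = (if \<bar>Re \<zeta> - Re a\<bar> \<le> e \<and> \<bar>Im \<zeta> - Im a\<bar> \<le> e then 1 else 0)" for \<zeta>
    by (auto simp: R_def rect_density_def indicator_def abs_le_iff)
  have R_in: "\<zeta> \<in> \<Omega>" if "\<bar>Re \<zeta> - Re a\<bar> \<le> e" "\<bar>Im \<zeta> - Im a\<bar> \<le> e" for \<zeta>
  proof -
    have "norm (\<zeta> - a) < e0" using cmod_le[of "\<zeta> - a"] that e0 unfolding e_def by auto
    then show ?thesis using e0 by (auto simp: dist_norm norm_minus_commute)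
  qed
  obtain \<rho>' where R: "bounded_density 1 \<rho>' R" unfolding R_def using rect_density_bounded by blast
  have [measurable]: "R \<in> borel_measurable borel" unfolding R_def by measurable
  define b1 where "b1 = (\<lambda>\<zeta>. exp_density \<Omega> w \<zeta> - h * R \<zeta>)"
  have [measurable]: "b1 \<in> borel_measurable borel" unfolding b1_def by measurable
  have b1_out: "b1 \<zeta> = 0" if "\<zeta> \<notin> \<Omega>" for \<zeta>
    using that R_in by (auto simp: b1_def exp_density_def R_cases)
  have b1_bd: "norm (b1 \<zeta>) \<le> 2 / \<delta> * indicator (ball 0 \<rho>) \<zeta>" for \<zeta>
  proof (cases "\<zeta> \<in> \<Omega>")
    case True
    have "norm (exp_density \<Omega> w \<zeta>) \<le> 1 / \<delta> * indicator (ball 0 \<rho>) \<zeta>" using b by (auto simp: bounded_density_def)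
    then have "norm (exp_density \<Omega> w \<zeta>) \<le> 1 / \<delta>" using True sub by auto
    moreover have "norm (h * R \<zeta>) \<le> 1 / \<delta>" using hle \<delta> by (auto simp: R_cases)
    ultimately have "norm (b1 \<zeta>) \<le> 1 / \<delta> + 1 / \<delta>" unfolding b1_def using norm_triangle_ineq4 by (smt (verit))
    then show ?thesis using True sub by auto
  qed (use \<delta> b1_out in auto)
  have b1: "bounded_density (2 / \<delta>) \<rho> b1" using \<delta> b1_bd by (auto simp: bounded_density_def)
  define M where "M = max (1 / \<delta>\<^sup>2) (2 / \<delta> / e)"
  have M0: "0 \<le> M" unfolding M_def using \<delta> e by (auto simp: le_max_iff_disj)
  have "norm (b1 \<zeta> / (\<zeta> - a)) \<le> M * indicator (ball 0 \<rho>) \<zeta>" for \<zeta>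
  proof (cases "\<zeta> \<in> \<Omega>")
    case True
    show ?thesis
    proof (cases "\<bar>Re \<zeta> - Re a\<bar> \<le> e \<and> \<bar>Im \<zeta> - Im a\<bar> \<le> e")
      case inside: True
      have nz: "cnj \<zeta> - cnj w \<noteq> 0" "cnj a - cnj w \<noteq> 0" using \<delta> na True by fastforce+
      have "b1 \<zeta> = cnj (a - \<zeta>) / ((cnj \<zeta> - cnj w) * (cnj a - cnj w))"
        using nz inside True by (simp add: b1_def R_cases exp_density_def h_def field_simps)
      then have "norm (b1 \<zeta> / (\<zeta> - a)) = (norm (\<zeta> - a) / norm (\<zeta> - a)) / (norm (cnj \<zeta> - cnj w) * norm (cnj a - cnj w))"
        by (simp only: norm_divide norm_mult complex_mod_cnj norm_minus_commute) simp
      also have "\<dots> \<le> 1 / (\<delta> * \<delta>)"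
        using \<delta> True na by (intro frac_le mult_mono) auto
      also have "\<dots> \<le> M" by (simp add: M_def power2_eq_square)
      finally show ?thesis using True sub by auto
    next
      case False
      then have "e \<le> norm (\<zeta> - a)" using abs_Re_le_cmod[of "\<zeta> - a"] abs_Im_le_cmod[of "\<zeta> - a"] by auto
      then have "norm (b1 \<zeta> / (\<zeta> - a)) \<le> (2 / \<delta> * indicator (ball 0 \<rho>) \<zeta>) / e"
        unfolding norm_divide using b1_bd[of \<zeta>] e \<delta> by (intro frac_le) auto
      also have "\<dots> \<le> M" using True sub by (auto simp: M_def)
      finally show ?thesis using True sub by auto
    qed
  qed (use M0 b1_out in auto)
  then have "bounded_density M \<rho> (\<lambda>\<zeta>. b1 \<zeta> / (\<zeta> - a))" using M0 by (auto simp: bounded_density_def)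
  from cauchy_transform_has_field_derivative[OF b1 this] obtain D1 where D1: "(cauchy_transform b1 has_field_derivative D1) (at a)" by blast
  obtain D2 where D2: "((\<lambda>z. cauchy_transform R z + of_real pi * cnj z) has_field_derivative D2) (at a)"
    using cauchy_transform_rect_derivative[of "Re a - e" a "Re a + e" "Im a - e" "Im a + e"] e unfolding R_def by auto
  have "bounded_density (norm h) \<rho>' (\<lambda>\<zeta>. h * R \<zeta>)"
    using R mult_left_mono[of _ _ "norm h"] by (auto simp: bounded_density_def norm_mult)
  then have "cauchy_transform (exp_density \<Omega> w) z = cauchy_transform b1 z + h * cauchy_transform R z" for z
    using cauchy_transform_add[OF b1, of _ _ "\<lambda>\<zeta>. h * R \<zeta>" z] by (simp add: cauchy_transform_cmult b1_def)
  then have "(\<lambda>z. cauchy_transform (exp_density \<Omega> w) z + of_real pi / (cnj a - cnj w) * cnj z)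
     = (\<lambda>z. cauchy_transform b1 z + h * (cauchy_transform R z + of_real pi * cnj z))"
    by (auto simp: h_def algebra_simps)
  moreover have "((\<lambda>z. cauchy_transform b1 z + h * (cauchy_transform R z + of_real pi * cnj z)) has_field_derivative D1 + h * D2) (at a)"
    by (intro DERIV_add D1 DERIV_cmult D2)
  ultimately show ?thesis by metis
qed

text \<open>By the previous lemma, the d-bar derivative of log E(z, w) at z \<in> \<Omega> is 1 / (cnj z - cnj w). This is also the
d-bar derivative of log (cnj z - cnj w), so that division by cnj z - cnj w removes the antiholomorphic part.\<close>

lemma exp_transform_holomorphic_inside:
  assumes \<Omega>: "open \<Omega>" "bounded \<Omega>" "w \<notin> closure \<Omega>"
  shows "(\<lambda>z. exp_transform \<Omega> z w / (cnj z - cnj w)) holomorphic_on \<Omega>"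
proof (subst holomorphic_on_open[OF \<Omega>(1)], intro ballI)
  fix a assume a: "a \<in> \<Omega>"
  define h where "h = 1 / (cnj a - cnj w)"
  have nz: "cnj a - cnj w \<noteq> 0" using a \<Omega>(3) closure_subset by auto
  obtain D where D: "((\<lambda>z. cauchy_transform (exp_density \<Omega> w) z + of_real pi / (cnj a - cnj w) * cnj z) has_field_derivative D) (at a)"
    using cauchy_transform_exp_density_inside[OF \<Omega> a] by blast
  have "((\<lambda>z. (- 1 / of_real pi) * (cauchy_transform (exp_density \<Omega> w) z + of_real pi / (cnj a - cnj w) * cnj z) + h * cnj z)
      has_derivative (\<lambda>d. (- 1 / of_real pi) * (D * d) + h * cnj d)) (at a)"
    by (intro has_derivative_add has_derivative_mult_right D[unfolded has_field_derivative_def]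
        bounded_linear_imp_has_derivative bounded_linear_cnj)
  then have L: "((\<lambda>z. - cauchy_transform (exp_density \<Omega> w) z / of_real pi) has_derivative (\<lambda>d. - (D * d) / of_real pi + h * cnj d)) (at a)"
    by (simp add: h_def field_simps)
  have "((\<lambda>z. exp_transform \<Omega> z w) has_derivative (\<lambda>d. exp_transform \<Omega> a w * (- (D * d) / of_real pi + h * cnj d))) (at a)"
    unfolding exp_transform_eq_cauchy
    using has_derivative_compose[OF L DERIV_exp[THEN has_field_derivative_imp_has_derivative]] by simp
  then have "((\<lambda>z. exp_transform \<Omega> z w / (cnj z - cnj w)) has_derivative
     (\<lambda>d. - exp_transform \<Omega> a w * (inverse (cnj a - cnj w) * cnj d * inverse (cnj a - cnj w)) + exp_transform \<Omega> a w * (- (D * d) / of_real pi + h * cnj d) / (cnj a - cnj w))) (at a)"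
    using nz by (intro has_derivative_divide[where g="\<lambda>z. cnj z - cnj w"]) (auto intro!: derivative_eq_intros)
  also have "(\<lambda>d. - exp_transform \<Omega> a w * (inverse (cnj a - cnj w) * cnj d * inverse (cnj a - cnj w)) + exp_transform \<Omega> a w * (- (D * d) / of_real pi + h * cnj d) / (cnj a - cnj w))
     = (*) (- exp_transform \<Omega> a w * D / (of_real pi * (cnj a - cnj w)))"
  proof
    have "- E * (inverse c * x * inverse c) + E * (- (D * d) / P + 1 / c * x) / c = - E * D / (P * c) * d"
      if "c \<noteq> 0" "P \<noteq> 0" for E c x P d :: complex
      using that by (simp add: field_simps)
    from this[OF nz, of "of_real pi"]
    show "- exp_transform \<Omega> a w * (inverse (cnj a - cnj w) * cnj d * inverse (cnj a - cnj w)) + exp_transform \<Omega> a w * (- (D * d) / of_real pi + h * cnj d) / (cnj a - cnj w)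
        = - exp_transform \<Omega> a w * D / (of_real pi * (cnj a - cnj w)) * d" for d
      by (simp add: h_def)
  qed
  finally show "\<exists>f'. ((\<lambda>z. exp_transform \<Omega> z w / (cnj z - cnj w)) has_field_derivative f') (at a)"
    unfolding has_field_derivative_def by blast
qed

section \<open>Gluing and extending holomorphic functions\<close>

text \<open>The substitution \<open>u = u\<^sub>0 exp t\<close> straightens the circle into the imaginary axis, where the corresponding statement for
lines applies.\<close>

lemma holomorphic_on_paste_across_circle:
  assumes N: "open N"
    and inner: "\<phi> holomorphic_on N \<inter> {u. norm u < 1}" and outer: "\<phi> holomorphic_on N \<inter> {u. 1 < norm u}"
    and cont: "continuous_on N \<phi>"
  shows "\<phi> holomorphic_on N"
proof -
  have op: "open {u::complex. norm u < 1}" "open {u::complex. 1 < norm u}"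
    by (auto intro!: open_Collect_less continuous_intros)
  have "\<exists>D. (\<phi> has_field_derivative D) (at u0)" if u0: "u0 \<in> N" for u0
  proof -
    consider "norm u0 < 1" | "1 < norm u0" | "norm u0 = 1" by linarith
    then show ?thesis
    proof cases
      case 1
      then show ?thesis using inner u0 op N by (subst (asm) holomorphic_on_open) auto
    next
      case 2
      then show ?thesis using outer u0 op N by (subst (asm) holomorphic_on_open) auto
    next
      case 3
      have nz: "u0 \<noteq> 0" using 3 by auto
      let ?e = "\<lambda>t. u0 * exp t"
      define S where "S = ?e -` N"
      have hol_e: "?e holomorphic_on X" for X by (intro holomorphic_intros)
      have S: "open S" unfolding S_def
        by (intro open_vimage N continuous_intros)
      have norm_e: "norm (?e t) = exp (Re t)" for t using 3 by (simp add: norm_mult)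
      have comp: "(\<phi> \<circ> ?e) holomorphic_on S"
      proof (rule holomorphic_on_paste_across_line[OF S, of 1 _ 0])
        show "(\<phi> \<circ> ?e) holomorphic_on S \<inter> {z. 1 \<bullet> z < 0}"
          by (rule holomorphic_on_compose_gen[OF hol_e inner]) (auto simp: S_def norm_e)
        show "(\<phi> \<circ> ?e) holomorphic_on S \<inter> {z. 0 < 1 \<bullet> z}"
          by (rule holomorphic_on_compose_gen[OF hol_e outer]) (auto simp: S_def norm_e)
        show "continuous_on S (\<phi> \<circ> ?e)"
          by (intro continuous_on_compose continuous_on_subset[OF cont] continuous_intros) (auto simp: S_def)
      qed auto
      define V where "V = N \<inter> {u. u / u0 \<notin> \<real>\<^sub>\<le>\<^sub>0}"
      have V: "open V" unfolding V_def
      proof (intro open_Int N)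
        have "{u. u / u0 \<notin> \<real>\<^sub>\<le>\<^sub>0} = (\<lambda>u. u / u0) -` (- \<real>\<^sub>\<le>\<^sub>0)" by auto
        then show "open {u. u / u0 \<notin> \<real>\<^sub>\<le>\<^sub>0}"
          using nz by (auto intro!: open_vimage continuous_intros)
      qed
      have exp_ln: "?e (Ln (u / u0)) = u" if "u \<in> V" for u
        using that nz by (subst exp_Ln) (auto simp: V_def)
      have "((\<phi> \<circ> ?e) \<circ> (\<lambda>u. Ln (u / u0))) holomorphic_on V"
      proof (rule holomorphic_on_compose_gen[OF _ comp])
        show "(\<lambda>u. Ln (u / u0)) holomorphic_on V" using nz by (intro holomorphic_intros) (auto simp: V_def)
        show "(\<lambda>u. Ln (u / u0)) ` V \<subseteq> S" using exp_ln by (auto simp: S_def V_def)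
      qed
      then have "\<phi> holomorphic_on V"
        by (rule holomorphic_transform) (use exp_ln in auto)
      moreover have "u0 \<in> V" using u0 nz by (auto simp: V_def)
      ultimately show ?thesis using V by (subst (asm) holomorphic_on_open) auto
    qed
  qed
  then show ?thesis using N by (subst holomorphic_on_open) auto
qed

lemma holomorphic_locally:
  assumes "open S" "\<And>x. x \<in> S \<Longrightarrow> \<exists>N. open N \<and> x \<in> N \<and> h holomorphic_on N"
  shows "(h :: complex \<Rightarrow> complex) holomorphic_on S"
proof (subst holomorphic_on_open[OF assms(1)], intro ballI)
  fix x assume "x \<in> S"
  then obtain N where "open N" "x \<in> N" "h holomorphic_on N" using assms(2) by blast
  then show "\<exists>f'. (h has_field_derivative f') (at x)" using holomorphic_on_open by blast
qed

lemma bounded_holomorphic_finite_exception_constant: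
  assumes "finite K" "\<phi> holomorphic_on - K" "\<And>u. u \<notin> K \<Longrightarrow> norm (\<phi> u) \<le> M"
  shows "\<exists>c. \<forall>u. u \<notin> K \<longrightarrow> \<phi> u = c"
  using assms
proof (induction K arbitrary: \<phi> M)
  case empty
  have "bounded (range \<phi>)" unfolding bounded_iff using empty.prems by auto
  then have "\<phi> constant_on UNIV" using empty.prems by (intro Liouville_theorem) auto
  then show ?case by (auto simp: constant_on_def)
next
  case (insert k K)
  have eq: "- insert k K = - K - {k}" by auto
  have k: "k \<in> interior (- K)" using insert.hyps by (simp add: interior_open finite_imp_closed open_Compl)
  have "\<forall>\<^sub>F u in at k. u \<in> - K - {k}"
    using insert.hyps by (intro eventually_at_in_open) (auto simp: open_Compl finite_imp_closed)
  then have "\<forall>\<^sub>F u in at k. norm (\<phi> u) \<le> M" by eventually_elim (use insert.prems in auto)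
  then obtain g where g: "g holomorphic_on - K" "\<And>z. z \<in> - K - {k} \<Longrightarrow> g z = \<phi> z"
    using holomorphic_on_extend_bounded[of \<phi> "- K" k] k insert.prems(1) unfolding eq by blast
  have "norm (g u) \<le> max M (norm (g k))" if "u \<notin> K" for u
    using g(2)[of u] insert.prems(2)[of u] that by (cases "u = k") (auto simp: le_max_iff_disj)
  from insert.IH[OF g(1) this] obtain c where "\<forall>u. u \<notin> K \<longrightarrow> g u = c" by blast
  then show ?case using g(2) by (intro exI[of _ c]) auto
qed

text \<open>A finite set does not separate the plane, so that a boundary between two nonempty open sets is never finite.\<close>

lemma frontier_avoids_finite:
  fixes W :: "complex set"
  assumes W: "W \<noteq> {}" "open W" and V: "V \<noteq> {}" "open V" "V \<inter> W = {}" and X: "finite X"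
  obtains z where "z \<in> frontier W" "z \<notin> X"
proof -
  have conn: "connected (UNIV - X)" by (rule connected_open_delete_finite) (use X in auto)
  have "infinite W" "infinite V" using W V by (metis finite_imp_not_open)+
  then have "\<not> W \<subseteq> X" "\<not> V \<subseteq> X" using X finite_subset by blast+
  then have "(UNIV - X) \<inter> frontier W \<noteq> {}" using V by (intro connected_Int_frontier[OF conn]) auto
  then show ?thesis using that by blast
qed

section \<open>Fibres of a rational function that is proper on a domain\<close>

text \<open>The fibre of u is described by the polynomial A - u B, whose degree and leading coefficient do not depend on \<open>u\<close>
because \<open>deg B < deg A\<close>. It has \<open>deg A\<close> simple roots unless \<open>u\<close> is one of finitely many critical values.\<close>

locale rational_proper_domain =
  fixes \<Omega> :: "complex set" and A B :: "complex poly" and p :: nat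
  assumes open_\<Omega>: "open \<Omega>" and connected_\<Omega>: "connected \<Omega>" and nonempty_\<Omega>: "\<Omega> \<noteq> {}" and bounded_\<Omega>: "bounded \<Omega>"
    and coprime_AB: "coprime A B" and degree_BA: "degree B < degree A"
    and B_nz: "\<And>z. z \<in> \<Omega> \<Longrightarrow> poly B z \<noteq> 0"
    and valent: "valent_proper_map p \<Omega> (\<lambda>z. poly A z / poly B z)"
begin

definition "f z = poly A z / poly B z"
definition "fibre u = {z. poly A z = u * poly B z}"
definition "critical = {u. \<exists>z. poly A z = u * poly B z \<and> poly (pderiv A) z = u * poly (pderiv B) z}"

lemma no_common_zero: "poly A z \<noteq> 0 \<or> poly B z \<noteq> 0"
  using coprime_poly_0[OF coprime_AB] by auto

lemma fibre_B_nz: "z \<in> fibre u \<Longrightarrow> poly B z \<noteq> 0"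
  using no_common_zero[of z] by (auto simp: fibre_def)

lemma fibre_f: "z \<in> fibre u \<Longrightarrow> f z = u"
  using fibre_B_nz[of z u] by (auto simp: fibre_def f_def)

lemma in_fibre_f: "poly B z \<noteq> 0 \<Longrightarrow> z \<in> fibre (f z)"
  by (auto simp: fibre_def f_def)

lemma degree_fibre_poly: "degree (A - smult u B) = degree A" and lead_coeff_fibre_poly: "lead_coeff (A - smult u B) = lead_coeff A"
proof -
  have "degree (smult u B) < degree A" using degree_BA by (auto intro: le_less_trans[OF degree_smult_le])
  then show "degree (A - smult u B) = degree A" "lead_coeff (A - smult u B) = lead_coeff A"
    using degree_add_eq_left[of "- smult u B" A] lead_coeff_add_le[of "- smult u B" A] by (auto simp: coeff_eq_0)
qed

lemma fibre_poly_nz: "A - smult u B \<noteq> 0"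
  using degree_fibre_poly[of u] degree_BA by auto

lemma fibre_eq_roots: "fibre u = {z. poly (A - smult u B) z = 0}"
  by (auto simp: fibre_def)

lemma finite_fibre: "finite (fibre u)"
  unfolding fibre_eq_roots by (rule poly_roots_finite[OF fibre_poly_nz])

lemma card_fibre_le: "card (fibre u) \<le> degree A"
  unfolding fibre_eq_roots using card_poly_roots_bound[OF fibre_poly_nz, of u] degree_fibre_poly by simp

lemma rsquarefree_fibre_poly: "u \<notin> critical \<Longrightarrow> rsquarefree (A - smult u B)"
  unfolding rsquarefree_roots critical_def by (auto simp: pderiv_diff pderiv_smult)

lemma fibre_poly_decompose:
  assumes "u \<notin> critical"
  shows "A - smult u B = smult (lead_coeff A) (\<Prod>z\<in>fibre u. [:-z, 1:])"
  using complex_poly_decompose_rsquarefree[OF rsquarefree_fibre_poly[OF assms]]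
  unfolding lead_coeff_fibre_poly fibre_eq_roots by simp

lemma lead_coeff_A_nz: "lead_coeff A \<noteq> 0"
  using degree_BA by auto

lemma card_fibre:
  assumes "u \<notin> critical"
  shows "card (fibre u) = degree A"
proof -
  have "degree A = degree (A - smult u B)" by (simp add: degree_fibre_poly)
  also have "\<dots> = degree (\<Prod>z\<in>fibre u. [:-z, 1:])"
    using lead_coeff_A_nz by (subst fibre_poly_decompose[OF assms]) simp
  also have "\<dots> = card (fibre u)" by (subst degree_prod_eq_sum_degree) auto
  finally show ?thesis ..
qed

lemma finite_critical: "finite critical"
proof -
  let ?W = "pderiv A * B - A * pderiv B"
  have "?W \<noteq> 0"
  proof
    assume "?W = 0"
    then have "A dvd pderiv A * B" by simp
    then have "A dvd pderiv A" by (rule iffD1[OF coprime_dvd_mult_left_iff[OF coprime_AB]])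
    moreover have "pderiv A \<noteq> 0" using degree_BA by (simp add: pderiv_eq_0_iff)
    ultimately have "degree A \<le> degree (pderiv A)" by (rule dvd_imp_degree_le)
    then show False using degree_BA by (simp add: degree_pderiv)
  qed
  then have "finite (f ` {z. poly ?W z = 0})" by (intro finite_imageI poly_roots_finite)
  moreover have "critical \<subseteq> f ` {z. poly ?W z = 0}"
  proof
    fix u assume "u \<in> critical"
    then obtain z where z: "poly A z = u * poly B z" "poly (pderiv A) z = u * poly (pderiv B) z"
      by (auto simp: critical_def)
    then have "f z = u" by (intro fibre_f) (auto simp: fibre_def)
    moreover have "poly ?W z = 0" using z by (simp add: algebra_simps)
    ultimately show "u \<in> f ` {z. poly ?W z = 0}" by auto
  qed
  ultimately show ?thesis by (rule finite_subset[rotated])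
qed

lemma f_continuous: "continuous_on {z. poly B z \<noteq> 0} f"
  unfolding f_def[abs_def] by (intro continuous_intros) auto

lemma f_holomorphic: "f holomorphic_on {z. poly B z \<noteq> 0}"
  unfolding f_def[abs_def] by (intro holomorphic_intros) auto

lemma open_B_nz: "open {z. poly B z \<noteq> 0}"
  by (intro open_Collect_neq continuous_intros)

lemma f_image: "f ` \<Omega> = ball 0 1"
  using valent unfolding valent_proper_map_def f_def[abs_def] by simp

lemma f_in_disc: "z \<in> \<Omega> \<Longrightarrow> norm (f z) < 1"
  using f_image by force

text \<open>Near a pole |f| is larger than 1, but |f| < 1 in \<Omega>.\<close>

lemma B_nz_closure:
  assumes z: "z \<in> closure \<Omega>"
  shows "poly B z \<noteq> 0"
proof
  assume B0: "poly B z = 0"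
  then have A: "poly A z \<noteq> 0" using no_common_zero by blast
  have "continuous_on UNIV (\<lambda>z. norm (poly A z) - norm (poly B z))" by (intro continuous_intros)
  then have "open ((\<lambda>z. norm (poly A z) - norm (poly B z)) -` {0<..})" by (intro open_vimage) auto
  moreover have "z \<in> (\<lambda>z. norm (poly A z) - norm (poly B z)) -` {0<..}" using A B0 by simp
  ultimately obtain y where y: "y \<in> \<Omega>" "norm (poly A y) - norm (poly B y) > 0"
    using z unfolding closure_iff_nhds_not_empty by blast
  have "norm (poly A y) < norm (poly B y)"
    using f_in_disc[OF y(1)] B_nz[OF y(1)] by (auto simp: f_def norm_divide divide_less_eq)
  then show False using y by simp
qed

lemma f_closure_le: 
  assumes z: "z \<in> closure \<Omega>"
  shows "norm (f z) \<le> 1"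
proof -
  have "continuous_on (closure \<Omega>) (\<lambda>z. norm (f z))"
    by (intro continuous_intros continuous_on_subset[OF f_continuous]) (use B_nz_closure in auto)
  from continuous_le_on_closure[OF this z] show ?thesis using f_in_disc by (meson less_imp_le)
qed

text \<open>This is what properness is used for: if |f z| < \<rho> < 1 at a boundary point z, then z is a limit of points of the
compact subset of \<Omega> on which |f| \<le> \<rho>.\<close>

lemma f_frontier:
  assumes z: "z \<in> frontier \<Omega>"
  shows "norm (f z) = 1"
proof (rule ccontr)
  assume "norm (f z) \<noteq> 1"
  have zc: "z \<in> closure \<Omega>" "z \<notin> \<Omega>" using z open_\<Omega> by (auto simp: frontier_def interior_open)
  then have lt: "norm (f z) < 1" using f_closure_le \<open>norm (f z) \<noteq> 1\<close> by fastforce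
  define \<rho> where "\<rho> = (1 + norm (f z)) / 2"
  have \<rho>: "norm (f z) < \<rho>" "\<rho> < 1" using lt by (auto simp: \<rho>_def)
  have pm: "proper_map (top_of_set \<Omega>) (top_of_set (ball 0 1)) f"
    using valent unfolding valent_proper_map_def f_def[abs_def] by simp
  have "compactin (top_of_set (ball 0 1)) (cball (0::complex) \<rho>)" using \<rho> by (auto simp: compactin_subtopology)
  from compactin_proper_map_preimage[OF pm this]
  have "compact {x \<in> \<Omega>. f x \<in> cball 0 \<rho>}" by (auto simp: compactin_subtopology)
  then have cl: "closed {x \<in> \<Omega>. f x \<in> cball 0 \<rho>}" by (rule compact_imp_closed)
  have "isCont f z"
    using f_continuous open_B_nz B_nz_closure[OF zc(1)] by (simp add: continuous_on_eq_continuous_at)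
  then have "\<forall>\<^sub>F y in at z. norm (f y) < \<rho>"
    using order_tendstoD(2)[OF tendsto_norm[of f "f z" "at z"] \<rho>(1)] by (simp add: isCont_def)
  then obtain d where d: "d > 0" "\<And>y. y \<noteq> z \<Longrightarrow> dist y z < d \<Longrightarrow> norm (f y) < \<rho>"
    by (auto simp: eventually_at)
  have "z \<in> closure {x \<in> \<Omega>. f x \<in> cball 0 \<rho>}"
    unfolding closure_approachable
  proof (intro allI impI)
    fix e :: real assume "0 < e"
    then obtain y where "y \<in> \<Omega>" "dist y z < min d e"
      using zc(1) d(1) unfolding closure_approachable by (metis min_less_iff_conj)
    then show "\<exists>y\<in>{x \<in> \<Omega>. f x \<in> cball 0 \<rho>}. dist y z < e"
      using d(2)[of y] zc(2) by (intro bexI[of _ y]) (auto intro: less_imp_le)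
  qed
  then show False using cl zc(2) by simp
qed

lemma in_closure_less_imp_in: "z \<in> closure \<Omega> \<Longrightarrow> norm (f z) < 1 \<Longrightarrow> z \<in> \<Omega>"
  using f_frontier[of z] open_\<Omega> by (auto simp: frontier_def interior_open)

lemma deriv_f_nz:
  assumes "u \<notin> critical" "z \<in> fibre u"
  shows "deriv f z \<noteq> 0"
proof -
  have B: "poly B z \<noteq> 0" and A: "poly A z = u * poly B z" using assms fibre_B_nz by (auto simp: fibre_def)
  have "(f has_field_derivative (poly (pderiv A) z * poly B z - poly A z * poly (pderiv B) z) / (poly B z * poly B z)) (at z)"
    unfolding f_def[abs_def] by (intro DERIV_divide poly_DERIV B)
  then have "deriv f z = (poly (pderiv A) z * poly B z - poly A z * poly (pderiv B) z) / (poly B z * poly B z)"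
    by (rule DERIV_imp_deriv)
  also have "poly (pderiv A) z * poly B z - poly A z * poly (pderiv B) z = poly B z * (poly (pderiv A) z - u * poly (pderiv B) z)"
    by (simp add: A algebra_simps)
  finally show ?thesis using B A assms(1) by (auto simp: critical_def)
qed

lemma card_fibre_inside:
  assumes u: "u \<notin> critical" "norm u < 1"
  shows "card (fibre u \<inter> \<Omega>) = p"
proof -
  have eq: "{z \<in> \<Omega>. f z = u} = fibre u \<inter> \<Omega>" using fibre_f in_fibre_f B_nz by blast
  have "(\<Sum>z\<in>{z \<in> \<Omega>. f z = u}. zorder (\<lambda>\<zeta>. f \<zeta> - u) z) = int p"
    using valent u unfolding valent_proper_map_def f_def[abs_def] by simp
  moreover have "zorder (\<lambda>\<zeta>. f \<zeta> - u) z = 1" if z: "z \<in> fibre u \<inter> \<Omega>" for z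
  proof -
    have hol: "f holomorphic_on \<Omega>" by (rule holomorphic_on_subset[OF f_holomorphic]) (use B_nz in auto)
    have fz: "f z = u" using z fibre_f by auto
    have "f analytic_on {z}" using hol open_\<Omega> z by (metis IntD2 analytic_at)
    then have an: "(\<lambda>\<zeta>. f \<zeta> - u) analytic_on {z}" by (intro analytic_intros)
    have "f field_differentiable at z" using hol open_\<Omega> z by (metis IntD2 holomorphic_on_imp_differentiable_at)
    then have "deriv (\<lambda>\<zeta>. f \<zeta> - u) z \<noteq> 0" using deriv_f_nz[OF u(1)] z by simp
    then show ?thesis using fz by (intro zorder_zero_eqI'[OF an]) auto
  qed
  ultimately show ?thesis unfolding eq by simp
qed

lemma p_pos: "0 < p"
proof -
  have "infinite (ball 0 1 :: complex set)" by (metis finite_imp_not_open open_ball ball_eq_empty zero_less_one not_less)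
  then obtain u where u: "u \<in> ball 0 1" "u \<notin> critical" using finite_critical by (meson finite_subset subsetI)
  then obtain z where "z \<in> \<Omega>" "f z = u" using f_image by (metis imageE)
  then have "z \<in> fibre u \<inter> \<Omega>" using in_fibre_f B_nz by auto
  then have "card (fibre u \<inter> \<Omega>) \<noteq> 0" using finite_fibre by auto
  then show ?thesis using card_fibre_inside[OF u(2)] u by auto
qed

lemma local_branch:
  assumes u0: "u0 \<notin> critical" and z0: "z0 \<in> fibre u0" and \<delta>: "0 < \<delta>"
  obtains r \<psi> where "0 < r" "\<psi> holomorphic_on ball u0 r" "\<psi> u0 = z0" "\<And>u. u \<in> ball u0 r \<Longrightarrow> \<psi> u \<in> fibre u"
    "\<And>u. u \<in> ball u0 r \<Longrightarrow> dist z0 (\<psi> u) < \<delta>"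
proof -
  have zB: "z0 \<in> {z. poly B z \<noteq> 0}" using fibre_B_nz z0 by auto
  obtain r0 where r0: "0 < r0" "ball z0 r0 \<subseteq> {z. poly B z \<noteq> 0}" "inj_on f (ball z0 r0)"
    using has_complex_derivative_locally_injective[OF f_holomorphic zB open_B_nz deriv_f_nz[OF u0 z0]] by metis
  define S where "S = ball z0 (min r0 \<delta>)"
  have S: "S \<subseteq> ball z0 r0" "open S" "z0 \<in> S" using r0 \<delta> by (auto simp: S_def)
  have holS: "f holomorphic_on S" using holomorphic_on_subset[OF f_holomorphic] S r0 by (meson subset_trans)
  have injS: "inj_on f S" using r0 S inj_on_subset by blast
  obtain g where g: "g holomorphic_on f ` S" "\<And>z. z \<in> S \<Longrightarrow> g (f z) = z"
    using holomorphic_has_inverse[OF holS S(2) injS] by metis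
  have "open (f ` S)" by (rule open_mapping_thm3[OF holS S(2) injS])
  moreover have fz0: "f z0 = u0" using z0 fibre_f by simp
  ultimately obtain r where r: "0 < r" "ball u0 r \<subseteq> f ` S" using S(3) open_contains_ball by (metis imageI)
  show ?thesis
  proof
    show "g holomorphic_on ball u0 r" using g(1) r holomorphic_on_subset by blast
    show "g u0 = z0" using g(2)[OF S(3)] fz0 by simp
    fix u assume "u \<in> ball u0 r"
    then obtain z where z: "z \<in> S" "u = f z" using r by blast
    then have "poly B z \<noteq> 0" using S r0 by auto
    then show "g u \<in> fibre u" using z g(2) in_fibre_f by simp
    show "dist z0 (g u) < \<delta>" using z g(2) by (simp add: S_def)
  qed (use r in auto)
qed

text \<open>Local inverses at the deg A points of a fibre have disjoint ranges when the neighbourhood is small, and they exhaust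
the neighbouring fibres because no fibre has more than deg A points.\<close>

lemma all_branches:
  assumes u0: "u0 \<notin> critical"
  obtains r g where "0 < r" "\<And>z. z \<in> fibre u0 \<Longrightarrow> g z holomorphic_on ball u0 r" "\<And>z. z \<in> fibre u0 \<Longrightarrow> g z u0 = z"
    "\<And>u. u \<in> ball u0 r \<Longrightarrow> inj_on (\<lambda>z. g z u) (fibre u0)" "\<And>u. u \<in> ball u0 r \<Longrightarrow> (\<lambda>z. g z u) ` fibre u0 = fibre u"
proof -
  obtain \<delta> where \<delta>: "0 < \<delta>" "\<And>z z'. z \<in> fibre u0 \<Longrightarrow> z' \<in> fibre u0 \<Longrightarrow> z \<noteq> z' \<Longrightarrow> 2 * \<delta> \<le> dist z z'"
  proof -
    let ?D = "insert 1 ((\<lambda>(z, z'). dist z z') ` {(z, z') \<in> fibre u0 \<times> fibre u0. z \<noteq> z'})"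
    have fin: "finite ?D" using finite_fibre by (auto intro: finite_subset[of _ "fibre u0 \<times> fibre u0"])
    have "0 < Min ?D" using fin by (subst Min_gr_iff) auto
    moreover have "2 * (Min ?D / 2) \<le> dist z z'" if "z \<in> fibre u0" "z' \<in> fibre u0" "z \<noteq> z'" for z z'
      using that fin by (auto intro!: Min_le)
    ultimately show ?thesis by (intro that[of "Min ?D / 2"]) auto
  qed
  have "\<exists>r \<psi>. 0 < r \<and> \<psi> holomorphic_on ball u0 r \<and> \<psi> u0 = z \<and> (\<forall>u\<in>ball u0 r. \<psi> u \<in> fibre u \<and> dist z (\<psi> u) < \<delta>)"
    if "z \<in> fibre u0" for z
    using local_branch[OF u0 that \<delta>(1)] by metis
  then obtain rr g where rg: "\<And>z. z \<in> fibre u0 \<Longrightarrow> 0 < rr z" "\<And>z. z \<in> fibre u0 \<Longrightarrow> g z holomorphic_on ball u0 (rr z)"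
     "\<And>z. z \<in> fibre u0 \<Longrightarrow> g z u0 = z" "\<And>z u. z \<in> fibre u0 \<Longrightarrow> u \<in> ball u0 (rr z) \<Longrightarrow> g z u \<in> fibre u \<and> dist z (g z u) < \<delta>"
    by metis
  define r where "r = Min (insert 1 (rr ` fibre u0))"
  have r: "0 < r" unfolding r_def using finite_fibre rg(1) by (subst Min_gr_iff) auto
  have rle: "r \<le> rr z" if "z \<in> fibre u0" for z unfolding r_def using finite_fibre that by (intro Min_le) auto
  have sub: "ball u0 r \<subseteq> ball u0 (rr z)" if "z \<in> fibre u0" for z using rle[OF that] by auto
  show ?thesis
  proof
    show "0 < r" by fact
    show "g z holomorphic_on ball u0 r" if "z \<in> fibre u0" for z using rg(2) sub that holomorphic_on_subset by blast
    show "g z u0 = z" if "z \<in> fibre u0" for z using rg(3) that by blast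
    fix u assume u: "u \<in> ball u0 r"
    show inj: "inj_on (\<lambda>z. g z u) (fibre u0)"
    proof (rule inj_onI, rule ccontr)
      fix z z' assume z: "z \<in> fibre u0" "z' \<in> fibre u0" "g z u = g z' u" "z \<noteq> z'"
      have "u \<in> ball u0 (rr z)" "u \<in> ball u0 (rr z')" using sub z u by blast+
      then have "dist z (g z u) < \<delta>" "dist z' (g z u) < \<delta>" using rg(4)[OF z(1)] rg(4)[OF z(2)] z(3) by metis+
      then have "dist z z' < 2 * \<delta>" using dist_triangle2[of z z' "g z u"] by linarith
      then show False using \<delta>(2)[OF z(1,2,4)] by simp
    qed
    have im: "(\<lambda>z. g z u) ` fibre u0 \<subseteq> fibre u" using rg(4) sub u by blast
    have card: "card ((\<lambda>z. g z u) ` fibre u0) = degree A" using inj card_fibre[OF u0] by (simp add: card_image)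
    show "(\<lambda>z. g z u) ` fibre u0 = fibre u"
      using card_fibre_le[of u] card_mono[OF finite_fibre im] card im by (intro card_subset_eq[OF finite_fibre]) auto
  qed
qed

text \<open>A branch of the inverse of f cannot leave \<Omega> over the open disc, since |f| = 1 on the boundary.\<close>

lemma branch_stays_inside:
  assumes C: "connected C" "continuous_on C \<psi>" "\<And>u. u \<in> C \<Longrightarrow> \<psi> u \<in> fibre u" "\<And>u. u \<in> C \<Longrightarrow> norm u < 1"
    and u1: "u1 \<in> C" "\<psi> u1 \<in> closure \<Omega>" and u: "u \<in> C"
  shows "\<psi> u \<in> \<Omega>"
proof (rule ccontr)
  assume "\<psi> u \<notin> \<Omega>"
  have f\<psi>: "f (\<psi> v) = v" if "v \<in> C" for v using C(3)[OF that] fibre_f by blast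
  have "\<psi> u1 \<in> \<Omega>" using u1 f\<psi>[of u1] C(4)[of u1] by (intro in_closure_less_imp_in) auto
  then have "\<psi> ` C \<inter> frontier \<Omega> \<noteq> {}"
    using u1 u \<open>\<psi> u \<notin> \<Omega>\<close> by (intro connected_Int_frontier connected_continuous_image C) auto
  then obtain v where "v \<in> C" "\<psi> v \<in> frontier \<Omega>" by blast
  then show False using f_frontier[of "\<psi> v"] f\<psi>[of v] C(4)[of v] by simp
qed

text \<open>A branch of the inverse is an open map, so that it meets \<Omega> if it starts in the closure of \<Omega>; over the convex set
where |u| < 1 it then stays in \<Omega>, and the parameters on the circle follow by continuity.\<close>

lemma branch_in_closure:
  assumes \<psi>: "\<psi> holomorphic_on ball u0 r" "\<And>u. u \<in> ball u0 r \<Longrightarrow> \<psi> u \<in> fibre u" and r: "0 < r"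
    and z: "\<psi> u0 \<in> closure \<Omega>" and u: "u \<in> ball u0 r" "norm u \<le> 1"
  shows "\<psi> u \<in> closure \<Omega>"
proof -
  have f\<psi>: "f (\<psi> v) = v" if "v \<in> ball u0 r" for v using \<psi>(2)[OF that] fibre_f by blast
  have inj: "inj_on \<psi> (ball u0 r)" by (metis f\<psi> inj_onI)
  have cont: "continuous_on (ball u0 r) \<psi>" using \<psi>(1) by (rule holomorphic_on_imp_continuous_on)
  let ?C = "ball u0 r \<inter> ball 0 1"
  have "open (\<psi> ` ball u0 r)" by (rule open_mapping_thm3[OF \<psi>(1) open_ball inj])
  moreover have "\<psi> u0 \<in> \<psi> ` ball u0 r" using r by simp
  ultimately obtain u1 where u1: "u1 \<in> ball u0 r" "\<psi> u1 \<in> \<Omega>" using z unfolding closure_iff_nhds_not_empty by blast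
  then have "u1 \<in> ?C" using f_in_disc[OF u1(2)] f\<psi> by simp
  have inside: "\<psi> v \<in> \<Omega>" if v: "v \<in> ?C" for v
  proof (rule branch_stays_inside[where C="?C" and \<psi>=\<psi> and ?u1.0=u1 and u=v])
    show "connected ?C" by (intro convex_connected convex_Int convex_ball)
    show "continuous_on ?C \<psi>" by (rule continuous_on_subset[OF cont]) auto
    show "\<psi> u1 \<in> closure \<Omega>" using u1 closure_subset by blast
  qed (use \<psi>(2) \<open>u1 \<in> ?C\<close> v in auto)
  show ?thesis
  proof (rule ccontr)
    assume "\<psi> u \<notin> closure \<Omega>"
    moreover have "open (ball u0 r \<inter> \<psi> -` (- closure \<Omega>))" by (rule continuous_open_preimage[OF cont]) auto
    ultimately obtain e where e: "0 < e" "ball u e \<subseteq> ball u0 r \<inter> \<psi> -` (- closure \<Omega>)"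
      using u open_contains_ball by (metis ComplI IntI vimageI)
    define s where "s = of_real (1 - min e 1 / 2) * u"
    have "norm (u - s) = (min e 1 / 2) * norm u"
    proof -
      have "u - s = of_real (min e 1 / 2) * u" by (simp add: s_def algebra_simps)
      then show ?thesis using e by (simp only: norm_mult norm_of_real)
    qed
    also have "\<dots> \<le> min e 1 / 2 * 1" using u e by (intro mult_left_mono) auto
    also have "\<dots> < e" using e by auto
    finally have s: "s \<in> ball u e" by (simp add: dist_norm)
    have "norm s = \<bar>1 - min e 1 / 2\<bar> * norm u" unfolding s_def by (simp only: norm_mult norm_of_real)
    also have "\<dots> \<le> \<bar>1 - min e 1 / 2\<bar> * 1" using u by (intro mult_left_mono) auto
    also have "\<dots> < 1" using e by auto
    finally have "s \<in> ?C" using s e by auto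
    then show False using inside[of s] e s closure_subset[of \<Omega>] by blast
  qed
qed

end

section \<open>Charts at the boundary\<close>

lemma holomorphic_cnj_cnj:
  assumes S: "open S" and g: "g holomorphic_on S"
  shows "(\<lambda>t. cnj (g (cnj t))) holomorphic_on cnj -` S"
proof (subst holomorphic_on_open)
  show "open (cnj -` S)" by (intro open_vimage S continuous_intros)
  show "\<forall>t\<in>cnj -` S. \<exists>f'. ((\<lambda>t. cnj (g (cnj t))) has_field_derivative f') (at t)"
  proof
    fix t :: complex assume "t \<in> cnj -` S"
    then obtain D where "(g has_field_derivative D) (at (cnj t))" using g holomorphic_on_open[OF S] by blast
    then have g: "(g has_derivative (*) D) (at (cnj t))" by (simp add: has_field_derivative_def)
    have c: "(cnj has_derivative cnj) F" for F by (intro bounded_linear_imp_has_derivative bounded_linear_cnj)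
    have "((\<lambda>t. cnj (g (cnj t))) has_derivative (\<lambda>x. cnj (D * cnj x))) (at t)"
      by (rule has_derivative_compose[OF has_derivative_compose[OF c g] c])
    moreover have "(\<lambda>x. cnj (D * cnj x)) = (*) (cnj D)" by auto
    ultimately show "\<exists>f'. ((\<lambda>t. cnj (g (cnj t))) has_field_derivative f') (at t)"
      unfolding has_field_derivative_def by metis
  qed
qed

lemma connected_half_ball:
  "connected (ball 0 r \<inter> {t. Re t < 0})" "connected (ball 0 r \<inter> {t. 0 < Re t})"
  by (intro convex_connected convex_Int convex_ball convex_halfspace_Re_lt convex_halfspace_Re_gt)+

lemma open_half_ball:
  "open (ball 0 r \<inter> {t. Re t < 0})" "open (ball 0 r \<inter> {t. 0 < Re t})"
  by (intro open_Int open_ball open_halfspace_Re_lt open_halfspace_Re_gt)+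

lemma half_ball_nonempty:
  assumes "0 < r"
  shows "ball 0 r \<inter> {t. Re t < 0} \<noteq> {}" "ball 0 r \<inter> {t. 0 < Re t} \<noteq> {}"
proof -
  have "of_real (- r / 2) \<in> ball 0 r \<inter> {t. Re t < 0}" "of_real (r / 2) \<in> ball 0 r \<inter> {t. 0 < Re t}"
    using assms by (auto simp del: of_real_divide of_real_minus)
  then show "ball 0 r \<inter> {t. Re t < 0} \<noteq> {}" "ball 0 r \<inter> {t. 0 < Re t} \<noteq> {}" by blast+
qed

context rational_proper_domain begin

text \<open>A branch of the inverse of f near a boundary point of a complementary component W, in the coordinate
\<open>t = log (u / u\<^sub>0)\<close>: the unit circle becomes the imaginary axis, the two sides become half-discs, which are convex, and
the reflection u \<mapsto> 1 / cnj u becomes t \<mapsto> - cnj t, which preserves the disc.\<close>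
definition boundary_chart :: "complex set \<Rightarrow> complex \<Rightarrow> real \<Rightarrow> (complex \<Rightarrow> complex) \<Rightarrow> bool" where
  "boundary_chart W u0 r \<theta> \<longleftrightarrow> 0 < r \<and> norm u0 = 1 \<and> \<theta> holomorphic_on ball 0 r \<and> inj_on \<theta> (ball 0 r) \<and>
     (\<forall>t\<in>ball 0 r. \<theta> t \<in> fibre (u0 * exp t) \<and> (Re t < 0 \<longrightarrow> \<theta> t \<in> \<Omega>) \<and> (Re t = 0 \<longrightarrow> \<theta> t \<in> closure \<Omega>) \<and> (0 < Re t \<longrightarrow> \<theta> t \<in> W))"

lemma frontier_component:
  assumes W: "W \<in> components (- closure \<Omega>)" and z: "z \<in> frontier W"
  shows "z \<in> closure \<Omega>" "norm (f z) = 1"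
proof -
  have "z \<in> frontier (- closure \<Omega>)" using frontier_of_components_subset[OF W] z by blast
  then have "z \<in> frontier (closure \<Omega>)" by (simp only: frontier_complement)
  then have "z \<in> frontier \<Omega>" using interior_mono[OF closure_subset[of \<Omega>]] by (auto simp: frontier_def)
  then show "z \<in> closure \<Omega>" "norm (f z) = 1" using f_frontier by (auto simp: frontier_def)
qed

lemma boundary_chart_exists:
  assumes W: "W \<in> components (- closure \<Omega>)" and z0: "z0 \<in> frontier W" "f z0 \<notin> critical" and \<delta>: "0 < \<delta>"
  obtains r \<theta> where "boundary_chart W (f z0) r \<theta>" "\<theta> 0 = z0" "\<And>t. t \<in> ball 0 r \<Longrightarrow> dist z0 (\<theta> t) < \<delta>"
proof -
  define u0 where "u0 = f z0"
  have z0c: "z0 \<in> closure \<Omega>" and u0: "norm u0 = 1" using frontier_component[OF W z0(1)] by (auto simp: u0_def)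
  have z0f: "z0 \<in> fibre u0" unfolding u0_def by (intro in_fibre_f B_nz_closure z0c)
  obtain r1 \<psi> where r1: "0 < r1" "\<psi> holomorphic_on ball u0 r1" "\<psi> u0 = z0" "\<And>u. u \<in> ball u0 r1 \<Longrightarrow> \<psi> u \<in> fibre u"
     "\<And>u. u \<in> ball u0 r1 \<Longrightarrow> dist z0 (\<psi> u) < \<delta>"
    using local_branch[OF z0(2)[folded u0_def] z0f \<delta>] by metis
  let ?e = "\<lambda>t. u0 * exp t"
  have "isCont ?e 0" by (intro continuous_intros)
  then obtain d where d: "0 < d" "\<And>t. dist t 0 < d \<Longrightarrow> dist (?e t) (?e 0) < r1"
    unfolding continuous_at_eps_delta using r1(1) by meson
  define r where "r = min d 1"
  have r: "0 < r" "r \<le> 1" using d by (auto simp: r_def)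
  have e_in: "?e t \<in> ball u0 r1" if "t \<in> ball 0 r" for t using d(2)[of t] that by (auto simp: r_def dist_commute)
  define \<theta> where "\<theta> = (\<lambda>t. \<psi> (?e t))"
  have \<theta>f: "\<theta> t \<in> fibre (?e t)" if "t \<in> ball 0 r" for t using r1(4)[OF e_in[OF that]] by (simp add: \<theta>_def)
  have f\<theta>: "f (\<theta> t) = ?e t" if "t \<in> ball 0 r" for t using fibre_f \<theta>f that by blast
  have norm_e: "norm (?e t) = exp (Re t)" for t using u0 by (simp add: norm_mult)
  have "(\<psi> \<circ> ?e) holomorphic_on ball 0 r"
    by (rule holomorphic_on_compose_gen[OF _ r1(2)]) (use e_in in \<open>auto intro!: holomorphic_intros\<close>)
  then have hol: "\<theta> holomorphic_on ball 0 r" by (simp add: \<theta>_def comp_def)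
  have inj: "inj_on \<theta> (ball 0 r)"
  proof (rule inj_onI)
    fix s t :: complex assume st: "s \<in> ball 0 r" "t \<in> ball 0 r" "\<theta> s = \<theta> t"
    then have "exp s = exp t" using f\<theta>[of s] f\<theta>[of t] u0 by auto
    moreover have "\<bar>Im s - Im t\<bar> < 2 * pi"
      using st r abs_Im_le_cmod[of s] abs_Im_le_cmod[of t] pi_gt3 by auto
    ultimately show "s = t" using exp_complex_eqI by blast
  qed
  have op: "open (\<theta> ` ball 0 r)" by (rule open_mapping_thm3[OF hol open_ball inj])
  have \<theta>0: "\<theta> 0 = z0" using r1(3) by (simp add: \<theta>_def)
  then have z0im: "z0 \<in> \<theta> ` ball 0 r" using r by (metis centre_in_ball imageI)
  have cont: "continuous_on (ball 0 r) \<theta>" using hol by (rule holomorphic_on_imp_continuous_on)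
  have on: "\<theta> t \<in> closure \<Omega>" if t: "t \<in> ball 0 r" "Re t \<le> 0" for t
    unfolding \<theta>_def
  proof (rule branch_in_closure[OF r1(2,4,1) _ e_in[OF t(1)]])
    show "\<psi> u0 \<in> closure \<Omega>" using r1(3) z0c by simp
    show "norm (?e t) \<le> 1" unfolding norm_e using t by simp
  qed
  have inside: "\<theta> t \<in> \<Omega>" if t: "t \<in> ball 0 r" "Re t < 0" for t
    using on[of t] t f\<theta>[OF t(1)] norm_e[of t] by (intro in_closure_less_imp_in) auto
  have outside: "\<theta> t \<in> W" if t: "t \<in> ball 0 r" "0 < Re t" for t
  proof -
    have Wsub: "W \<subseteq> - closure \<Omega>" by (rule in_components_subset[OF W])
    have z0W: "z0 \<in> closure W" using z0 by (auto simp: frontier_def)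
    obtain t2 where t2: "t2 \<in> ball 0 r" "\<theta> t2 \<in> W" using op z0im z0W unfolding closure_iff_nhds_not_empty by blast
    have "0 < Re t2" using t2 on[of t2] Wsub by (cases "Re t2 \<le> 0") auto
    let ?C = "ball 0 r \<inter> {t. 0 < Re t}"
    have "\<theta> ` ?C \<subseteq> W"
    proof (rule components_maximal[OF W])
      show "connected (\<theta> ` ?C)" by (intro connected_continuous_image connected_half_ball continuous_on_subset[OF cont]) auto
      show "\<theta> ` ?C \<subseteq> - closure \<Omega>"
      proof clarify
        fix s assume s: "s \<in> ball 0 r" "0 < Re s" "\<theta> s \<in> closure \<Omega>"
        then show False using f_closure_le[OF s(3)] f\<theta>[OF s(1)] norm_e[of s] by simp
      qed
      show "W \<inter> \<theta> ` ?C \<noteq> {}" using t2 \<open>0 < Re t2\<close> by blast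
    qed
    then show ?thesis using t by blast
  qed
  show ?thesis
  proof (rule that)
    show "boundary_chart W (f z0) r \<theta>"
      unfolding boundary_chart_def u0_def[symmetric] using r u0 hol inj \<theta>f inside on outside by auto
    show "dist z0 (\<theta> t) < \<delta>" if "t \<in> ball 0 r" for t using r1(5)[OF e_in[OF that]] by (simp add: \<theta>_def)
  qed (rule \<theta>0)
qed

text \<open>The Schwarz function of the boundary arc, read in the chart: it is holomorphic, and equals cnj (\<theta> t) on the
imaginary axis.\<close>
definition reflected :: "(complex \<Rightarrow> complex) \<Rightarrow> complex \<Rightarrow> complex" where
  "reflected \<theta> t = cnj (\<theta> (- cnj t))"

lemma reflected_holomorphic: "\<theta> holomorphic_on ball 0 r \<Longrightarrow> reflected \<theta> holomorphic_on ball 0 r"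
proof -
  assume "\<theta> holomorphic_on ball 0 r"
  then have "(\<theta> \<circ> uminus) holomorphic_on ball 0 r"
    by (intro holomorphic_on_compose_gen[where t="ball 0 r"] holomorphic_intros) auto
  then have "(\<lambda>t. \<theta> (- t)) holomorphic_on ball 0 r" by (simp add: comp_def)
  from holomorphic_cnj_cnj[OF open_ball this] have "reflected \<theta> holomorphic_on cnj -` ball 0 r"
    by (simp add: reflected_def[abs_def])
  moreover have "cnj -` ball 0 r = ball 0 r" by auto
  ultimately show ?thesis by simp
qed

text \<open>With f* y = cnj (f (cnj y)) the Schwarz function s satisfies f z f* (s z) = 1, as it does on the arc,
where s z = cnj z and |f z| = 1.\<close>

lemma reflected_fibre:
  assumes "boundary_chart W u0 r \<theta>" "t \<in> ball 0 r"
  shows "poly A (\<theta> t) * cnj (poly A (cnj (reflected \<theta> t))) = poly B (\<theta> t) * cnj (poly B (cnj (reflected \<theta> t)))"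
proof -
  have a: "poly A (\<theta> t) = u0 * exp t * poly B (\<theta> t)"
    and a': "poly A (\<theta> (- cnj t)) = u0 * exp (- cnj t) * poly B (\<theta> (- cnj t))" and "norm u0 = 1"
    using assms by (auto simp: boundary_chart_def fibre_def)
  have u: "u0 * cnj u0 = 1" using \<open>norm u0 = 1\<close> by (simp add: complex_norm_square[symmetric])
  have e: "exp t * cnj (exp (- cnj t)) = 1" by (simp add: exp_cnj flip: exp_add)
  have "poly A (\<theta> t) * cnj (poly A (\<theta> (- cnj t)))
      = (u0 * cnj u0) * (exp t * cnj (exp (- cnj t))) * (poly B (\<theta> t) * cnj (poly B (\<theta> (- cnj t))))"
    unfolding a a' complex_cnj_mult by (simp only: mult_ac)
  then show ?thesis unfolding reflected_def complex_cnj_cnj u e by simp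
qed

definition glued :: "complex \<Rightarrow> (complex \<Rightarrow> complex) \<Rightarrow> complex \<Rightarrow> complex" where
  "glued w \<theta> t = (if Re t \<le> 0 then exp_transform \<Omega> (\<theta> t) w * (reflected \<theta> t - cnj w) / (cnj (\<theta> t) - cnj w)
     else exp_transform \<Omega> (\<theta> t) w)"

text \<open>On the arc cnj z may be replaced by the Schwarz function. Inside \<Omega> this replacement turns
E(z, w) = (cnj z - cnj w) (E(z, w) / (cnj z - cnj w)) into a holomorphic function, which is therefore the
analytic continuation of E(z, w) from W into \<Omega>.\<close>

lemma glued_holomorphic:
  assumes W: "W \<in> components (- closure \<Omega>)" and ch: "boundary_chart W u0 r \<theta>" and w: "w \<notin> closure \<Omega>"
  shows "glued w \<theta> holomorphic_on ball 0 r"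
proof (rule holomorphic_on_paste_across_line[where d=1 and k=0])
  have hol: "\<theta> holomorphic_on ball 0 r" using ch by (simp add: boundary_chart_def)
  have Wsub: "W \<subseteq> - closure \<Omega>" by (rule in_components_subset[OF W])
  note E = open_\<Omega> bounded_\<Omega> w
  have "((\<lambda>z. exp_transform \<Omega> z w / (cnj z - cnj w)) \<circ> \<theta>) holomorphic_on ball 0 r \<inter> {z. 1 \<bullet> z < 0}"
    by (rule holomorphic_on_compose_gen[OF _ exp_transform_holomorphic_inside[OF E]])
       (use hol ch in \<open>auto simp: boundary_chart_def\<close>)
  moreover have "reflected \<theta> holomorphic_on ball 0 r \<inter> {z. 1 \<bullet> z < 0}"
    using reflected_holomorphic[OF hol] by (rule holomorphic_on_subset) auto
  ultimately have "(\<lambda>t. ((\<lambda>z. exp_transform \<Omega> z w / (cnj z - cnj w)) \<circ> \<theta>) t * (reflected \<theta> t - cnj w)) holomorphic_on ball 0 r \<inter> {z. 1 \<bullet> z < 0}"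
    by (intro holomorphic_intros)
  then show "glued w \<theta> holomorphic_on ball 0 r \<inter> {z. 1 \<bullet> z < 0}"
    by (rule holomorphic_transform) (auto simp: glued_def)
  have "((\<lambda>z. exp_transform \<Omega> z w) \<circ> \<theta>) holomorphic_on ball 0 r \<inter> {z. 0 < 1 \<bullet> z}"
    by (rule holomorphic_on_compose_gen[OF _ exp_transform_holomorphic_outside[OF E]])
       (use hol ch Wsub in \<open>auto simp: boundary_chart_def\<close>)
  then show "glued w \<theta> holomorphic_on ball 0 r \<inter> {z. 0 < 1 \<bullet> z}"
    by (rule holomorphic_transform) (auto simp: glued_def)
  have cont: "continuous_on (ball 0 r) \<theta>" "continuous_on (ball 0 r) (reflected \<theta>)"
    using hol reflected_holomorphic[OF hol] by (simp_all add: holomorphic_on_imp_continuous_on)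
  have contE: "continuous_on (ball 0 r) (\<lambda>t. exp_transform \<Omega> (\<theta> t) w)"
    by (rule continuous_on_compose2[OF continuous_exp_transform[OF E] cont(1)]) auto
  show "continuous_on (ball 0 r) (glued w \<theta>)"
    unfolding glued_def
  proof (rule continuous_on_cases_le)
    have nz: "cnj (\<theta> t) - cnj w \<noteq> 0" if "t \<in> ball 0 r" "Re t \<le> 0" for t
    proof -
      have "Re t < 0 \<or> Re t = 0" using that by auto
      then have "\<theta> t \<in> closure \<Omega>" using that ch closure_subset[of \<Omega>] unfolding boundary_chart_def by blast
      then show ?thesis using w by auto
    qed
    show "continuous_on {t \<in> ball 0 r. Re t \<le> 0} (\<lambda>t. exp_transform \<Omega> (\<theta> t) w * (reflected \<theta> t - cnj w) / (cnj (\<theta> t) - cnj w))"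
      using nz by (intro continuous_intros continuous_on_subset[OF contE] continuous_on_subset[OF cont(1)] continuous_on_subset[OF cont(2)]) auto
    show "continuous_on {t \<in> ball 0 r. 0 \<le> Re t} (\<lambda>t. exp_transform \<Omega> (\<theta> t) w)"
      by (rule continuous_on_subset[OF contE]) auto
    show "continuous_on (ball 0 r) Re" by (intro continuous_intros)
    fix t assume t: "t \<in> ball 0 r" "Re t = 0"
    then have "- cnj t = t" by (simp add: complex_eq_iff)
    then show "exp_transform \<Omega> (\<theta> t) w * (reflected \<theta> t - cnj w) / (cnj (\<theta> t) - cnj w) = exp_transform \<Omega> (\<theta> t) w"
      using nz[of t] t by (simp add: reflected_def)
  qed
qed auto

end

section \<open>The Schwarz function of the outer boundary\<close>

definition slice :: "complex poly poly \<Rightarrow> complex \<Rightarrow> complex poly" where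
  "slice P y = map_poly (\<lambda>c. poly c y) P"

lemma poly_slice: "poly (slice P y) x = poly2 P x y"
  unfolding slice_def poly2_def
  by (induction P) (auto simp: map_poly_pCons)

lemma open_imp_fsigma:
  fixes S :: "complex set"
  assumes "open S"
  shows "fsigma S"
proof -
  obtain C :: "nat \<Rightarrow> complex set" where "\<And>n. compact (C n)" "\<Union>(range C) = S"
    using open_Union_compact_subsets[OF assms] by metis
  then show ?thesis unfolding fsigma_Union_compact by (intro exI[of _ C]) auto
qed

lemma countable_components_open:
  fixes S :: "complex set"
  assumes "open S"
  shows "countable (components S)"
proof (rule countable_disjoint_open_subsets)
  show "open T" if "T \<in> components S" for T using that assms open_components by blast
  show "disjoint (components S)"
    using pairwise_disjoint_components[of S] by (simp add: pairwise_def disjnt_def disjoint_def)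
qed

lemma uncountable_open_complex:
  fixes S :: "complex set"
  assumes "open S" "S \<noteq> {}"
  shows "uncountable S"
proof -
  obtain x e where "0 < e" "ball x e \<subseteq> S" using assms open_contains_ball by blast
  then show ?thesis using uncountable_ball countable_subset by blast
qed

lemma holomorphic_zero_on_open_subset:
  assumes "h holomorphic_on S" "open S" "connected S" "N \<subseteq> S" "open N" "N \<noteq> {}" "\<And>z. z \<in> N \<Longrightarrow> h z = 0" "z \<in> S"
  shows "h z = 0"
  by (rule analytic_continuation_open[of N S h "\<lambda>_. 0"]) (use assms in auto)

context rational_proper_domain begin

definition "Ac = map_poly cnj A"
definition "Bc = map_poly cnj B"

lemma poly_Ac: "poly Ac y = cnj (poly A (cnj y))" and poly_Bc: "poly Bc y = cnj (poly B (cnj y))"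
  unfolding Ac_def Bc_def poly_cnj complex_cnj_cnj by auto

text \<open>The curve f z f* s = 1, with f* y = cnj (f (cnj y)), after clearing denominators.\<close>
definition "curve_eq z s = poly A z * poly Ac s - poly B z * poly Bc s"
abbreviation "on_curve z s \<equiv> curve_eq z s = 0"

lemma curve_eq_holomorphic:
  "g holomorphic_on X \<Longrightarrow> h holomorphic_on X \<Longrightarrow> (\<lambda>t. curve_eq (g t) (h t)) holomorphic_on X"
  unfolding curve_eq_def by (intro holomorphic_on_diff holomorphic_on_mult poly_holomorphic_on)

lemma on_curve_iff_fibre: "on_curve z s \<longleftrightarrow> poly A z * cnj (poly A (cnj s)) = poly B z * cnj (poly B (cnj s))"
  by (simp add: curve_eq_def poly_Ac poly_Bc)

lemma fibre_nonempty: "fibre u \<noteq> {}"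
proof -
  have "\<exists>z. poly (A - smult u B) z = 0"
    using degree_fibre_poly[of u] degree_BA by (intro alg_closed_imp_poly_has_root) auto
  then show ?thesis unfolding fibre_eq_roots by auto
qed

lemma on_curve_exists:
  assumes "poly A z \<noteq> 0"
  shows "\<exists>s. on_curve z s"
proof -
  obtain y where "y \<in> fibre (cnj (poly B z / poly A z))" using fibre_nonempty by blast
  then have "cnj (poly A y) = (poly B z / poly A z) * cnj (poly B y)" by (simp add: fibre_def)
  then have "on_curve z (cnj y)" unfolding on_curve_iff_fibre complex_cnj_cnj using assms by simp
  then show ?thesis by blast
qed

lemma boundary_chart_half_open:
  assumes "boundary_chart W u0 r \<theta>"
  shows "open (\<theta> ` (ball 0 r \<inter> {t. Re t < 0}))" "\<theta> ` (ball 0 r \<inter> {t. Re t < 0}) \<noteq> {}" "\<theta> ` (ball 0 r \<inter> {t. Re t < 0}) \<subseteq> \<Omega>"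
    "open (\<theta> ` (ball 0 r \<inter> {t. 0 < Re t}))" "\<theta> ` (ball 0 r \<inter> {t. 0 < Re t}) \<noteq> {}" "\<theta> ` (ball 0 r \<inter> {t. 0 < Re t}) \<subseteq> W"
proof -
  have "0 < r" "\<theta> holomorphic_on ball 0 r" "inj_on \<theta> (ball 0 r)" using assms by (auto simp: boundary_chart_def)
  then show "open (\<theta> ` (ball 0 r \<inter> {t. Re t < 0}))" "open (\<theta> ` (ball 0 r \<inter> {t. 0 < Re t}))"
    "\<theta> ` (ball 0 r \<inter> {t. Re t < 0}) \<noteq> {}"  "\<theta> ` (ball 0 r \<inter> {t. 0 < Re t}) \<noteq> {}"
    using half_ball_nonempty[of r]
    by (auto intro!: open_mapping_thm3 open_half_ball elim!: holomorphic_on_subset inj_on_subset)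
  show "\<theta> ` (ball 0 r \<inter> {t. Re t < 0}) \<subseteq> \<Omega>" "\<theta> ` (ball 0 r \<inter> {t. 0 < Re t}) \<subseteq> W"
    using assms by (auto simp: boundary_chart_def)
qed

lemma finite_critical_preimage: "finite (\<Union>u\<in>critical. fibre u)"
  using finite_critical finite_fibre by auto

lemma component_boundary_chart:
  assumes W: "W \<in> components (- closure \<Omega>)" and X: "finite X"
  obtains z0 where "z0 \<notin> X" "z0 \<in> closure \<Omega>" "\<And>\<delta>. 0 < \<delta> \<Longrightarrow> \<exists>r \<theta>. boundary_chart W (f z0) r \<theta> \<and> (\<forall>t\<in>ball 0 r. dist z0 (\<theta> t) < \<delta>)"
proof -
  have "open W" using W open_components by blast
  moreover have "W \<noteq> {}" using W in_components_nonempty by blast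
  moreover have "\<Omega> \<inter> W = {}" using in_components_subset[OF W] closure_subset by blast
  ultimately obtain z0 where z0: "z0 \<in> frontier W" "z0 \<notin> X \<union> (\<Union>u\<in>critical. fibre u)"
    using frontier_avoids_finite[of W \<Omega> "X \<union> (\<Union>u\<in>critical. fibre u)"] open_\<Omega> nonempty_\<Omega> X finite_critical_preimage by blast
  have z0c: "z0 \<in> closure \<Omega>" by (rule frontier_component[OF W z0(1)])
  have "f z0 \<notin> critical" using z0 in_fibre_f[OF B_nz_closure[OF z0c]] by blast
  then have "\<exists>r \<theta>. boundary_chart W (f z0) r \<theta> \<and> (\<forall>t\<in>ball 0 r. dist z0 (\<theta> t) < \<delta>)" if "0 < \<delta>" for \<delta>
    using boundary_chart_exists[OF W z0(1) _ that] by metis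
  then show ?thesis using that z0 z0c by blast
qed

end

text \<open>For fixed w the polynomials Pw w and Qw w are the numerator and the denominator of E(z, w) as functions of
z. The function Ein w is the part of E(z, w) that is holomorphic in \<Omega>.\<close>

locale rational_exp_transform = rational_proper_domain +
  fixes P Q :: "complex poly poly"
  assumes rational: "\<And>z w. z \<in> outside (closure \<Omega>) \<Longrightarrow> w \<in> outside (closure \<Omega>) \<Longrightarrow>
     poly2 Q z (cnj w) \<noteq> 0 \<and> exp_transform \<Omega> z w = poly2 P z (cnj w) / poly2 Q z (cnj w)"
begin

abbreviation "U \<equiv> outside (closure \<Omega>)"
abbreviation "E w z \<equiv> exp_transform \<Omega> z w"
definition "Ein w z = exp_transform \<Omega> z w / (cnj z - cnj w)"
abbreviation "Pw w \<equiv> poly (slice P (cnj w))"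
abbreviation "Qw w \<equiv> poly (slice Q (cnj w))"

lemma U_open: "open U" and U_nonempty: "U \<noteq> {}" and U_component: "U \<in> components (- closure \<Omega>)"
proof -
  have b: "bounded (closure \<Omega>)" using bounded_\<Omega> by auto
  show "open U" by (rule open_outside) auto
  show ne: "U \<noteq> {}" by (rule outside_bounded_nonempty[OF b])
  show "U \<in> components (- closure \<Omega>)"
    unfolding outside_in_components using ne connected_outside[OF b] by auto
qed

lemma U_notin: "w \<in> U \<Longrightarrow> w \<notin> closure \<Omega>"
  using outside_no_overlap by blast

lemma rational': "z \<in> U \<Longrightarrow> w \<in> U \<Longrightarrow> E w z * Qw w z = Pw w z"
  and Q_nz: "z \<in> U \<Longrightarrow> w \<in> U \<Longrightarrow> Qw w z \<noteq> 0" and P_nz: "z \<in> U \<Longrightarrow> w \<in> U \<Longrightarrow> Pw w z \<noteq> 0"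
  using rational[of z w] exp_transform_nonzero[of \<Omega> z w] by (auto simp: poly_slice)

lemma finite_Q_zeros: "w \<in> U \<Longrightarrow> finite {z. Qw w z = 0}" and finite_P_zeros: "w \<in> U \<Longrightarrow> finite {z. Pw w z = 0}"
  using Q_nz[of w w] P_nz[of w w] by (auto intro!: poly_roots_finite)

lemma E_hol: "w \<in> U \<Longrightarrow> E w holomorphic_on - closure \<Omega>" and Ein_hol: "w \<in> U \<Longrightarrow> Ein w holomorphic_on \<Omega>"
  using exp_transform_holomorphic_outside[OF open_\<Omega> bounded_\<Omega> U_notin] exp_transform_holomorphic_inside[OF open_\<Omega> bounded_\<Omega> U_notin] by (auto simp: Ein_def[abs_def])

lemma Ein_nz: "w \<in> U \<Longrightarrow> z \<in> \<Omega> \<Longrightarrow> Ein w z \<noteq> 0"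
  using U_notin[of w] closure_subset[of \<Omega>] by (auto simp: Ein_def)

text \<open>On the outer side of the arc E Q = P. Continued into \<Omega>, this reads Ein (s - cnj w) Q = P, where s is the Schwarz
function of the arc.\<close>

lemma outer_chart_relation:
  assumes ch: "boundary_chart U u0 r \<theta>" and w: "w \<in> U" and t: "t \<in> ball 0 r" "Re t < 0"
  shows "Ein w (\<theta> t) * (reflected \<theta> t - cnj w) * Qw w (\<theta> t) = Pw w (\<theta> t)"
proof -
  have hol: "\<theta> holomorphic_on ball 0 r" and r: "0 < r" using ch by (auto simp: boundary_chart_def)
  let ?h = "\<lambda>t. glued w \<theta> t * Qw w (\<theta> t) - Pw w (\<theta> t)"
  have "?h t = 0"
  proof (rule holomorphic_zero_on_open_subset[where h="?h" and z=t and S="ball 0 r" and N="ball 0 r \<inter> {t. 0 < Re t}"])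
    show "?h holomorphic_on ball 0 r"
      by (intro holomorphic_intros hol glued_holomorphic[OF U_component ch U_notin[OF w]])
    fix s assume s: "s \<in> ball 0 r \<inter> {t. 0 < Re t}"
    then have "\<theta> s \<in> U" using boundary_chart_half_open(6)[OF ch] by blast
    then show "?h s = 0" using rational'[OF _ w, of "\<theta> s"] s by (auto simp: glued_def)
  qed (use t open_half_ball half_ball_nonempty[OF r] in auto)
  then show ?thesis using t by (simp add: glued_def Ein_def algebra_simps)
qed

text \<open>For \<open>w = w\<^sub>0\<close> the relation on the chart gives \<open>s = cnj w\<^sub>0 + P / (Q Ein)\<close>, a function that is meromorphic in all of \<Omega>. The
relation for any other w, with this expression inserted and denominators cleared, holds on an open set and hence in the
connected set \<Omega>.\<close>

lemma inner_relation:
  assumes w0: "w0 \<in> U" and w: "w \<in> U" and z: "z \<in> \<Omega>"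
  shows "Ein w z * Qw w z * ((cnj w0 - cnj w) * Qw w0 z * Ein w0 z + Pw w0 z) = Pw w z * Qw w0 z * Ein w0 z"
proof -
  obtain z0 where "\<exists>r \<theta>. boundary_chart U (f z0) r \<theta> \<and> (\<forall>t\<in>ball 0 r. dist z0 (\<theta> t) < 1)"
    using component_boundary_chart[OF U_component, of "{}"] by (metis finite.emptyI zero_less_one)
  then obtain r \<theta> where ch: "boundary_chart U (f z0) r \<theta>" by blast
  note half = boundary_chart_half_open[OF ch]
  let ?h = "\<lambda>z. Ein w z * Qw w z * ((cnj w0 - cnj w) * Qw w0 z * Ein w0 z + Pw w0 z) - Pw w z * Qw w0 z * Ein w0 z"
  have "?h z = 0"
  proof (rule holomorphic_zero_on_open_subset[where h="?h" and z=z,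
      OF _ open_\<Omega> connected_\<Omega> half(3,1,2) _ z])
    show "?h holomorphic_on \<Omega>"
      by (intro holomorphic_intros Ein_hol w w0)
    fix z assume "z \<in> \<theta> ` (ball 0 r \<inter> {t. Re t < 0})"
    then obtain t where t: "t \<in> ball 0 r" "Re t < 0" "z = \<theta> t" by auto
    have 1: "Ein w z * (reflected \<theta> t - cnj w) * Qw w z = Pw w z" and 2: "Ein w0 z * (reflected \<theta> t - cnj w0) * Qw w0 z = Pw w0 z"
      using outer_chart_relation[OF ch _ t(1,2)] w w0 t(3) by auto
    have "a * c * ((y0 - y) * d * b + b * (s - y0) * d) - (a * (s - y) * c) * d * b = 0" for a b c d s y y0 :: complex
      by (simp add: algebra_simps)
    from this[of "Ein w z" "Qw w z" "cnj w0" "cnj w" "Qw w0 z" "Ein w0 z" "reflected \<theta> t"]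
    show "?h z = 0"
      unfolding 1 2 by simp
  qed
  then show ?thesis by simp
qed

text \<open>The meromorphic extension of the outer Schwarz function to \<Omega> satisfies the same algebraic equation as the Schwarz
function itself.\<close>

lemma inner_on_curve:
  assumes w0: "w0 \<in> U" and z: "z \<in> \<Omega>" "Qw w0 z \<noteq> 0"
  shows "on_curve z (cnj w0 + Pw w0 z / (Qw w0 z * Ein w0 z))"
proof -
  obtain z0 where "\<exists>r \<theta>. boundary_chart U (f z0) r \<theta> \<and> (\<forall>t\<in>ball 0 r. dist z0 (\<theta> t) < 1)"
    using component_boundary_chart[OF U_component, of "{}"] by (metis finite.emptyI zero_less_one)
  then obtain r \<theta> where ch: "boundary_chart U (f z0) r \<theta>" by blast
  note half = boundary_chart_half_open[OF ch]
  let ?Z = "{z. Qw w0 z = 0}"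
  let ?S = "\<lambda>z. cnj w0 + Pw w0 z / (Qw w0 z * Ein w0 z)"
  have fin: "finite ?Z" by (rule finite_Q_zeros[OF w0])
  have "curve_eq z (?S z) = 0"
  proof (rule holomorphic_zero_on_open_subset[where h="\<lambda>z. curve_eq z (?S z)" and z=z and S="\<Omega> - ?Z" and N="\<theta> ` (ball 0 r \<inter> {t. Re t < 0}) - ?Z"])
    show "connected (\<Omega> - ?Z)" by (intro connected_open_delete_finite open_\<Omega> connected_\<Omega> fin) auto
    show "open (\<Omega> - ?Z)" "open (\<theta> ` (ball 0 r \<inter> {t. Re t < 0}) - ?Z)"
      by (intro open_Diff open_\<Omega> half finite_imp_closed fin)+
    have "uncountable (\<theta> ` (ball 0 r \<inter> {t. Re t < 0}))" by (rule uncountable_open_complex[OF half(1,2)])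
    then have "uncountable (\<theta> ` (ball 0 r \<inter> {t. Re t < 0}) - ?Z)" using fin by (intro uncountable_minus_countable countable_finite)
    then show "\<theta> ` (ball 0 r \<inter> {t. Re t < 0}) - ?Z \<noteq> {}" by (metis countable_empty)
    show "\<theta> ` (ball 0 r \<inter> {t. Re t < 0}) - ?Z \<subseteq> \<Omega> - ?Z" using half(3) by blast
    have Fh: "Ein w0 holomorphic_on \<Omega> - ?Z" using Ein_hol[OF w0] by (rule holomorphic_on_subset) auto
    then have Sh: "?S holomorphic_on \<Omega> - ?Z"
      by (intro holomorphic_intros Fh) (use Ein_nz[OF w0] in auto)
    show "(\<lambda>z. curve_eq z (?S z)) holomorphic_on \<Omega> - ?Z"
      by (rule curve_eq_holomorphic[OF holomorphic_on_ident Sh])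
    show "z \<in> \<Omega> - ?Z" using z by auto
    fix z assume "z \<in> \<theta> ` (ball 0 r \<inter> {t. Re t < 0}) - ?Z"
    then obtain t where t: "t \<in> ball 0 r" "Re t < 0" "z = \<theta> t" and nz: "Qw w0 z \<noteq> 0" by auto
    have z: "z \<in> \<Omega>" using half(3) t by blast
    have "Ein w0 z * (reflected \<theta> t - cnj w0) * Qw w0 z = Pw w0 z"
      using outer_chart_relation[OF ch w0 t(1,2)] t(3) by auto
    then have "?S z = cnj w0 + Ein w0 z * (reflected \<theta> t - cnj w0) * Qw w0 z / (Qw w0 z * Ein w0 z)" by simp
    also have "\<dots> = reflected \<theta> t" using nz Ein_nz[OF w0 z] by (simp del: divide_eq_0_iff)
    finally have "?S z = reflected \<theta> t" .
    then show "curve_eq z (?S z) = 0"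
      using reflected_fibre[OF ch t(1)] unfolding t(3) on_curve_iff_fibre[symmetric] by simp
  qed
  then show ?thesis .
qed

end

section \<open>The exponential transform on the bounded complementary components\<close>

context rational_exp_transform begin

text \<open>In a complementary component E(z, w) is the quotient P / Q only up to a factor (t - cnj w) / (s - cnj w). What matters
is that s and t lie on the curve over z and do not depend on w.\<close>
definition matched_by :: "complex \<Rightarrow> complex \<Rightarrow> complex \<Rightarrow> bool" where
  "matched_by z s t \<longleftrightarrow> on_curve z s \<and> on_curve z t \<and>
     (\<forall>w\<in>U. E w z * Qw w z * (s - cnj w) = Pw w z * (t - cnj w))"

text \<open>Crossing from \<Omega> into a component W involves two functions: the extension S of the Schwarz function of the outer boundary,
and the Schwarz function T of the arc that is crossed. They need not coincide: for the ring \<open>\<rho> < |z| < 1\<close>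
they are \<open>1 / z\<close> and \<open>\<rho>\<^sup>2 / z\<close>. Inside, \<open>Ein Q (S - cnj w) = P\<close>; since \<open>Ein (T - cnj w)\<close> continues
\<open>E\<close>, the relation \<open>E Q (S - cnj w) = P (T - cnj w)\<close> holds on the other side.\<close>

lemma component_matched_locally:
  assumes W: "W \<in> components (- closure \<Omega>)"
  obtains N where "open N" "N \<noteq> {}" "N \<subseteq> W" "\<And>z. z \<in> N \<Longrightarrow> \<exists>s t. matched_by z s t"
proof -
  obtain w0 where w0: "w0 \<in> U" using U_nonempty by blast
  let ?X = "{z. Qw w0 z = 0}"
  have fin: "finite ?X" by (rule finite_Q_zeros[OF w0])
  obtain z0 where z0: "z0 \<notin> ?X" "z0 \<in> closure \<Omega>"
    and charts: "\<And>\<delta>. 0 < \<delta> \<Longrightarrow> \<exists>r \<theta>. boundary_chart W (f z0) r \<theta> \<and> (\<forall>t\<in>ball 0 r. dist z0 (\<theta> t) < \<delta>)"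
    using component_boundary_chart[OF W fin] by metis
  have "open (- insert w0 ?X)" using fin by (intro open_Compl finite_imp_closed) auto
  moreover have "z0 \<in> - insert w0 ?X" using z0 U_notin[OF w0] by auto
  ultimately obtain \<delta> where \<delta>: "0 < \<delta>" "ball z0 \<delta> \<subseteq> - insert w0 ?X" using open_contains_ball by blast
  obtain r \<theta> where ch: "boundary_chart W (f z0) r \<theta>" and near: "\<And>t. t \<in> ball 0 r \<Longrightarrow> dist z0 (\<theta> t) < \<delta>"
    using charts[OF \<delta>(1)] by blast
  note half = boundary_chart_half_open[OF ch]
  have hol: "\<theta> holomorphic_on ball 0 r" and r: "0 < r" using ch by (auto simp: boundary_chart_def)
  have avoid: "\<theta> t \<noteq> w0" "Qw w0 (\<theta> t) \<noteq> 0" if "t \<in> ball 0 r" for t using near[OF that] \<delta>(2) by (auto simp: subset_eq)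
  define T where "T = reflected \<theta>"
  have Thol: "T holomorphic_on ball 0 r" unfolding T_def by (rule reflected_holomorphic[OF hol])
  have Tnz: "T t - cnj w0 \<noteq> 0" if "t \<in> ball 0 r" for t
    using avoid(1)[of "- cnj t"] that by (auto simp: T_def reflected_def)
  let ?K = "\<lambda>w. glued w \<theta>"
  have Khol: "?K w holomorphic_on ball 0 r" if "w \<in> U" for w by (rule glued_holomorphic[OF W ch U_notin[OF that]])
  have K_left: "?K w t = Ein w (\<theta> t) * (T t - cnj w)" if "Re t < 0" for w t
    using that by (simp add: glued_def Ein_def T_def)
  have K_right: "?K w t = E w (\<theta> t)" if "0 < Re t" for w t
    using that by (simp add: glued_def)
  have K_nz: "?K w0 t \<noteq> 0" if t: "t \<in> ball 0 r" for t
  proof -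
    have "cnj (\<theta> t) - cnj w0 \<noteq> 0" using avoid(1)[OF t] by auto
    then show ?thesis using Tnz[OF t] by (auto simp: glued_def T_def)
  qed
  have ident: "h t = 0" if "h holomorphic_on ball 0 r" "\<And>t. t \<in> ball 0 r \<Longrightarrow> Re t < 0 \<Longrightarrow> h t = 0" "t \<in> ball 0 r" for h t
    by (rule holomorphic_zero_on_open_subset[where h=h and z=t and S="ball 0 r" and N="ball 0 r \<inter> {t. Re t < 0}"])
       (use that open_half_ball half_ball_nonempty[OF r] in auto)
  let ?h = "\<lambda>w t. ?K w t * Qw w (\<theta> t) * ((cnj w0 - cnj w) * Qw w0 (\<theta> t) * ?K w0 t + Pw w0 (\<theta> t) * (T t - cnj w0))
      - Pw w (\<theta> t) * (T t - cnj w) * Qw w0 (\<theta> t) * ?K w0 t"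
  have rel: "?h w t = 0" if w: "w \<in> U" and t: "t \<in> ball 0 r" for w t
  proof (rule ident[where h="?h w", OF _ _ t])
    show "?h w holomorphic_on ball 0 r" by (intro holomorphic_intros Khol Thol hol w w0)
    fix t assume t: "t \<in> ball 0 r" "Re t < 0"
    then have z: "\<theta> t \<in> \<Omega>" using half(3) by blast
    have alg: "(F * a) * q * (c * q0 * (F0 * b) + p0 * b) - p' * a * q0 * (F0 * b) = a * b * (F * q * (c * q0 * F0 + p0) - p' * q0 * F0)"
      for F a q c q0 F0 b p0 p' :: complex by (simp add: algebra_simps)
    show "?h w t = 0"
      unfolding K_left[OF t(2)] alg inner_relation[OF w0 w z] by simp
  qed
  \<comment> \<open>The formula \<open>cnj w\<^sub>0 + P / (Q Ein)\<close> with \<open>Ein\<close> replaced by its continuation \<open>?K w0 t / (T t - cnj w0)\<close>.\<close>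
  define S where "S = (\<lambda>t. cnj w0 + Pw w0 (\<theta> t) * (T t - cnj w0) / (Qw w0 (\<theta> t) * ?K w0 t))"
  have Shol: "S holomorphic_on ball 0 r" unfolding S_def
    by (intro holomorphic_on_add holomorphic_on_divide holomorphic_on_mult holomorphic_on_diff holomorphic_on_const poly_holomorphic_on hol Thol Khol w0)
       (use avoid K_nz in auto)
  have S_curve: "on_curve (\<theta> t) (S t)" if t: "t \<in> ball 0 r" for t
  proof -
    have "curve_eq (\<theta> t) (S t) = 0"
    proof (rule ident[where h="\<lambda>t. curve_eq (\<theta> t) (S t)", OF curve_eq_holomorphic[OF hol Shol] _ t])
      fix t assume t: "t \<in> ball 0 r" "Re t < 0"
      then have z: "\<theta> t \<in> \<Omega>" using half(3) by blast
      have "S t = cnj w0 + Pw w0 (\<theta> t) / (Qw w0 (\<theta> t) * Ein w0 (\<theta> t))"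
        using Tnz[OF t(1)] by (simp add: S_def K_left[OF t(2)])
      then show "curve_eq (\<theta> t) (S t) = 0"
        using inner_on_curve[OF w0 z avoid(2)[OF t(1)]] by simp
    qed
    then show ?thesis .
  qed
  have expl: "matched_by (\<theta> t) (S t) (T t)" if t: "t \<in> ball 0 r" "0 < Re t" for t
    unfolding matched_by_def
  proof (intro conjI ballI)
    show "on_curve (\<theta> t) (S t)" by (rule S_curve[OF t(1)])
    show "on_curve (\<theta> t) (T t)" unfolding on_curve_iff_fibre T_def by (rule reflected_fibre[OF ch t(1)])
    fix w assume w: "w \<in> U"
    have alg: "e * (y + p0 * b / (q0 * e0) - y') = x"
      if "e * ((y - y') * q0 * e0 + p0 * b) - x * q0 * e0 = 0" "q0 \<noteq> 0" "e0 \<noteq> 0" for e y p0 b q0 e0 y' x :: complex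
      using that by (simp add: field_simps)
    show "E w (\<theta> t) * Qw w (\<theta> t) * (S t - cnj w) = Pw w (\<theta> t) * (T t - cnj w)"
      unfolding S_def K_right[OF t(2)]
      by (rule alg) (use rel[OF w t(1)] avoid(2)[OF t(1)] in \<open>auto simp: K_right[OF t(2)]\<close>)
  qed
  show ?thesis using that[OF half(4,5,6)] expl by blast
qed

text \<open>For two values of w the relation is a linear system for s and t, with holomorphic coefficients in W. If its
determinant does not vanish identically, Cramer's rule extends s and t meromorphically to W, and the identity theorem extends
their properties. If all determinants vanish identically, then E Q = P in W, and s = t may be any
point of the curve over z.\<close>

lemma component_matched:
  assumes W: "W \<in> components (- closure \<Omega>)"
  shows "\<exists>Z. countable Z \<and> (\<forall>z\<in>W - Z. \<exists>s t. matched_by z s t)"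
proof -
  have W': "open W" "connected W" "W \<subseteq> - closure \<Omega>"
    using W open_components in_components_connected in_components_subset by blast+
  obtain N where N: "open N" "N \<noteq> {}" "N \<subseteq> W" "\<And>z. z \<in> N \<Longrightarrow> \<exists>s t. matched_by z s t"
    using component_matched_locally[OF W] by metis
  obtain w0 where w0: "w0 \<in> U" using U_nonempty by blast
  have "uncountable U" by (rule uncountable_open_complex[OF U_open U_nonempty])
  then have "uncountable (U - {w0})" by (intro uncountable_minus_countable) auto
  then obtain w1 where w1: "w1 \<in> U" "w1 \<noteq> w0" by (metis Diff_iff countable_empty ex_in_conv insertI1)
  have EW: "E w holomorphic_on W" if "w \<in> U" for w using E_hol[OF that] W'(3) by (rule holomorphic_on_subset)
  define e where "e w z = E w z * Qw w z" for w z
  have ehol: "e w holomorphic_on W" if "w \<in> U" for w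
    unfolding e_def by (intro holomorphic_intros EW that)
  define \<Delta> where "\<Delta> w z = e w0 z * Pw w z - e w z * Pw w0 z" for w z
  have \<Delta>hol: "\<Delta> w holomorphic_on W" if "w \<in> U" for w
    unfolding \<Delta>_def by (intro holomorphic_on_diff holomorphic_on_mult poly_holomorphic_on holomorphic_on_ident ehol that w0)
  show ?thesis
  proof (cases "\<exists>w\<in>U. \<exists>z\<in>W. \<Delta> w z \<noteq> 0")
    case True
    then obtain w z1 where w: "w \<in> U" and z1: "z1 \<in> W" "\<Delta> w z1 \<noteq> 0" by blast
    define Z where "Z = {z \<in> W. \<Delta> w z = 0}"
    have Z: "countable Z"
    proof (cases "\<Delta> w constant_on W")
      case True
      then have "Z = {}" using z1 by (auto simp: Z_def constant_on_def)
      then show ?thesis by simp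
    next
      case False
      then show ?thesis unfolding Z_def
        by (intro holomorphic_countable_zeros \<Delta>hol w W' open_imp_fsigma)
    qed
    have WZ: "open (W - Z)"
    proof -
      have "W - Z = W \<inter> \<Delta> w -` (- {0})" by (auto simp: Z_def)
      then show ?thesis
        using continuous_open_preimage[OF holomorphic_on_imp_continuous_on[OF \<Delta>hol[OF w]] W'(1), of "- {0}"] by auto
    qed
    have WZc: "connected (W - Z)" by (rule connected_open_diff_countable[OF _ W'(1,2) Z]) simp
    have NZ: "open (N - Z)"
    proof -
      have "N - Z = N \<inter> (W - Z)" using N(3) by auto
      then show ?thesis using open_Int[OF N(1) WZ] by simp
    qed
    have "uncountable (N - Z)" by (intro uncountable_minus_countable Z uncountable_open_complex N)
    then have NZne: "N - Z \<noteq> {}" by (metis countable_empty)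
    define c where "c v z = cnj v * (e v z - Pw v z)" for v z
    have chol: "c v holomorphic_on W" if "v \<in> U" for v
      unfolding c_def by (intro holomorphic_on_diff holomorphic_on_mult holomorphic_on_const poly_holomorphic_on holomorphic_on_ident ehol that)
    \<comment> \<open>Cramer's rule for the equations that belong to \<open>w\<close> and \<open>w0\<close>.\<close>
    define S where "S z = (Pw w z * c w0 z - Pw w0 z * c w z) / \<Delta> w z" for z
    define T where "T z = (e w z * c w0 z - e w0 z * c w z) / \<Delta> w z" for z
    have nz: "\<Delta> w z \<noteq> 0" if "z \<in> W - Z" for z using that by (auto simp: Z_def)
    have sub: "h holomorphic_on W - Z" if "h holomorphic_on W" for h using that by (rule holomorphic_on_subset) auto
    have Shol: "S holomorphic_on W - Z" unfolding S_def
      by (intro holomorphic_on_divide holomorphic_on_diff holomorphic_on_mult poly_holomorphic_on holomorphic_on_ident sub[OF ehol] sub[OF chol] sub[OF \<Delta>hol] w w0 nz)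
    have Thol: "T holomorphic_on W - Z" unfolding T_def
      by (intro holomorphic_on_divide holomorphic_on_diff holomorphic_on_mult poly_holomorphic_on holomorphic_on_ident sub[OF ehol] sub[OF chol] sub[OF \<Delta>hol] w w0 nz)
    have sol: "matched_by z (S z) (T z)" if z: "z \<in> N - Z" for z
    proof -
      obtain s t where st: "matched_by z s t" using N(4) z by blast
      have 1: "e w z * (s - cnj w) = Pw w z * (t - cnj w)" and 2: "e w0 z * (s - cnj w0) = Pw w0 z * (t - cnj w0)"
        using st w w0 by (auto simp: matched_by_def e_def)
      have s: "s * (e0 * p1 - e1 * p0) = p1 * (y0 * (e0 - p0)) - p0 * (y1 * (e1 - p1))"
        and t: "t * (e0 * p1 - e1 * p0) = e1 * (y0 * (e0 - p0)) - e0 * (y1 * (e1 - p1))"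
        if "e1 * (s - y1) = p1 * (t - y1)" "e0 * (s - y0) = p0 * (t - y0)" for e0 e1 p0 p1 y0 y1 :: complex
        using that by algebra+
      have "\<Delta> w z \<noteq> 0" using z N(3) by (intro nz) auto
      then have "s = S z" "t = T z" using s[OF 1 2] t[OF 1 2] unfolding S_def T_def c_def \<Delta>_def by (auto simp: eq_divide_eq)
      with st show ?thesis by simp
    qed
    have "matched_by z (S z) (T z)" if z: "z \<in> W - Z" for z
    proof -
      have ident: "h z = 0" if "h holomorphic_on W - Z" "\<And>z. z \<in> N - Z \<Longrightarrow> h z = 0" for h
        by (rule holomorphic_zero_on_open_subset[where h=h and z=z, OF that(1) WZ WZc _ NZ NZne that(2) z]) (use N(3) in auto)
      have "on_curve z (S z)"
        by (rule ident[OF curve_eq_holomorphic[OF holomorphic_on_ident Shol]]) (use sol in \<open>auto simp: matched_by_def\<close>)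
      moreover have "on_curve z (T z)"
        by (rule ident[OF curve_eq_holomorphic[OF holomorphic_on_ident Thol]]) (use sol in \<open>auto simp: matched_by_def\<close>)
      moreover have "e v z * (S z - cnj v) - Pw v z * (T z - cnj v) = 0" if v: "v \<in> U" for v
      proof (rule ident[where h="\<lambda>z. e v z * (S z - cnj v) - Pw v z * (T z - cnj v)"])
        show "(\<lambda>z. e v z * (S z - cnj v) - Pw v z * (T z - cnj v)) holomorphic_on W - Z"
          by (intro holomorphic_on_diff holomorphic_on_mult poly_holomorphic_on holomorphic_on_ident holomorphic_on_const Shol Thol sub[OF ehol[OF v]])
        show "e v z * (S z - cnj v) - Pw v z * (T z - cnj v) = 0" if "z \<in> N - Z" for z
          using sol[OF that] v unfolding matched_by_def e_def right_minus_eq by blast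
      qed
      ultimately show ?thesis unfolding matched_by_def e_def right_minus_eq by blast
    qed
    with Z show ?thesis by blast
  next
    case False
    then have \<Delta>0: "e w0 z * Pw w z = e w z * Pw w0 z" if "w \<in> U" "z \<in> W" for w z using that by (auto simp: \<Delta>_def)
    have eP: "e w z = Pw w z" if w: "w \<in> U" "w \<noteq> w0" and z: "z \<in> W" for w z
    proof -
      let ?Z = "{z. Pw w0 z = 0}"
      have fin: "finite ?Z" by (rule finite_P_zeros[OF w0])
      have "uncountable (N - ?Z)" by (intro uncountable_minus_countable countable_finite fin uncountable_open_complex N)
      then have ne: "N - ?Z \<noteq> {}" by (metis countable_empty)
      have "e w z - Pw w z = 0"
      proof (rule holomorphic_zero_on_open_subset[where h="\<lambda>z. e w z - Pw w z" and z=z, OF _ W'(1,2) _ _ ne _ z])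
        show "(\<lambda>z. e w z - Pw w z) holomorphic_on W"
          by (intro holomorphic_on_diff poly_holomorphic_on holomorphic_on_ident ehol w)
        show "N - ?Z \<subseteq> W" using N(3) by auto
        show "open (N - ?Z)" by (intro open_Diff N finite_imp_closed fin)
        fix z assume z: "z \<in> N - ?Z"
        obtain s t where st: "matched_by z s t" using N(4) z by blast
        have 1: "e w z * (s - cnj w) = Pw w z * (t - cnj w)" and 2: "e w0 z * (s - cnj w0) = Pw w0 z * (t - cnj w0)"
          using st w w0 by (auto simp: matched_by_def e_def)
        have 3: "e w0 z * Pw w z = e w z * Pw w0 z" using \<Delta>0 w z N(3) by auto
        have "p0 * (e1 - p1) * (y0 - y1) = 0"
          if "e1 * (s - y1) = p1 * (t - y1)" "e0 * (s - y0) = p0 * (t - y0)" "e0 * p1 = e1 * p0" for e0 e1 p0 p1 y0 y1 :: complex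
          using that by algebra
        from this[OF 1 2 3] show "e w z - Pw w z = 0" using w z by auto
      qed
      then show ?thesis by simp
    qed
    let ?Z = "{z. poly A z = 0} \<union> {z. Pw w1 z = 0}"
    have "A \<noteq> 0" using degree_BA by auto
    then have "finite ?Z" using poly_roots_finite finite_P_zeros[OF w1(1)] by auto
    moreover have "\<exists>s t. matched_by z s t" if z: "z \<in> W - ?Z" for z
    proof -
      obtain s where s: "on_curve z s" using on_curve_exists[of z] z by auto
      have "e w z = Pw w z" if w: "w \<in> U" for w
      proof (cases "w = w0")
        case True
        have "e w0 z * Pw w1 z = Pw w1 z * Pw w0 z" using \<Delta>0[OF w1(1), of z] eP[OF w1, of z] z by auto
        then show ?thesis using True z by auto
      qed (use eP w z in auto)
      then have "matched_by z s s" using s by (auto simp: matched_by_def e_def)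
      then show ?thesis by blast
    qed
    ultimately show ?thesis by (intro exI[of _ ?Z]) (auto intro: countable_finite)
  qed
qed

lemma complement_matched:
  obtains Z where "countable Z" "\<And>z. z \<notin> closure \<Omega> \<Longrightarrow> z \<notin> Z \<Longrightarrow> \<exists>s t. matched_by z s t"
proof -
  have "\<forall>W\<in>components (- closure \<Omega>). \<exists>Z. countable Z \<and> (\<forall>z\<in>W - Z. \<exists>s t. matched_by z s t)"
    using component_matched by blast
  then obtain Z where Z: "\<And>W. W \<in> components (- closure \<Omega>) \<Longrightarrow> countable (Z W)"
     "\<And>W z. W \<in> components (- closure \<Omega>) \<Longrightarrow> z \<in> W - Z W \<Longrightarrow> \<exists>s t. matched_by z s t"
    by (metis (no_types, lifting))
  show ?thesis
  proof
    show "countable (\<Union>W\<in>components (- closure \<Omega>). Z W)"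
      using countable_components_open[of "- closure \<Omega>"] Z(1) by auto
    fix z assume z: "z \<notin> closure \<Omega>" "z \<notin> (\<Union>W\<in>components (- closure \<Omega>). Z W)"
    then obtain W where "W \<in> components (- closure \<Omega>)" "z \<in> W" using Union_components[of "- closure \<Omega>"] by blast
    then show "\<exists>s t. matched_by z s t" using Z(2) z(2) by blast
  qed
qed

end

section \<open>The product formula over a fibre\<close>

context rational_proper_domain begin

lemma fibre_outside: "1 < norm u \<Longrightarrow> z \<in> fibre u \<Longrightarrow> z \<notin> closure \<Omega>"
  using f_closure_le[of z] fibre_f[of z u] by auto

text \<open>Holomorphic enumerations of the fibres over a neighbourhood of u0 that also separate the points in the closure of \<Omega> from
the others as long as |u| \<le> 1.\<close>
definition local_sections :: "complex \<Rightarrow> real \<Rightarrow> (complex \<Rightarrow> complex \<Rightarrow> complex) \<Rightarrow> bool" where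
  "local_sections u0 r g \<longleftrightarrow> 0 < r \<and> (\<forall>z\<in>fibre u0. g z holomorphic_on ball u0 r) \<and>
     (\<forall>u\<in>ball u0 r. inj_on (\<lambda>z. g z u) (fibre u0) \<and> (\<lambda>z. g z u) ` fibre u0 = fibre u \<and>
        (norm u \<le> 1 \<longrightarrow> (\<forall>z\<in>fibre u0. g z u \<in> closure \<Omega> \<longleftrightarrow> z \<in> closure \<Omega>)))"

lemma local_sections_exist:
  assumes u0: "u0 \<notin> critical"
  shows "\<exists>r g. local_sections u0 r g"
proof -
  obtain r g where r: "0 < r" and g: "\<And>z. z \<in> fibre u0 \<Longrightarrow> g z holomorphic_on ball u0 r" "\<And>z. z \<in> fibre u0 \<Longrightarrow> g z u0 = z"
    "\<And>u. u \<in> ball u0 r \<Longrightarrow> inj_on (\<lambda>z. g z u) (fibre u0)" "\<And>u. u \<in> ball u0 r \<Longrightarrow> (\<lambda>z. g z u) ` fibre u0 = fibre u"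
    using all_branches[OF u0] by metis
  have "\<exists>e. 0 < e \<and> e \<le> r \<and> (\<forall>u\<in>ball u0 e. z \<notin> closure \<Omega> \<longrightarrow> g z u \<notin> closure \<Omega>)" if z: "z \<in> fibre u0" for z
  proof (cases "z \<in> closure \<Omega>")
    case False
    have "open (ball u0 r \<inter> g z -` (- closure \<Omega>))"
      by (rule continuous_open_preimage[OF holomorphic_on_imp_continuous_on[OF g(1)[OF z]]]) auto
    moreover have "u0 \<in> ball u0 r \<inter> g z -` (- closure \<Omega>)" using g(2)[OF z] False r by auto
    ultimately obtain e where "0 < e" "ball u0 e \<subseteq> ball u0 r \<inter> g z -` (- closure \<Omega>)" using open_contains_ball by metis
    then show ?thesis using r by (intro exI[of _ "min e r"]) auto
  qed (use r in auto)
  then obtain ee where ee: "\<And>z. z \<in> fibre u0 \<Longrightarrow> 0 < ee z" "\<And>z. z \<in> fibre u0 \<Longrightarrow> ee z \<le> r"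
     "\<And>z u. z \<in> fibre u0 \<Longrightarrow> u \<in> ball u0 (ee z) \<Longrightarrow> z \<notin> closure \<Omega> \<Longrightarrow> g z u \<notin> closure \<Omega>" by metis
  define e where "e = Min (insert r (ee ` fibre u0))"
  have e: "0 < e" "e \<le> r" unfolding e_def using finite_fibre r ee(1) by auto
  have ele: "e \<le> ee z" if "z \<in> fibre u0" for z unfolding e_def using finite_fibre that by (intro Min_le) auto
  have sub: "ball u0 e \<subseteq> ball u0 r" using e by auto
  have mem: "g z u \<in> closure \<Omega> \<longleftrightarrow> z \<in> closure \<Omega>" if u: "u \<in> ball u0 e" "norm u \<le> 1" and z: "z \<in> fibre u0" for u z
  proof
    assume zc: "z \<in> closure \<Omega>"
    have gf: "g z v \<in> fibre v" if "v \<in> ball u0 r" for v using g(4)[OF that] z by blast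
    have "g z u0 \<in> closure \<Omega>" unfolding g(2)[OF z] by (rule zc)
    from branch_in_closure[OF g(1)[OF z] gf r this subsetD[OF sub u(1)] u(2)]
    show "g z u \<in> closure \<Omega>" .
  next
    assume "g z u \<in> closure \<Omega>"
    moreover have "u \<in> ball u0 (ee z)" using u ele[OF z] by auto
    ultimately show "z \<in> closure \<Omega>" using ee(3)[OF z] by blast
  qed
  have "local_sections u0 e g"
    unfolding local_sections_def
  proof (intro conjI ballI impI)
    show "0 < e" by fact
    show "g z holomorphic_on ball u0 e" if "z \<in> fibre u0" for z using g(1)[OF that] sub by (rule holomorphic_on_subset)
    show "inj_on (\<lambda>z. g z u) (fibre u0)" "(\<lambda>z. g z u) ` fibre u0 = fibre u" if "u \<in> ball u0 e" for u
      using g(3,4)[OF subsetD[OF sub that]] .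
  qed (rule mem)
  then show ?thesis by blast
qed

lemma local_sectionsD:
  assumes "local_sections u0 r g"
  shows "0 < r" "z \<in> fibre u0 \<Longrightarrow> g z holomorphic_on ball u0 r"
    "z \<in> fibre u0 \<Longrightarrow> u \<in> ball u0 r \<Longrightarrow> g z u \<in> fibre u"
    "z \<in> fibre u0 \<Longrightarrow> u \<in> ball u0 r \<Longrightarrow> norm u \<le> 1 \<Longrightarrow> g z u \<in> closure \<Omega> \<longleftrightarrow> z \<in> closure \<Omega>"
  using assms unfolding local_sections_def by blast+

context
  fixes w :: complex
  assumes w: "w \<notin> closure \<Omega>"
begin

definition "fibre_prod u = (\<Prod>z\<in>fibre u. exp_transform \<Omega> z w)"
definition "inner_prod u = (\<Prod>z\<in>fibre u \<inter> closure \<Omega>. cnj z - cnj w)"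

lemma inner_prod_nz: "inner_prod u \<noteq> 0"
  unfolding inner_prod_def using w by (auto simp: finite_fibre)

lemma fibre_prod_local:
  assumes "local_sections u0 r g" "u \<in> ball u0 r"
  shows "fibre_prod u = (\<Prod>z\<in>fibre u0. exp_transform \<Omega> (g z u) w)"
proof -
  have "inj_on (\<lambda>z. g z u) (fibre u0)" and im: "(\<lambda>z. g z u) ` fibre u0 = fibre u"
    using assms unfolding local_sections_def by blast+
  then show ?thesis unfolding fibre_prod_def im[symmetric] by (simp add: prod.reindex)
qed

lemma inner_prod_local:
  assumes "local_sections u0 r g" "u \<in> ball u0 r" "norm u \<le> 1"
  shows "inner_prod u = (\<Prod>z\<in>fibre u0 \<inter> closure \<Omega>. cnj (g z u) - cnj w)"
proof -
  have inj: "inj_on (\<lambda>z. g z u) (fibre u0)" and im: "(\<lambda>z. g z u) ` fibre u0 = fibre u"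
    and mem: "\<forall>z\<in>fibre u0. g z u \<in> closure \<Omega> \<longleftrightarrow> z \<in> closure \<Omega>"
    using assms unfolding local_sections_def by blast+
  have "fibre u \<inter> closure \<Omega> = (\<lambda>z. g z u) ` (fibre u0 \<inter> closure \<Omega>)" unfolding im[symmetric] using mem by blast
  moreover have "inj_on (\<lambda>z. g z u) (fibre u0 \<inter> closure \<Omega>)" using inj by (rule inj_on_subset) auto
  ultimately show ?thesis unfolding inner_prod_def by (simp add: prod.reindex)
qed

lemma continuous_fibre_prod: "continuous_on (- critical) fibre_prod"
  unfolding continuous_on_eq_continuous_within
proof
  fix u0 assume u0: "u0 \<in> - critical"
  then obtain r g where ls: "local_sections u0 r g" using local_sections_exist by blast
  note r = local_sectionsD(1)[OF ls]
  have "continuous_on (ball u0 r) (\<lambda>u. \<Prod>z\<in>fibre u0. exp_transform \<Omega> (g z u) w)"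
    by (intro continuous_on_prod continuous_on_compose2[OF continuous_exp_transform[OF open_\<Omega> bounded_\<Omega> w]]
        holomorphic_on_imp_continuous_on local_sectionsD(2)[OF ls]) auto
  then have "continuous (at u0 within - critical) (\<lambda>u. \<Prod>z\<in>fibre u0. exp_transform \<Omega> (g z u) w)"
    by - (rule continuous_at_imp_continuous_at_within, use r in \<open>simp add: continuous_on_eq_continuous_at\<close>)
  then show "continuous (at u0 within - critical) fibre_prod"
    by (rule continuous_transform_within[OF _ r u0]) (use fibre_prod_local[OF ls] in \<open>auto simp: dist_commute\<close>)
qed

lemma continuous_inner_prod: "continuous_on (cball 0 1 - critical) inner_prod"
  unfolding continuous_on_eq_continuous_within
proof
  fix u0 assume u0: "u0 \<in> cball 0 1 - critical"
  then obtain r g where ls: "local_sections u0 r g" using local_sections_exist by blast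
  note r = local_sectionsD(1)[OF ls]
  have "continuous_on (ball u0 r) (\<lambda>u. \<Prod>z\<in>fibre u0 \<inter> closure \<Omega>. cnj (g z u) - cnj w)"
    by (intro continuous_on_prod continuous_intros holomorphic_on_imp_continuous_on local_sectionsD(2)[OF ls]) auto
  then have "continuous (at u0 within cball 0 1 - critical) (\<lambda>u. \<Prod>z\<in>fibre u0 \<inter> closure \<Omega>. cnj (g z u) - cnj w)"
    by - (rule continuous_at_imp_continuous_at_within, use r in \<open>simp add: continuous_on_eq_continuous_at\<close>)
  then show "continuous (at u0 within cball 0 1 - critical) inner_prod"
    by (rule continuous_transform_within[OF _ r u0]) (use inner_prod_local[OF ls] in \<open>auto simp: dist_commute\<close>)
qed

text \<open>The denominator takes exactly one factor cnj z - cnj w from each point z of the fibre in \<Omega>, which leaves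
E(z, w) / (cnj z - cnj w); at the other points E(z, w) itself is holomorphic.\<close>

lemma holomorphic_ratio_inside:
  "(\<lambda>u. fibre_prod u / inner_prod u) holomorphic_on ball 0 1 - critical"
proof (rule holomorphic_locally)
  show "open (ball 0 1 - critical)" by (intro open_Diff finite_imp_closed finite_critical) auto
  fix u0 assume u0: "u0 \<in> ball 0 1 - critical"
  obtain r g where ls: "local_sections u0 r g" using local_sections_exist u0 by blast
  note r = local_sectionsD(1)[OF ls] and g = local_sectionsD(2)[OF ls]
  define N where "N = ball u0 r \<inter> ball 0 1"
  have gN: "g z holomorphic_on N" if "z \<in> fibre u0" for z using g[OF that] by (rule holomorphic_on_subset) (auto simp: N_def)
  have gin: "g z u \<in> \<Omega>" if "z \<in> fibre u0 \<inter> closure \<Omega>" "u \<in> N" for z u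
  proof (rule in_closure_less_imp_in)
    show "g z u \<in> closure \<Omega>" using local_sectionsD(4)[OF ls, of z u] that by (auto simp: N_def)
    have "g z u \<in> fibre u" using local_sectionsD(3)[OF ls] that by (auto simp: N_def)
    then show "norm (f (g z u)) < 1" using fibre_f that by (auto simp: N_def)
  qed
  have gout: "g z u \<notin> closure \<Omega>" if "z \<in> fibre u0 - closure \<Omega>" "u \<in> N" for z u
    using local_sectionsD(4)[OF ls, of z u] that by (auto simp: N_def)
  have in_hol: "(\<lambda>u. exp_transform \<Omega> (g z u) w / (cnj (g z u) - cnj w)) holomorphic_on N" if z: "z \<in> fibre u0 \<inter> closure \<Omega>" for z
    using holomorphic_on_compose_gen[OF gN exp_transform_holomorphic_inside[OF open_\<Omega> bounded_\<Omega> w], of z] gin[OF z] z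
    by (auto simp: comp_def)
  have out_hol: "(\<lambda>u. exp_transform \<Omega> (g z u) w) holomorphic_on N" if z: "z \<in> fibre u0 - closure \<Omega>" for z
    using holomorphic_on_compose_gen[OF gN exp_transform_holomorphic_outside[OF open_\<Omega> bounded_\<Omega> w], of z] gout[OF z] z
    by (auto simp: comp_def)
  have "(\<lambda>u. (\<Prod>z\<in>fibre u0 \<inter> closure \<Omega>. exp_transform \<Omega> (g z u) w / (cnj (g z u) - cnj w)) * (\<Prod>z\<in>fibre u0 - closure \<Omega>. exp_transform \<Omega> (g z u) w)) holomorphic_on N"
    by (intro holomorphic_on_mult holomorphic_on_prod in_hol out_hol)
  then have "(\<lambda>u. fibre_prod u / inner_prod u) holomorphic_on N"
  proof (rule holomorphic_transform)
    fix u assume u: "u \<in> N"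
    have "fibre_prod u = (\<Prod>z\<in>fibre u0 \<inter> closure \<Omega>. exp_transform \<Omega> (g z u) w) * (\<Prod>z\<in>fibre u0 - closure \<Omega>. exp_transform \<Omega> (g z u) w)"
      using fibre_prod_local[OF ls, of u] u prod.Int_Diff[OF finite_fibre] by (auto simp: N_def)
    moreover have "inner_prod u = (\<Prod>z\<in>fibre u0 \<inter> closure \<Omega>. cnj (g z u) - cnj w)"
      using inner_prod_local[OF ls, of u] u by (auto simp: N_def)
    ultimately show "(\<Prod>z\<in>fibre u0 \<inter> closure \<Omega>. exp_transform \<Omega> (g z u) w / (cnj (g z u) - cnj w)) * (\<Prod>z\<in>fibre u0 - closure \<Omega>. exp_transform \<Omega> (g z u) w)
        = fibre_prod u / inner_prod u"
      by (simp add: prod_dividef)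
  qed
  moreover have "open N" "u0 \<in> N" using u0 r by (auto simp: N_def)
  ultimately show "\<exists>N. open N \<and> u0 \<in> N \<and> (\<lambda>u. fibre_prod u / inner_prod u) holomorphic_on N" by blast
qed

lemma holomorphic_fibre_prod_outside: "fibre_prod holomorphic_on {u. 1 < norm u} - critical"
proof (rule holomorphic_locally)
  have op: "open {u::complex. 1 < norm u}" by (intro open_Collect_less continuous_intros)
  then show "open ({u. 1 < norm u} - critical)" by (intro open_Diff finite_imp_closed finite_critical) auto
  fix u0 assume u0: "u0 \<in> {u. 1 < norm u} - critical"
  obtain r g where ls: "local_sections u0 r g" using local_sections_exist u0 by blast
  note r = local_sectionsD(1)[OF ls] and g = local_sectionsD(2)[OF ls]
  define N where "N = ball u0 r \<inter> {u. 1 < norm u}"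
  have out_hol: "(\<lambda>u. exp_transform \<Omega> (g z u) w) holomorphic_on N" if z: "z \<in> fibre u0" for z
  proof -
    have "g z holomorphic_on N" using g[OF z] by (rule holomorphic_on_subset) (auto simp: N_def)
    moreover have "g z ` N \<subseteq> - closure \<Omega>" using fibre_outside local_sectionsD(3)[OF ls] z by (fastforce simp: N_def)
    ultimately show ?thesis
      using holomorphic_on_compose_gen[OF _ exp_transform_holomorphic_outside[OF open_\<Omega> bounded_\<Omega> w], of "g z"] by (auto simp: comp_def)
  qed
  have "(\<lambda>u. \<Prod>z\<in>fibre u0. exp_transform \<Omega> (g z u) w) holomorphic_on N"
    by (intro holomorphic_on_prod out_hol)
  then have "fibre_prod holomorphic_on N"
    by (rule holomorphic_transform) (use fibre_prod_local[OF ls] in \<open>auto simp: N_def\<close>)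
  moreover have "open N" "u0 \<in> N" using u0 r op by (auto simp: N_def)
  ultimately show "\<exists>N. open N \<and> u0 \<in> N \<and> fibre_prod holomorphic_on N" by blast
qed

lemma antiholomorphic_inner_prod:
  "(\<lambda>u. inner_prod (cnj u)) holomorphic_on cnj -` (ball 0 1 - critical)"
proof (rule holomorphic_locally)
  show "open (cnj -` (ball 0 1 - critical))"
    by (intro open_vimage open_Diff finite_imp_closed finite_critical continuous_intros) auto
  fix x assume x: "x \<in> cnj -` (ball 0 1 - critical)"
  define u0 where "u0 = cnj x"
  obtain r g where ls: "local_sections u0 r g" using local_sections_exist[of u0] x by (auto simp: u0_def)
  note r = local_sectionsD(1)[OF ls] and g = local_sectionsD(2)[OF ls]
  define N where "N = cnj -` (ball u0 r \<inter> ball 0 1)"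
  have "(\<lambda>u. \<Prod>z\<in>fibre u0 \<inter> closure \<Omega>. cnj (g z (cnj u)) - cnj w) holomorphic_on N"
    unfolding N_def
    by (intro holomorphic_on_prod holomorphic_on_diff holomorphic_on_const holomorphic_cnj_cnj) (auto intro: holomorphic_on_subset[OF g])
  then have "(\<lambda>u. inner_prod (cnj u)) holomorphic_on N"
    by (rule holomorphic_transform) (use inner_prod_local[OF ls] in \<open>auto simp: N_def\<close>)
  moreover have "open N" "x \<in> N" using x r by (auto simp: N_def u0_def intro!: open_vimage continuous_intros)
  ultimately show "\<exists>N. open N \<and> x \<in> N \<and> (\<lambda>u. inner_prod (cnj u)) holomorphic_on N" by blast
qed

text \<open>The left-hand side is holomorphic in u for |u| > 1, and so is the product on the right, since it is
antiholomorphic in 1 / cnj u. On the circle 1 / cnj u = u, and there the quotient of the two sides matches the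
corresponding quotient on the disc, which is holomorphic by the previous lemmas. Together they form a function that is bounded and holomorphic in the plane
except for finitely many critical values; so it is constant.\<close>

lemma product_formula:
  "\<exists>c. \<forall>u. 1 < norm u \<longrightarrow> u \<notin> critical \<longrightarrow> 1 / cnj u \<notin> critical \<longrightarrow>
     (\<Prod>z\<in>fibre u. exp_transform \<Omega> z w) = c * (\<Prod>\<zeta>\<in>fibre (1 / cnj u) \<inter> \<Omega>. cnj \<zeta> - cnj w)"
proof -
  define K where "K = critical \<union> (\<lambda>u. 1 / cnj u) ` critical"
  have K: "finite K" using finite_critical by (auto simp: K_def)
  have K_refl: "1 / cnj u \<notin> critical" if "u \<notin> K" for u
  proof
    assume "1 / cnj u \<in> critical"
    then have "1 / cnj (1 / cnj u) \<in> (\<lambda>u. 1 / cnj u) ` critical" by blast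
    then show False using that by (simp add: K_def)
  qed
  define \<rho> where "\<rho> u = (if norm u \<le> 1 then u else 1 / cnj u)" for u :: complex
  have \<rho>_cont: "continuous_on UNIV \<rho>"
    unfolding \<rho>_def
  proof (rule continuous_on_cases_le)
    show "continuous_on {u \<in> UNIV. 1 \<le> norm u} (\<lambda>u. 1 / cnj u)" by (intro continuous_intros) auto
    fix u :: complex assume "norm u = 1"
    then have "u * cnj u = 1" "u \<noteq> 0" by (auto simp: complex_norm_square[symmetric])
    then show "u = 1 / cnj u" by (simp add: field_simps)
  qed (intro continuous_intros)+
  have \<rho>_in: "\<rho> u \<in> cball 0 1 - critical" if "u \<notin> K" for u
    using that K_refl[OF that] by (auto simp: \<rho>_def K_def norm_divide divide_le_eq_1)
  define X where "X u = fibre_prod u / inner_prod (\<rho> u)" for u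
  have "X holomorphic_on - K"
  proof (rule holomorphic_on_paste_across_circle)
    show "open (- K)" using K by (intro open_Compl finite_imp_closed)
    have "(\<lambda>u. fibre_prod u / inner_prod u) holomorphic_on - K \<inter> {u. norm u < 1}"
      by (rule holomorphic_on_subset[OF holomorphic_ratio_inside]) (auto simp: K_def)
    then show "X holomorphic_on - K \<inter> {u. norm u < 1}"
      by (rule holomorphic_transform) (auto simp: X_def \<rho>_def)
    have "(\<lambda>u. 1 / u) holomorphic_on - K \<inter> {u. 1 < norm u}" by (intro holomorphic_intros) auto
    moreover have "(\<lambda>u. 1 / u) ` (- K \<inter> {u. 1 < norm u}) \<subseteq> cnj -` (ball 0 1 - critical)"
      using K_refl by (auto simp: norm_divide divide_less_eq_1)
    ultimately have ih: "((\<lambda>u. inner_prod (cnj u)) \<circ> (\<lambda>u. 1 / u)) holomorphic_on - K \<inter> {u. 1 < norm u}"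
      by (rule holomorphic_on_compose_gen[OF _ antiholomorphic_inner_prod])
    have fh: "fibre_prod holomorphic_on - K \<inter> {u. 1 < norm u}"
      by (rule holomorphic_on_subset[OF holomorphic_fibre_prod_outside]) (auto simp: K_def)
    have "(\<lambda>u. fibre_prod u / ((\<lambda>u. inner_prod (cnj u)) \<circ> (\<lambda>u. 1 / u)) u) holomorphic_on - K \<inter> {u. 1 < norm u}"
      by (rule holomorphic_on_divide[OF fh ih]) (simp add: inner_prod_nz)
    then show "X holomorphic_on - K \<inter> {u. 1 < norm u}"
      by (rule holomorphic_transform) (auto simp: X_def \<rho>_def)
    show "continuous_on (- K) X"
      unfolding X_def
    proof (intro continuous_on_divide)
      show "continuous_on (- K) fibre_prod" by (rule continuous_on_subset[OF continuous_fibre_prod]) (auto simp: K_def)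
      show "continuous_on (- K) (\<lambda>u. inner_prod (\<rho> u))"
        by (rule continuous_on_compose2[OF continuous_inner_prod continuous_on_subset[OF \<rho>_cont]]) (use \<rho>_in in auto)
    qed (use inner_prod_nz in auto)
  qed
  moreover have "\<exists>M. \<forall>u. norm (X u) \<le> M"
  proof -
    obtain M where M: "\<And>z. norm (exp_transform \<Omega> z w) \<le> M" using bounded_exp_transform[OF open_\<Omega> bounded_\<Omega> w] by blast
    obtain \<delta> where \<delta>: "0 < \<delta>" "ball w \<delta> \<subseteq> - closure \<Omega>" using w open_contains_ball[of "- closure \<Omega>"] by auto
    define M' where "M' = max M 1"
    define \<delta>' where "\<delta>' = min \<delta> 1"
    have \<delta>': "0 < \<delta>'" "\<delta>' \<le> 1" using \<delta> by (auto simp: \<delta>'_def)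
    have "norm (X u) \<le> M' ^ degree A / \<delta>' ^ degree A" for u
    proof -
      have "norm (fibre_prod u) = (\<Prod>z\<in>fibre u. norm (exp_transform \<Omega> z w))" unfolding fibre_prod_def by (rule prod_norm[symmetric])
      also have "\<dots> \<le> (\<Prod>z\<in>fibre u. M')" using M by (intro prod_mono) (auto simp: M'_def le_max_iff_disj)
      also have "\<dots> = M' ^ card (fibre u)" by simp
      also have "\<dots> \<le> M' ^ degree A" using card_fibre_le by (intro power_increasing) (auto simp: M'_def)
      finally have 1: "norm (fibre_prod u) \<le> M' ^ degree A" .
      have "\<delta>' ^ degree A \<le> \<delta>' ^ card (fibre (\<rho> u) \<inter> closure \<Omega>)"
        using card_mono[OF finite_fibre, of "fibre (\<rho> u) \<inter> closure \<Omega>" "\<rho> u"] card_fibre_le[of "\<rho> u"] \<delta>' by (intro power_decreasing) auto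
      also have "\<dots> = (\<Prod>z\<in>fibre (\<rho> u) \<inter> closure \<Omega>. \<delta>')" by simp
      also have "\<dots> \<le> (\<Prod>z\<in>fibre (\<rho> u) \<inter> closure \<Omega>. norm (cnj z - cnj w))"
      proof (intro prod_mono conjI)
        fix z assume "z \<in> fibre (\<rho> u) \<inter> closure \<Omega>"
        then have "z \<notin> ball w \<delta>" using \<delta> by blast
        then show "\<delta>' \<le> norm (cnj z - cnj w)"
          by (simp add: \<delta>'_def dist_norm norm_minus_commute flip: complex_cnj_diff)
      qed (use \<delta>' in auto)
      also have "\<dots> = norm (inner_prod (\<rho> u))" unfolding inner_prod_def by (rule prod_norm)
      finally have 2: "\<delta>' ^ degree A \<le> norm (inner_prod (\<rho> u))" .
      show ?thesis unfolding X_def norm_divide using 1 2 \<delta>' by (intro frac_le) (auto simp: M'_def)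
    qed
    then show ?thesis by blast
  qed
  ultimately obtain c where c: "\<And>u. u \<notin> K \<Longrightarrow> X u = c"
    using bounded_holomorphic_finite_exception_constant[OF K, of X] by metis
  have "(\<Prod>z\<in>fibre u. exp_transform \<Omega> z w) = c * (\<Prod>\<zeta>\<in>fibre (1 / cnj u) \<inter> \<Omega>. cnj \<zeta> - cnj w)"
    if u: "1 < norm u" "u \<notin> critical" "1 / cnj u \<notin> critical" for u
  proof -
    have "u \<notin> K" using u by (auto simp: K_def)
    have nc: "norm (1 / cnj u) < 1" using u by (simp add: norm_divide divide_less_eq_1)
    have "z \<in> \<Omega>" if "z \<in> fibre (1 / cnj u) \<inter> closure \<Omega>" for z
      using that nc fibre_f[of z "1 / cnj u"] by (intro in_closure_less_imp_in) auto
    then have "fibre (1 / cnj u) \<inter> closure \<Omega> = fibre (1 / cnj u) \<inter> \<Omega>" using closure_subset[of \<Omega>] by blast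
    then have "X u = (\<Prod>z\<in>fibre u. exp_transform \<Omega> z w) / (\<Prod>\<zeta>\<in>fibre (1 / cnj u) \<inter> \<Omega>. cnj \<zeta> - cnj w)"
      using u by (simp add: X_def \<rho>_def fibre_prod_def inner_prod_def)
    moreover have "(\<Prod>\<zeta>\<in>fibre (1 / cnj u) \<inter> \<Omega>. cnj \<zeta> - cnj w) \<noteq> 0"
      using w closure_subset[of \<Omega>] finite_fibre by auto
    ultimately show ?thesis using c[OF \<open>u \<notin> K\<close>] by (simp add: field_simps)
  qed
  then show ?thesis by blast
qed

end

end

section \<open>Orders along a curve that is linear in one variable\<close>

text \<open>The polynomial u a - b is linear in u, so that pseudo-division of N leaves a remainder \<rho> in y alone, and \<rho> vanishes at
every common zero. If \<rho> = 0, then u a - b divides a multiple c N with c in y alone; as it has content 1, it divides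
N by Gauss's lemma.\<close>

lemma linear_curve_dvd_or_finite:
  fixes a b :: "complex poly" and N :: "complex poly poly"
  assumes ab: "coprime a b" "a \<noteq> 0" and ndvd: "\<not> [:- b, a:] dvd N"
  shows "finite {Y. \<exists>u. poly (smult u a - b) Y = 0 \<and> poly (poly N [:u:]) Y = 0}"
proof -
  let ?q = "[:- b, a:]"
  have q: "?q \<noteq> 0" "degree ?q = 1" using ab by auto
  obtain c s where c: "c \<noteq> 0" "smult c N = ?q * s + pseudo_mod N ?q" using pseudo_mod(1)[OF q(1)] by blast
  obtain \<rho> where \<rho>: "pseudo_mod N ?q = [:\<rho>:]"
    using pseudo_mod(2)[OF q(1), of N] q(2) by (metis degree_eq_zeroE degree_0 less_one)
  have "\<rho> \<noteq> 0"
  proof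
    assume "\<rho> = 0"
    then have eq: "smult c N = ?q * s" using c \<rho> by simp
    have cq: "content ?q = 1"
    proof -
      have "content ?q dvd coeff ?q 0" "content ?q dvd coeff ?q 1" by (rule content_dvd_coeff)+
      then have "content ?q dvd a" "content ?q dvd b" by auto
      then have "is_unit (content ?q)" using ab(1) by (metis coprime_common_divisor)
      then show ?thesis by simp
    qed
    have "content (smult c N) = content s" unfolding eq by (simp add: content_mult cq del: mult_pCons_left)
    then have "c dvd content s" by (simp add: content_smult)
      (metis dvd_triv_left dvd_normalize_iff normalize_mult normalize_content)
    then have "[:c:] dvd s" by (simp add: const_poly_dvd_iff_dvd_content)
    then obtain s' where "s = [:c:] * s'" by (elim dvdE)
    then have "smult c N = smult c (?q * s')" using eq by (simp add: mult.left_commute)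
    then have "N = ?q * s'" using c(1) by (metis smult_eq_iff smult_smult smult_cancel)
    then show False using ndvd by (metis dvd_triv_left)
  qed
  have "{Y. \<exists>u. poly (smult u a - b) Y = 0 \<and> poly (poly N [:u:]) Y = 0} \<subseteq> {Y. poly \<rho> Y = 0}"
  proof clarify
    fix Y u assume Y: "poly (smult u a - b) Y = 0" "poly (poly N [:u:]) Y = 0"
    have "poly (poly (smult c N) [:u:]) Y = poly (poly (?q * s + [:\<rho>:]) [:u:]) Y" using c(2) \<rho> by simp
    then have "poly \<rho> Y = - (u * poly a Y - poly b Y) * poly (poly s [:u:]) Y" using Y(2) by (simp add: algebra_simps)
    then show "poly \<rho> Y = 0" using Y(1) by simp
  qed
  then show ?thesis using poly_roots_finite[OF \<open>\<rho> \<noteq> 0\<close>] finite_subset by blast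
qed

text \<open>A polynomial vanishes to the same order along an irreducible curve at all but finitely many of its points. Here a polynomial in
u with coefficients in y is restricted to lines of constant u; apart from finitely many
points, the order where such a line meets the curve transversally is the number of factors u a - b that it contains.\<close>

lemma order_along_linear_curve:
  fixes a b :: "complex poly" and N :: "complex poly poly"
  assumes ab: "coprime a b" "a \<noteq> 0" and N: "N \<noteq> 0"
  shows "\<exists>m X. finite X \<and> (\<forall>u Y. Y \<notin> X \<longrightarrow> smult u a - b \<noteq> 0 \<longrightarrow> order Y (smult u a - b) = 1 \<longrightarrow>
     poly N [:u:] \<noteq> 0 \<and> order Y (poly N [:u:]) = m)"
  using N
proof (induction "degree N" arbitrary: N rule: less_induct)
  case less
  let ?q = "[:- b, a:]"
  show ?case
  proof (cases "?q dvd N")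
    case False
    let ?X = "{Y. \<exists>u. poly (smult u a - b) Y = 0 \<and> poly (poly N [:u:]) Y = 0}"
    have "finite ?X" by (rule linear_curve_dvd_or_finite[OF ab False])
    moreover have "poly N [:u:] \<noteq> 0 \<and> order Y (poly N [:u:]) = 0"
      if "Y \<notin> ?X" "smult u a - b \<noteq> 0" "order Y (smult u a - b) = 1" for u Y
    proof -
      have "poly (smult u a - b) Y = 0" using that by (metis order_root zero_neq_one)
      then have "poly (poly N [:u:]) Y \<noteq> 0" using that(1) by blast
      then show ?thesis by (auto simp: order_0I)
    qed
    ultimately show ?thesis by blast
  next
    case True
    then obtain N1 where N1: "N = ?q * N1" by (elim dvdE)
    then have "N1 \<noteq> 0" using less.prems by auto
    moreover have "degree N = degree ?q + degree N1" unfolding N1 using \<open>N1 \<noteq> 0\<close> ab by (intro degree_mult_eq) auto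
    then have "degree N1 < degree N" using ab by simp
    ultimately obtain m X where X: "finite X" "\<And>u Y. Y \<notin> X \<Longrightarrow> smult u a - b \<noteq> 0 \<Longrightarrow> order Y (smult u a - b) = 1 \<Longrightarrow>
       poly N1 [:u:] \<noteq> 0 \<and> order Y (poly N1 [:u:]) = m"
      using less.hyps by blast
    have "poly N [:u:] \<noteq> 0 \<and> order Y (poly N [:u:]) = Suc m"
      if "Y \<notin> X" "smult u a - b \<noteq> 0" "order Y (smult u a - b) = 1" for u Y
    proof -
      have "poly N [:u:] = (smult u a - b) * poly N1 [:u:]"
        unfolding N1 by (simp add: algebra_simps)
      moreover have "poly N1 [:u:] \<noteq> 0" "order Y (poly N1 [:u:]) = m" using X(2)[OF that] by auto
      ultimately show ?thesis using that order_mult[of "smult u a - b" "poly N1 [:u:]" Y] by auto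
    qed
    then show ?thesis using X(1) by blast
  qed
qed

lemma order_root_factor: "order Y [:c, -1:] = (if Y = c then 1 else 0)" for c :: complex
proof (cases "Y = c")
  case True
  have "order Y [:-Y, 1:] = 1" using order_power_n_n[of Y 1] by simp
  then have "order Y (- [:-Y, 1:]) = 1" by (simp only: order_uminus)
  then show ?thesis using True by simp
qed (auto simp: order_0I)

lemma sum_order_root_factors:
  fixes c :: "'i \<Rightarrow> complex"
  assumes I: "finite I" and S: "finite S" "c ` I \<subseteq> S"
  shows "(\<Sum>Y\<in>S. order Y (\<Prod>i\<in>I. [:c i, -1:])) = card I"
  using I S(2)
proof (induction I rule: finite_induct)
  case (insert i I)
  have "(\<Prod>i\<in>insert i I. [:c i, -1:]) \<noteq> 0" using insert.hyps by (subst prod_zero_iff) auto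
  then have "order Y (\<Prod>i\<in>insert i I. [:c i, -1:]) = (if Y = c i then 1 else 0) + order Y (\<Prod>i\<in>I. [:c i, -1:])" for Y
    using insert.hyps by (simp add: order_mult order_root_factor del: mult_pCons_left)
  then have "(\<Sum>Y\<in>S. order Y (\<Prod>i\<in>insert i I. [:c i, -1:])) = (\<Sum>Y\<in>S. if Y = c i then 1 else 0) + card I"
    using insert by (simp add: sum.distrib)
  also have "(\<Sum>Y\<in>S. if Y = c i then 1 else 0) = (1::nat)" using insert.prems S(1) by simp
  finally show ?case using insert.hyps by simp
qed simp

section \<open>Norms along the fibres\<close>

lemma poly_constant_coeffs: "poly (map_poly (\<lambda>c. [:c:]) l) [:u:] = [:poly l u:]" for l :: "complex poly"
  by (induction l) (auto simp: map_poly_pCons)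

text \<open>Lagrange interpolation turns a function of u and y that is a polynomial in u of bounded degree for each y, and
a polynomial in y for each of finitely many nodes u, into a polynomial in both variables.\<close>

definition lagrange_basis :: "complex set \<Rightarrow> complex \<Rightarrow> complex poly" where
  "lagrange_basis I s = (\<Prod>t\<in>I - {s}. smult (1 / (s - t)) [:- t, 1:])"

lemma poly_lagrange_basis:
  assumes "finite I" "s \<in> I" "u \<in> I"
  shows "poly (lagrange_basis I s) u = (if u = s then 1 else 0)"
proof (cases "u = s")
  case True
  have "poly (smult (1 / (s - t)) [:- t, 1:]) s = 1" if "t \<in> I - {s}" for t
    using that by (auto simp: divide_simps)
  then show ?thesis unfolding lagrange_basis_def poly_prod True by (simp add: prod.neutral)
next
  case False
  then show ?thesis unfolding lagrange_basis_def poly_prod using assms by (auto intro!: prod_zero bexI[of _ u])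
qed

lemma degree_lagrange_basis: "finite I \<Longrightarrow> s \<in> I \<Longrightarrow> degree (lagrange_basis I s) \<le> card I - 1"
proof -
  assume I: "finite I" "s \<in> I"
  have "degree (lagrange_basis I s) \<le> (\<Sum>t\<in>I - {s}. degree (smult (1 / (s - t)) [:- t, 1:]))"
    unfolding lagrange_basis_def
    using degree_prod_sum_le[of "I - {s}" "\<lambda>t. smult (1 / (s - t)) [:- t, 1:]"] I by (simp only: comp_def finite_Diff)
  also have "\<dots> \<le> (\<Sum>t\<in>I - {s}. 1)" by (intro sum_mono) auto
  finally show ?thesis using I by simp
qed

lemma lagrange_interpolation:
  assumes I: "finite I" "degree g < card I"
  shows "(\<Sum>s\<in>I. poly g s * poly (lagrange_basis I s) u) = poly g u"
proof -
  let ?h = "\<Sum>s\<in>I. smult (poly g s) (lagrange_basis I s)"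
  have "?h = g"
  proof (rule poly_eqI_degree[of I])
    show "poly ?h x = poly g x" if x: "x \<in> I" for x
    proof -
      have "poly ?h x = (\<Sum>s\<in>I. poly g s * (if x = s then 1 else 0))"
        using x I by (simp add: poly_sum poly_lagrange_basis)
      also have "\<dots> = (\<Sum>s\<in>I. if x = s then poly g s else 0)" by (rule sum.cong) auto
      finally show ?thesis using x I by simp
    qed
    have "degree ?h \<le> card I - 1"
      using I degree_lagrange_basis by (intro degree_sum_le) (auto intro: order_trans[OF degree_smult_le])
    then show "degree ?h < card I" using I by linarith
  qed (use I in auto)
  then show ?thesis by (metis (no_types, lifting) poly_smult poly_sum sum.cong)
qed

context rational_proper_domain begin

text \<open>The product over the fibre of z - \<beta> is, up to a constant, the value at \<beta> of A - u B, which is linear in u. The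
degree bound is what makes interpolation possible.\<close>

lemma fibre_norm_polynomial:
  "\<exists>g. degree g \<le> degree h \<and> (\<forall>u. u \<notin> critical \<longrightarrow> (\<Prod>z\<in>fibre u. poly h z) = poly g u)"
proof (induction "degree h" arbitrary: h)
  case 0
  then obtain c where "h = [:c:]" by (metis degree_eq_zeroE)
  then show ?case using card_fibre by (intro exI[of _ "[:c ^ degree A:]"]) auto
next
  case (Suc d)
  then have "\<exists>x. poly h x = 0" by (intro alg_closed_imp_poly_has_root) auto
  then obtain \<beta> h1 where h1: "h = [:-\<beta>, 1:] * h1" by (metis poly_eq_0_iff_dvd dvdE)
  then have "h1 \<noteq> 0" using Suc by auto
  then have "degree h = Suc (degree h1)" unfolding h1 by (subst degree_mult_eq) auto
  then obtain g1 where g1: "degree g1 \<le> degree h1" "\<And>u. u \<notin> critical \<Longrightarrow> (\<Prod>z\<in>fibre u. poly h1 z) = poly g1 u"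
    using Suc.hyps(1)[of h1] Suc.hyps(2) by auto
  define l where "l = smult ((-1) ^ degree A / lead_coeff A) [:poly A \<beta>, - poly B \<beta>:]"
  have "(\<Prod>z\<in>fibre u. poly h z) = poly (l * g1) u" if u: "u \<notin> critical" for u
  proof -
    have "poly l u = ((-1) ^ degree A / lead_coeff A) * poly (A - smult u B) \<beta>"
      by (simp add: l_def diff_divide_distrib right_diff_distrib mult_ac)
    also have "poly (A - smult u B) \<beta> = lead_coeff A * (\<Prod>z\<in>fibre u. \<beta> - z)"
      by (subst fibre_poly_decompose[OF u]) (simp add: poly_prod)
    also have "((-1) ^ degree A / lead_coeff A) * (lead_coeff A * (\<Prod>z\<in>fibre u. \<beta> - z)) = (-1) ^ degree A * (\<Prod>z\<in>fibre u. \<beta> - z)"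
      using lead_coeff_A_nz by simp
    also have "\<dots> = (\<Prod>z\<in>fibre u. z - \<beta>)"
    proof -
      have "(\<Prod>z\<in>fibre u. z - \<beta>) = (\<Prod>z\<in>fibre u. (-1) * (\<beta> - z))" by (intro prod.cong) auto
      also have "\<dots> = (-1) ^ card (fibre u) * (\<Prod>z\<in>fibre u. \<beta> - z)" by (simp only: prod.distrib prod_constant)
      finally show ?thesis using card_fibre[OF u] by simp
    qed
    finally have "(\<Prod>z\<in>fibre u. z - \<beta>) = poly l u" ..
    moreover have "poly h z = (z - \<beta>) * poly h1 z" for z by (simp add: h1 algebra_simps)
    ultimately show ?thesis using g1(2)[OF u] by (simp add: prod.distrib)
  qed
  moreover have "degree (l * g1) \<le> degree h"
  proof -
    have "degree l \<le> 1" unfolding l_def by (intro order_trans[OF degree_smult_le]) auto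
    then show ?thesis using degree_mult_le[of l g1] g1(1) \<open>degree h = Suc (degree h1)\<close> by linarith
  qed
  ultimately show ?case by blast
qed

lemma fibre_norm_bivariate:
  "\<exists>N. \<forall>u. u \<notin> critical \<longrightarrow> poly N [:u:] = (\<Prod>z\<in>fibre u. poly P [:z:])"
proof -
  have "infinite (UNIV - critical)" using finite_critical infinite_UNIV_char_0 by (intro Diff_infinite_finite) auto
  then obtain I where I: "I \<subseteq> UNIV - critical" "finite I" "card I = Suc (degree P)"
    using infinite_arbitrarily_large by blast
  define N where "N = (\<Sum>s\<in>I. [:\<Prod>z\<in>fibre s. poly P [:z:]:] * map_poly (\<lambda>c. [:c:]) (lagrange_basis I s))"
  have "poly N [:u:] = (\<Prod>z\<in>fibre u. poly P [:z:])" if u: "u \<notin> critical" for u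
  proof (rule poly_ext)
    fix y
    have pe: "poly (\<Prod>z\<in>fibre v. poly P [:z:]) y = (\<Prod>z\<in>fibre v. poly (slice P y) z)" for v
      by (simp add: poly_prod poly_slice poly2_def)
    obtain g where g: "degree g \<le> degree (slice P y)" "\<And>u. u \<notin> critical \<Longrightarrow> (\<Prod>z\<in>fibre u. poly (slice P y) z) = poly g u"
      using fibre_norm_polynomial by blast
    have "degree (slice P y) \<le> degree P" unfolding slice_def by (rule map_poly_degree_leq)
    then have dg: "degree g < card I" using g(1) I(3) by linarith
    have "poly (poly N [:u:]) y = (\<Sum>s\<in>I. (\<Prod>z\<in>fibre s. poly (slice P y) z) * poly (lagrange_basis I s) u)"
      by (simp add: N_def poly_sum poly_constant_coeffs pe mult.commute)
    also have "\<dots> = (\<Sum>s\<in>I. poly g s * poly (lagrange_basis I s) u)"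
      using I(1) g(2) by (intro sum.cong) auto
    also have "\<dots> = poly g u" by (rule lagrange_interpolation[OF I(2) dg])
    also have "\<dots> = poly (\<Prod>z\<in>fibre u. poly P [:z:]) y" using g(2)[OF u] pe by simp
    finally show "poly (poly N [:u:]) y = poly (\<Prod>z\<in>fibre u. poly P [:z:]) y" .
  qed
  then show ?thesis by blast
qed

lemma coprime_Ac_Bc: "coprime Ac Bc"
proof (rule coprimeI)
  fix d assume d: "d dvd Ac" "d dvd Bc"
  have nocommon: "\<not> (poly Ac y = 0 \<and> poly Bc y = 0)" for y using no_common_zero[of "cnj y"] by (auto simp: poly_Ac poly_Bc)
  have "degree d = 0"
  proof (rule ccontr)
    assume "degree d \<noteq> 0"
    then obtain y where "poly d y = 0" using alg_closed_imp_poly_has_root[of d] by auto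
    then show False using d nocommon[of y] by (metis dvd_trans poly_eq_0_iff_dvd)
  qed
  then obtain c where "d = [:c:]" by (metis degree_eq_zeroE)
  moreover have "c \<noteq> 0" using d nocommon[of 0] calculation by auto
  ultimately show "is_unit d" by (simp add: is_unit_const_poly_iff dvd_field_iff)
qed

lemma Ac_nz: "Ac \<noteq> 0"
  using degree_BA unfolding Ac_def by (auto simp: map_poly_eq_0_iff)

text \<open>The second coordinates y of the points of the curve f z f* y = 1 with f z = u. Their equation u f* y = 1 is linear in u.\<close>
definition "conj_fibre u = cnj ` fibre (1 / cnj u)"

lemma conj_fibre_iff: "u \<noteq> 0 \<Longrightarrow> Y \<in> conj_fibre u \<longleftrightarrow> poly (smult u Ac - Bc) Y = 0"
proof -
  assume u: "u \<noteq> 0"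
  have "Y \<in> conj_fibre u \<longleftrightarrow> cnj Y \<in> fibre (1 / cnj u)" unfolding conj_fibre_def by (metis complex_cnj_cnj image_iff)
  also have "\<dots> \<longleftrightarrow> cnj u * poly A (cnj Y) = poly B (cnj Y)" using u by (auto simp: fibre_def field_simps)
  also have "\<dots> \<longleftrightarrow> cnj (cnj u * poly A (cnj Y)) = cnj (poly B (cnj Y))" by (simp only: complex_cnj_cancel_iff)
  also have "\<dots> \<longleftrightarrow> poly (smult u Ac - Bc) Y = 0" by (simp add: poly_Ac poly_Bc)
  finally show ?thesis .
qed

lemma finite_conj_fibre: "finite (conj_fibre u)"
  unfolding conj_fibre_def by (intro finite_imageI finite_fibre)

lemma card_conj_fibre: "1 / cnj u \<notin> critical \<Longrightarrow> card (conj_fibre u) = degree A"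
  unfolding conj_fibre_def by (subst card_image) (auto simp: inj_on_def card_fibre)

lemma order_conj_fibre:
  assumes u: "u \<noteq> 0" "1 / cnj u \<notin> critical" and Y: "Y \<in> conj_fibre u"
  shows "smult u Ac - Bc \<noteq> 0" "order Y (smult u Ac - Bc) = 1"
proof -
  have pd: "pderiv (map_poly cnj p) = map_poly cnj (pderiv p)" for p
    by (intro poly_eqI) (simp add: coeff_pderiv coeff_map_poly)
  have root: "poly (smult u Ac - Bc) Y = 0" using Y conj_fibre_iff[OF u(1)] by blast
  have "poly (pderiv (smult u Ac - Bc)) Y \<noteq> 0"
  proof
    assume "poly (pderiv (smult u Ac - Bc)) Y = 0"
    then have "u * poly (map_poly cnj (pderiv A)) Y = poly (map_poly cnj (pderiv B)) Y"
      by (simp add: pderiv_diff pderiv_smult Ac_def Bc_def pd)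
    then have "cnj (u * cnj (poly (pderiv A) (cnj Y))) = cnj (cnj (poly (pderiv B) (cnj Y)))"
      unfolding poly_cnj complex_cnj_cnj by simp
    then have "poly (pderiv A) (cnj Y) = 1 / cnj u * poly (pderiv B) (cnj Y)" using u by (simp add: field_simps)
    moreover have "cnj Y \<in> fibre (1 / cnj u)" using Y unfolding conj_fibre_def by auto
    ultimately show False using u(2) unfolding critical_def fibre_def by blast
  qed
  then show nz: "smult u Ac - Bc \<noteq> 0" by auto
  have "pderiv (smult u Ac - Bc) \<noteq> 0" using \<open>poly (pderiv (smult u Ac - Bc)) Y \<noteq> 0\<close> by auto
  show "order Y (smult u Ac - Bc) = 1"
    using order_pderiv[OF nz root] \<open>poly (pderiv (smult u Ac - Bc)) Y \<noteq> 0\<close> by (simp add: order_0I)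
qed

end

section \<open>Counting orders\<close>

context rational_proper_domain begin

lemma generic_value_exists:
  assumes Z: "countable Z" and T: "finite T"
  obtains u where "1 < norm u" "u \<notin> critical" "1 / cnj u \<notin> critical" "fibre u \<inter> Z = {}" "conj_fibre u \<inter> T = {}"
proof -
  let ?bad = "critical \<union> (\<lambda>v. 1 / cnj v) ` critical \<union> f ` Z \<union> (\<lambda>Y. 1 / cnj (f (cnj Y))) ` T"
  have "countable ?bad" by (intro countable_Un countable_image Z countable_finite[OF T] countable_finite[OF finite_critical])
  moreover have "uncountable {u::complex. 1 < norm u}"
  proof (rule uncountable_open_complex)
    show "open {u::complex. 1 < norm u}" by (intro open_Collect_less continuous_intros)
    have "2 \<in> {u::complex. 1 < norm u}" by simp
    then show "{u::complex. 1 < norm u} \<noteq> {}" by blast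
  qed
  ultimately have "uncountable ({u. 1 < norm u} - ?bad)" by (intro uncountable_minus_countable)
  then obtain u where u: "1 < norm u" "u \<notin> ?bad" by (metis (mono_tags, lifting) DiffE countable_empty equals0I mem_Collect_eq)
  show ?thesis
  proof (rule that[of u])
    show "1 / cnj u \<notin> critical"
    proof
      assume "1 / cnj u \<in> critical"
      then have "1 / cnj (1 / cnj u) \<in> (\<lambda>v. 1 / cnj v) ` critical" by blast
      then show False using u(2) by simp
    qed
    show "fibre u \<inter> Z = {}" using u(2) fibre_f by blast
    show "conj_fibre u \<inter> T = {}"
    proof (rule ccontr)
      assume "conj_fibre u \<inter> T \<noteq> {}"
      then obtain \<zeta> where \<zeta>: "\<zeta> \<in> fibre (1 / cnj u)" "cnj \<zeta> \<in> T" by (auto simp: conj_fibre_def)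
      then have "1 / cnj (f (cnj (cnj \<zeta>))) \<in> (\<lambda>Y. 1 / cnj (f (cnj Y))) ` T" by blast
      then show False using u(2) fibre_f[OF \<zeta>(1)] by simp
    qed
  qed (use u in auto)
qed

lemma on_curve_conj_fibre:
  assumes "z \<in> fibre u" "u \<noteq> 0" "on_curve z s"
  shows "s \<in> conj_fibre u"
proof -
  have "u * poly B z * poly Ac s = poly B z * poly Bc s"
    using assms by (simp add: fibre_def curve_eq_def)
  then have "u * poly Ac s = poly Bc s" using fibre_B_nz[OF assms(1)] by (simp add: mult.assoc mult.left_commute)
  then show ?thesis using conj_fibre_iff[OF assms(2)] by simp
qed

end

context rational_exp_transform begin

text \<open>Multiply the relations E Q (s - y) = P (t - y), with y = cnj w, over the fibre of a generic u and insert the product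
formula. The result is an identity c L = R between functions of y, where c does not depend on u, so that L and R have
the same order at each of the n points y of the conjugate fibre once these avoid the zeros that occur for another value u0.
The norms of Q and P contribute constant orders mQ and mP at these points; the factors s - y and t - y contribute
n each in total, and the product formula contributes p. Hence n mQ + n + p = n mP + n.\<close>

lemma degree_dvd_valency: "degree A dvd p"
proof -
  let ?n = "degree A"
  obtain w0 where w0: "w0 \<in> U" using U_nonempty by blast
  obtain Z where Z: "countable Z" "\<And>z. z \<notin> closure \<Omega> \<Longrightarrow> z \<notin> Z \<Longrightarrow> \<exists>s t. matched_by z s t"
    using complement_matched by metis
  define Z' where "Z' = Z \<union> {z. Pw w0 z = 0} \<union> {z. Qw w0 z = 0}"
  have Z': "countable Z'" unfolding Z'_def using Z finite_P_zeros[OF w0] finite_Q_zeros[OF w0] by (simp add: countable_finite)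
  have "\<forall>w\<in>U. \<exists>c. \<forall>u. 1 < norm u \<longrightarrow> u \<notin> critical \<longrightarrow> 1 / cnj u \<notin> critical \<longrightarrow>
     (\<Prod>z\<in>fibre u. E w z) = c * (\<Prod>\<zeta>\<in>fibre (1 / cnj u) \<inter> \<Omega>. cnj \<zeta> - cnj w)"
    using product_formula U_notin by blast
  then obtain c where c: "\<And>w u. w \<in> U \<Longrightarrow> 1 < norm u \<Longrightarrow> u \<notin> critical \<Longrightarrow> 1 / cnj u \<notin> critical \<Longrightarrow>
     (\<Prod>z\<in>fibre u. E w z) = c w * (\<Prod>\<zeta>\<in>fibre (1 / cnj u) \<inter> \<Omega>. cnj \<zeta> - cnj w)"
    by metis
  have slice_eq: "poly (poly P [:z:]) (cnj w) = Pw w z" "poly (poly Q [:z:]) (cnj w) = Qw w z" for z w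
    by (simp_all add: poly_slice poly2_def)
  obtain NP where NP: "\<And>u. u \<notin> critical \<Longrightarrow> poly NP [:u:] = (\<Prod>z\<in>fibre u. poly P [:z:])" using fibre_norm_bivariate by blast
  obtain NQ where NQ: "\<And>u. u \<notin> critical \<Longrightarrow> poly NQ [:u:] = (\<Prod>z\<in>fibre u. poly Q [:z:])" using fibre_norm_bivariate by blast
  have PQ_nz: "(\<Prod>z\<in>fibre u. poly P [:z:]) \<noteq> 0" "(\<Prod>z\<in>fibre u. poly Q [:z:]) \<noteq> 0" if "fibre u \<inter> Z' = {}" for u
  proof -
    have "poly P [:z:] \<noteq> 0" "poly Q [:z:] \<noteq> 0" if "z \<in> fibre u" for z
      using that \<open>fibre u \<inter> Z' = {}\<close> slice_eq[of z w0] by (auto simp: Z'_def)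
    then show "(\<Prod>z\<in>fibre u. poly P [:z:]) \<noteq> 0" "(\<Prod>z\<in>fibre u. poly Q [:z:]) \<noteq> 0" by (auto simp: finite_fibre)
  qed
  have "NP \<noteq> 0" "NQ \<noteq> 0"
  proof -
    obtain u where u: "u \<notin> critical" "fibre u \<inter> Z' = {}" using generic_value_exists[OF Z' finite.emptyI] by metis
    have "poly NP [:u:] \<noteq> 0" "poly NQ [:u:] \<noteq> 0"
      unfolding NP[OF u(1)] NQ[OF u(1)] by (rule PQ_nz[OF u(2)])+
    then show "NP \<noteq> 0" "NQ \<noteq> 0" by (metis poly_0)+
  qed
  then obtain mP XP mQ XQ where X: "finite XP" "finite XQ"
    and mP: "\<And>u Y. Y \<notin> XP \<Longrightarrow> smult u Ac - Bc \<noteq> 0 \<Longrightarrow> order Y (smult u Ac - Bc) = 1 \<Longrightarrow> order Y (poly NP [:u:]) = mP"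
    and mQ: "\<And>u Y. Y \<notin> XQ \<Longrightarrow> smult u Ac - Bc \<noteq> 0 \<Longrightarrow> order Y (smult u Ac - Bc) = 1 \<Longrightarrow> order Y (poly NQ [:u:]) = mQ"
    using order_along_linear_curve[OF coprime_Ac_Bc Ac_nz] by (metis (no_types, lifting))
  have key: "\<exists>L R. L \<noteq> 0 \<and> R \<noteq> 0 \<and> (\<forall>w\<in>U. c w * poly L (cnj w) = poly R (cnj w)) \<and>
      (\<Sum>Y\<in>conj_fibre u. order Y L) = ?n * mQ + ?n + p \<and> (\<Sum>Y\<in>conj_fibre u. order Y R) = ?n * mP + ?n"
    if u: "1 < norm u" "u \<notin> critical" "1 / cnj u \<notin> critical" "fibre u \<inter> Z' = {}" "conj_fibre u \<inter> (XP \<union> XQ) = {}" for u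
  proof -
    have u0: "u \<noteq> 0" using u by auto
    have "\<forall>z\<in>fibre u. \<exists>s t. matched_by z s t"
      using Z(2) fibre_outside[OF u(1)] u(4) unfolding Z'_def by blast
    then obtain s t where st: "\<And>z. z \<in> fibre u \<Longrightarrow> matched_by z (s z) (t z)" by metis
    define LQ Ls L\<zeta> RP Rt where "LQ = (\<Prod>z\<in>fibre u. poly Q [:z:])" and "Ls = (\<Prod>z\<in>fibre u. [:s z, -1:])"
      and "L\<zeta> = (\<Prod>\<zeta>\<in>fibre (1 / cnj u) \<inter> \<Omega>. [:cnj \<zeta>, -1:])"
      and "RP = (\<Prod>z\<in>fibre u. poly P [:z:])" and "Rt = (\<Prod>z\<in>fibre u. [:t z, -1:])"
    have nz: "LQ \<noteq> 0" "RP \<noteq> 0" "Ls \<noteq> 0" "L\<zeta> \<noteq> 0" "Rt \<noteq> 0"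
      unfolding LQ_def RP_def Ls_def L\<zeta>_def Rt_def using PQ_nz[OF u(4)] by (simp_all add: finite_fibre)
    have rel: "c w * poly (LQ * Ls * L\<zeta>) (cnj w) = poly (RP * Rt) (cnj w)" if w: "w \<in> U" for w
    proof -
      have "c w * poly (LQ * Ls * L\<zeta>) (cnj w)
          = (c w * (\<Prod>\<zeta>\<in>fibre (1 / cnj u) \<inter> \<Omega>. cnj \<zeta> - cnj w)) * (\<Prod>z\<in>fibre u. Qw w z) * (\<Prod>z\<in>fibre u. s z - cnj w)"
        by (simp add: LQ_def Ls_def L\<zeta>_def poly_prod slice_eq)
      also have "\<dots> = (\<Prod>z\<in>fibre u. E w z) * (\<Prod>z\<in>fibre u. Qw w z) * (\<Prod>z\<in>fibre u. s z - cnj w)"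
        by (simp only: c[OF w u(1-3)])
      also have "\<dots> = (\<Prod>z\<in>fibre u. E w z * Qw w z * (s z - cnj w))" by (simp only: prod.distrib)
      also have "\<dots> = (\<Prod>z\<in>fibre u. Pw w z * (t z - cnj w))"
        using st w by (intro prod.cong refl) (auto simp: matched_by_def)
      also have "\<dots> = poly (RP * Rt) (cnj w)" by (simp add: RP_def Rt_def poly_prod slice_eq prod.distrib)
      finally show ?thesis .
    qed
    have s_in: "s ` fibre u \<subseteq> conj_fibre u" and t_in: "t ` fibre u \<subseteq> conj_fibre u"
      using st on_curve_conj_fibre[OF _ u0] by (auto simp: matched_by_def)
    have cards: "card (fibre u) = ?n" "card (conj_fibre u) = ?n" by (auto simp: card_fibre card_conj_fibre u)
    have sQ: "(\<Sum>Y\<in>conj_fibre u. order Y LQ) = ?n * mQ" and sP: "(\<Sum>Y\<in>conj_fibre u. order Y RP) = ?n * mP"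
    proof -
      have "order Y LQ = mQ" "order Y RP = mP" if Y: "Y \<in> conj_fibre u" for Y
        using mP[OF _ order_conj_fibre[OF u0 u(3) Y]] mQ[OF _ order_conj_fibre[OF u0 u(3) Y]] Y u(5) NP[OF u(2)] NQ[OF u(2)]
        by (auto simp: LQ_def RP_def)
      then show "(\<Sum>Y\<in>conj_fibre u. order Y LQ) = ?n * mQ" "(\<Sum>Y\<in>conj_fibre u. order Y RP) = ?n * mP" using cards by auto
    qed
    have ss: "(\<Sum>Y\<in>conj_fibre u. order Y Ls) = ?n" and tt: "(\<Sum>Y\<in>conj_fibre u. order Y Rt) = ?n"
      using sum_order_root_factors[OF finite_fibre finite_conj_fibre s_in] sum_order_root_factors[OF finite_fibre finite_conj_fibre t_in] cards
      by (auto simp: Ls_def Rt_def)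
    have "norm (1 / cnj u) < 1" using u by (simp add: norm_divide divide_less_eq_1)
    then have "card (fibre (1 / cnj u) \<inter> \<Omega>) = p" using u by (intro card_fibre_inside)
    moreover have "(\<Sum>Y\<in>conj_fibre u. order Y L\<zeta>) = card (fibre (1 / cnj u) \<inter> \<Omega>)"
      unfolding L\<zeta>_def by (rule sum_order_root_factors) (auto simp: finite_fibre finite_conj_fibre conj_fibre_def)
    ultimately have zz: "(\<Sum>Y\<in>conj_fibre u. order Y L\<zeta>) = p" by simp
    have "(\<Sum>Y\<in>conj_fibre u. order Y (LQ * Ls * L\<zeta>)) = (\<Sum>Y\<in>conj_fibre u. order Y LQ + order Y Ls + order Y L\<zeta>)"
      using nz by (intro sum.cong refl) (simp add: order_mult)
    then have sL: "(\<Sum>Y\<in>conj_fibre u. order Y (LQ * Ls * L\<zeta>)) = ?n * mQ + ?n + p"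
      by (simp add: sum.distrib sQ ss zz)
    have "(\<Sum>Y\<in>conj_fibre u. order Y (RP * Rt)) = (\<Sum>Y\<in>conj_fibre u. order Y RP + order Y Rt)"
      using nz by (intro sum.cong refl) (simp add: order_mult)
    then have sR: "(\<Sum>Y\<in>conj_fibre u. order Y (RP * Rt)) = ?n * mP + ?n" by (simp add: sum.distrib sP tt)
    show ?thesis using rel sL sR nz by (intro exI[of _ "LQ * Ls * L\<zeta>"] exI[of _ "RP * Rt"]) auto
  qed
  \<comment> \<open>The factor \<open>c\<close> is eliminated by comparison with one fixed value \<open>u0\<close>.\<close>
  obtain u0 where "1 < norm u0" "u0 \<notin> critical" "1 / cnj u0 \<notin> critical" "fibre u0 \<inter> Z' = {}" "conj_fibre u0 \<inter> (XP \<union> XQ) = {}"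
    using generic_value_exists[OF Z' finite_UnI[OF X]] by metis
  from key[OF this] obtain L0 R0 where LR0: "L0 \<noteq> 0" "R0 \<noteq> 0" "\<And>w. w \<in> U \<Longrightarrow> c w * poly L0 (cnj w) = poly R0 (cnj w)"
    by blast
  let ?T = "XP \<union> XQ \<union> {Y. poly L0 Y = 0} \<union> {Y. poly R0 Y = 0}"
  have "finite ?T" using X LR0 by (auto intro: poly_roots_finite)
  then obtain u where u: "1 < norm u" "u \<notin> critical" "1 / cnj u \<notin> critical" "fibre u \<inter> Z' = {}" "conj_fibre u \<inter> ?T = {}"
    using generic_value_exists[OF Z', of ?T] by metis
  have "conj_fibre u \<inter> (XP \<union> XQ) = {}" using u(5) by blast
  from key[OF u(1-4) this] obtain L R where LR: "L \<noteq> 0" "R \<noteq> 0" "\<And>w. w \<in> U \<Longrightarrow> c w * poly L (cnj w) = poly R (cnj w)"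
    "(\<Sum>Y\<in>conj_fibre u. order Y L) = ?n * mQ + ?n + p" "(\<Sum>Y\<in>conj_fibre u. order Y R) = ?n * mP + ?n" by blast
  have "L * R0 = R * L0"
  proof (rule ccontr)
    assume "L * R0 \<noteq> R * L0"
    then have "finite {y. poly (L * R0 - R * L0) y = 0}" by (intro poly_roots_finite) simp
    moreover have "cnj ` U \<subseteq> {y. poly (L * R0 - R * L0) y = 0}"
    proof clarify
      fix w assume w: "w \<in> U"
      have "poly L (cnj w) * poly R0 (cnj w) = poly R (cnj w) * poly L0 (cnj w)"
        unfolding LR(3)[OF w, symmetric] LR0(3)[OF w, symmetric] by simp
      then show "poly (L * R0 - R * L0) (cnj w) = 0" by simp
    qed
    ultimately have "finite (cnj ` U)" by (rule finite_subset[rotated])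
    then have "finite U" by (rule finite_imageD) (auto simp: inj_on_def)
    then show False using uncountable_open_complex[OF U_open U_nonempty] countable_finite by blast
  qed
  moreover have "order Y (L * R0) = order Y L" "order Y (R * L0) = order Y R" if "Y \<in> conj_fibre u" for Y
  proof -
    have "poly L0 Y \<noteq> 0" "poly R0 Y \<noteq> 0" using that u(5) by auto
    then show "order Y (L * R0) = order Y L" "order Y (R * L0) = order Y R"
      using LR LR0 by (simp_all add: order_mult order_0I)
  qed
  ultimately have "(\<Sum>Y\<in>conj_fibre u. order Y L) = (\<Sum>Y\<in>conj_fibre u. order Y R)" by (metis (no_types, lifting) sum.cong)
  then have "?n * mQ + p = ?n * mP" using LR(4,5) by simp
  then show ?thesis by (metis dvd_add_right_iff dvd_triv_left)
qed

end

theorem theorem1p1: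
  fixes \<Omega> :: "complex set" and A B :: "complex poly" and f :: "complex \<Rightarrow> complex"
    and n p :: nat
  assumes "open \<Omega>" and "connected \<Omega>" and "\<Omega> \<noteq> {}" and "bounded \<Omega>"
    and "coprime A B" and "degree A > degree B"
    and "f = (\<lambda>z. poly A z / poly B z)"
    and "\<And>z. z \<in> \<Omega> \<Longrightarrow> poly B z \<noteq> 0"
    and "valent_proper_map p \<Omega> f"
    and "n = max (degree A) (degree B)"
    and "n > p"
  shows "\<not> rational_in_z_cnj_w_on (outside (closure \<Omega>)) (exp_transform \<Omega>)"
proof
  assume "rational_in_z_cnj_w_on (outside (closure \<Omega>)) (exp_transform \<Omega>)"
  then obtain P Q where PQ: "\<forall>z\<in>outside (closure \<Omega>). \<forall>w\<in>outside (closure \<Omega>).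
      poly2 Q z (cnj w) \<noteq> 0 \<and> exp_transform \<Omega> z w = poly2 P z (cnj w) / poly2 Q z (cnj w)"
    unfolding rational_in_z_cnj_w_on_def by blast
  interpret rational_exp_transform \<Omega> A B p P Q
    by unfold_locales (use assms PQ in auto)
  have "degree A \<le> p" using degree_dvd_valency p_pos by (rule dvd_imp_le)
  then show False using assms by simp
qed

end
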